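(* Let $$f(z)=a(z^2-1)+\frac{1}{4a(z^2-1)},\qquad a\in\mathbb C\setminus\{0\},$$ a rational map of degree four. Suppose that $|a|$ is large enough for $f^2=f\circ f$ to be s-Cantor. Then $f$ is not t-Cantor, namely, for any radial $r$ for $f$, the coding map $\phi_r:\Sigma_4\to J_f$ is not one-to-one. In particular, there exists a hyperbolic rational map of degree four which is Cantor but not s-Cantor.
   Context: For a rational map $f$ of degree $d$ with Julia set $J=J_f$: $P=\{f^k(c):c\text{ critical point},k>0\}$; $f$ is hyperbolic if $\overline P\cap J=\emptyset$. $\Sigma_d=\{1,\dots,d\}^{\mathbb N}$ with the product topology. $f$ is Cantor if $J$ is homeomorphic to $\Sigma_d$. A rational map $g$ is s-Cantor if there is a closed topological disc $\overline D\subset\hat{\mathbb C}$ containing no critical value of $g$ with $g^{-1}(\overline D)\subset\overline D$. A radial for $f$ is a collection $r=(l_i)_{i=1,\dots,d}$ of continuous paths $l_i:[0,1]\to\hat{\mathbb C}-P$ with common initial point $\bar x=l_i(0)$ such that $f^{-1}(\bar x)\supset\{l_i(1):i=1,\dots,d\}$. For a path $\gamma$ in $\hat{\mathbb C}-P$ with $\gamma(0)=\bar x$ let $L_i(\gamma)$ be the lift of $\gamma$ by $f$ with $L_i(\gamma)(0)=l_i(1)$. For finite words define inductively $l_{iw}=l_i\,L_i(l_w)$ (concatenation). The coding map is $\phi_r(i_1i_2\cdots)=\lim_{k\to\infty}l_{i_1i_2\cdots i_k}(1)\in J$; when $J$ is a Cantor set it is defined and continuous on all of $\Sigma_d$. $f$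 is t-Cantor if there exists a radial $r$ such that $\phi_r:\Sigma_d\to J$ is a homeomorphism. *)

theory Defs
  imports "HOL-Analysis.Analysis" "HOL-Computational_Algebra.Polynomial"
begin

section \<open>The Riemann sphere\<close>

datatype rsphere = Fin complex | Infty

text \<open>
  The sphere carries the chordal metric, that is, the Euclidean metric of the unit sphere of
  \<open>complex \<times> real\<close> pulled back along inverse stereographic projection. It induces the usual
  topology of the one-point compactification of the plane.
\<close>

fun stereo :: "rsphere \<Rightarrow> complex \<times> real" where
  "stereo (Fin z) = (of_real (2 / ((cmod z)\<^sup>2 + 1)) * z, ((cmod z)\<^sup>2 - 1) / ((cmod z)\<^sup>2 + 1))"
| "stereo Infty = (0, 1)"

lemma inj_stereo: "inj stereo"
proof (rule injI)
  have pos: "0 < (cmod z)\<^sup>2 + 1" for z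
    by (smt (verit) zero_le_power2)
  have third: "((cmod z)\<^sup>2 - 1) / ((cmod z)\<^sup>2 + 1) = 1 - 2 / ((cmod z)\<^sup>2 + 1)" for z
    using pos[of z] by (simp add: field_simps)
  fix x y assume eq: "stereo x = stereo y"
  show "x = y"
  proof (cases x; cases y)
    fix z w assume xy: "x = Fin z" "y = Fin w"
    have "2 / ((cmod z)\<^sup>2 + 1) = 2 / ((cmod w)\<^sup>2 + 1)"
      using eq unfolding xy by (simp add: third)
    moreover have "2 / ((cmod w)\<^sup>2 + 1) \<noteq> 0"
      using pos[of w] by simp
    moreover have "of_real (2 / ((cmod z)\<^sup>2 + 1)) * z = of_real (2 / ((cmod w)\<^sup>2 + 1)) * w"
      using eq unfolding xy by simp
    ultimately have "z = w"
      by (metis mult_left_cancel of_real_eq_0_iff)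
    then show "x = y" using xy by simp
  next
    fix z assume xy: "x = Fin z" "y = Infty"
    have "2 / ((cmod z)\<^sup>2 + 1) = 0"
      using eq unfolding xy by (simp add: third)
    then show "x = y" using pos[of z] by simp
  next
    fix z assume xy: "x = Infty" "y = Fin z"
    have "2 / ((cmod z)\<^sup>2 + 1) = 0"
      using eq unfolding xy by (simp add: third)
    then show "x = y" using pos[of z] by simp
  qed simp
qed

instantiation rsphere :: metric_space
begin

definition dist_rsphere :: "rsphere \<Rightarrow> rsphere \<Rightarrow> real" where
  "dist_rsphere x y = dist (stereo x) (stereo y)"

definition uniformity_rsphere :: "(rsphere \<times> rsphere) filter" where
  "uniformity_rsphere = (INF e\<in>{0 <..}. principal {(x, y). dist x y < e})"

definition open_rsphere :: "rsphere set \<Rightarrow> bool" where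
  "open_rsphere U \<longleftrightarrow> (\<forall>x\<in>U. eventually (\<lambda>(x', y). x' = x \<longrightarrow> y \<in> U) uniformity)"

instance
proof
  show "dist x y = 0 \<longleftrightarrow> x = y" for x y :: rsphere
    using inj_stereo by (auto simp: dist_rsphere_def inj_def)
  show "dist x y \<le> dist x z + dist y z" for x y z :: rsphere
    unfolding dist_rsphere_def by (rule dist_triangle2)
qed (simp_all only: uniformity_rsphere_def open_rsphere_def)

end


section \<open>Rational maps\<close>

text \<open>The value at infinity is the limit of \<open>p / q\<close> there.\<close>

fun rat_fun :: "complex poly \<Rightarrow> complex poly \<Rightarrow> rsphere \<Rightarrow> rsphere" where
  "rat_fun p q (Fin z) = (if poly q z = 0 then Infty else Fin (poly p z / poly q z))"
| "rat_fun p q Infty =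
     (if degree q < degree p then Infty else Fin (coeff p (degree q) / lead_coeff q))"

definition rational_map :: "nat \<Rightarrow> (rsphere \<Rightarrow> rsphere) \<Rightarrow> bool" where
  "rational_map d f \<longleftrightarrow>
     (\<exists>p q. q \<noteq> 0 \<and> coprime p q \<and> d = max (degree p) (degree q) \<and> f = rat_fun p q)"

text \<open>
  Critical points are the points at which the map is not locally injective; for a nonconstant
  rational map these are the zeros of the derivative in local coordinates.
\<close>

definition critical_point :: "(rsphere \<Rightarrow> rsphere) \<Rightarrow> rsphere \<Rightarrow> bool" where
  "critical_point f c \<longleftrightarrow> \<not> (\<exists>U. open U \<and> c \<in> U \<and> inj_on f U)"

definition critical_values :: "(rsphere \<Rightarrow> rsphere) \<Rightarrow> rsphere set" where
  "critical_values f = {f c | c. critical_point f c}"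

definition postcritical_set :: "(rsphere \<Rightarrow> rsphere) \<Rightarrow> rsphere set" where
  "postcritical_set f = {(f ^^ k) c | k c. 0 < k \<and> critical_point f c}"

text \<open>Normality of the family of iterates, with respect to the chordal metric.\<close>

definition iterates_normal_on :: "(rsphere \<Rightarrow> rsphere) \<Rightarrow> rsphere set \<Rightarrow> bool" where
  "iterates_normal_on f U \<longleftrightarrow>
     (\<forall>s :: nat \<Rightarrow> nat. \<exists>r g. strict_mono r \<and>
        (\<forall>K. compact K \<and> K \<subseteq> U \<longrightarrow> uniform_limit K (\<lambda>n. f ^^ (s (r n))) g sequentially))"

definition fatou_set :: "(rsphere \<Rightarrow> rsphere) \<Rightarrow> rsphere set" where
  "fatou_set f = \<Union> {U. open U \<and> iterates_normal_on f U}"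

definition julia_set :: "(rsphere \<Rightarrow> rsphere) \<Rightarrow> rsphere set" where
  "julia_set f = - fatou_set f"

definition hyperbolic :: "(rsphere \<Rightarrow> rsphere) \<Rightarrow> bool" where
  "hyperbolic f \<longleftrightarrow> closure (postcritical_set f) \<inter> julia_set f = {}"


section \<open>Cantor rational maps\<close>

text \<open>
  As \<open>nat\<close> is discrete, the subspace topology inherited from the product topology of
  \<open>nat \<Rightarrow> nat\<close> is the product topology of \<open>{1..d}\<close>.
\<close>

definition symbol_space :: "nat \<Rightarrow> (nat \<Rightarrow> nat) set" where
  "symbol_space d = {w. \<forall>n. w n \<in> {1..d}}"

text \<open>Below, \<open>d\<close> is always meant to be the degree of \<open>f\<close>.\<close>

definition Cantor_map :: "nat \<Rightarrow> (rsphere \<Rightarrow> rsphere) \<Rightarrow> bool" where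
  "Cantor_map d f \<longleftrightarrow> julia_set f homeomorphic symbol_space d"

definition s_Cantor :: "(rsphere \<Rightarrow> rsphere) \<Rightarrow> bool" where
  "s_Cantor g \<longleftrightarrow>
     (\<exists>D. D homeomorphic cball (0::complex) 1 \<and> D \<inter> critical_values g = {} \<and> g -` D \<subseteq> D)"

definition radial :: "nat \<Rightarrow> (rsphere \<Rightarrow> rsphere) \<Rightarrow> (nat \<Rightarrow> real \<Rightarrow> rsphere) \<Rightarrow> bool" where
  "radial d f l \<longleftrightarrow>
     (\<forall>i\<in>{1..d}. path (l i) \<and> path_image (l i) \<subseteq> - postcritical_set f) \<and>
     (\<exists>x. (\<forall>i\<in>{1..d}. pathstart (l i) = x) \<and> {pathfinish (l i) | i. i \<in> {1..d}} \<subseteq> f -` {x})"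

definition is_lift ::
    "(rsphere \<Rightarrow> rsphere) \<Rightarrow> rsphere \<Rightarrow> (real \<Rightarrow> rsphere) \<Rightarrow> (real \<Rightarrow> rsphere) \<Rightarrow> bool" where
  "is_lift f y \<gamma> \<delta> \<longleftrightarrow> path \<delta> \<and> pathstart \<delta> = y \<and> (\<forall>t\<in>{0..1}. f (\<delta> t) = \<gamma> t)"

text \<open>
  For a path avoiding the critical values of \<open>f\<close> and starting at \<open>f y\<close>, the lift starting at
  \<open>y\<close> exists and is unique on \<open>{0..1}\<close>; the choice only concerns irrelevant values outside
  this interval.
\<close>

definition lift_path ::
    "(rsphere \<Rightarrow> rsphere) \<Rightarrow> rsphere \<Rightarrow> (real \<Rightarrow> rsphere) \<Rightarrow> real \<Rightarrow> rsphere" where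
  "lift_path f y \<gamma> = (SOME \<delta>. is_lift f y \<gamma> \<delta>)"

text \<open>The value at the empty word is a dummy, since words are nonempty.\<close>

fun word_path ::
    "(rsphere \<Rightarrow> rsphere) \<Rightarrow> (nat \<Rightarrow> real \<Rightarrow> rsphere) \<Rightarrow> nat list \<Rightarrow> real \<Rightarrow> rsphere" where
  "word_path f l [] = (\<lambda>_. pathstart (l 1))"
| "word_path f l [i] = l i"
| "word_path f l (i # j # w) = l i +++ lift_path f (pathfinish (l i)) (word_path f l (j # w))"

definition coding_seq ::
    "(rsphere \<Rightarrow> rsphere) \<Rightarrow> (nat \<Rightarrow> real \<Rightarrow> rsphere) \<Rightarrow> (nat \<Rightarrow> nat) \<Rightarrow> nat \<Rightarrow> rsphere" where
  "coding_seq f l w k = pathfinish (word_path f l (map w [0..<k]))"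

definition coding_map ::
    "(rsphere \<Rightarrow> rsphere) \<Rightarrow> (nat \<Rightarrow> real \<Rightarrow> rsphere) \<Rightarrow> (nat \<Rightarrow> nat) \<Rightarrow> rsphere" where
  "coding_map f l w = lim (coding_seq f l w)"

text \<open>
  The constant \<open>lim\<close> is total, so the sequences at which the coding map is actually defined are
  recorded separately. If the Julia set is a Cantor set, this is the whole symbol space.
\<close>

definition coding_domain ::
    "nat \<Rightarrow> (rsphere \<Rightarrow> rsphere) \<Rightarrow> (nat \<Rightarrow> real \<Rightarrow> rsphere) \<Rightarrow> (nat \<Rightarrow> nat) set" where
  "coding_domain d f l = {w \<in> symbol_space d. convergent (coding_seq f l w)}"

definition t_Cantor :: "nat \<Rightarrow> (rsphere \<Rightarrow> rsphere) \<Rightarrow> bool" where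
  "t_Cantor d f \<longleftrightarrow>
     (\<exists>l. radial d f l \<and> coding_domain d f l = symbol_space d \<and>
          (\<exists>\<psi>. homeomorphism (symbol_space d) (julia_set f) (coding_map f l) \<psi>))"


section \<open>The family of quartic maps\<close>

fun quartic :: "complex \<Rightarrow> rsphere \<Rightarrow> rsphere" where
  "quartic a (Fin z) =
     (if z\<^sup>2 - 1 = 0 then Infty else Fin (a * (z\<^sup>2 - 1) + 1 / (4 * a * (z\<^sup>2 - 1))))"
| "quartic a Infty = Infty"

end

theory Submission imports Defs "HOL-Complex_Analysis.Complex_Analysis"
begin

text \<open>
  Write \<open>f = J \<circ> h\<close> with \<open>h z = a (z\<^sup>2 - 1)\<close> and \<open>J u = u + 1 / (4 u)\<close>. If \<open>f \<circ> f\<close> is s-Cantor with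
  disc \<open>D\<close>, then all points outside \<open>D\<close> escape (Montel on the complement of \<open>D\<close>), inverse branches
  of the iterates contract near every point outside the postcritical set, and so lifts of paths
  shrink exponentially; this makes the coding map of every radial converge.

  For the non-injectivity, let \<open>x\<close> be the base point and suppose that the endpoints of the radial
  are the four preimages of \<open>x\<close>. A loop \<open>g\<close> at \<open>x\<close> lifts to a path from the endpoint of \<open>l i\<close> to that
  of some \<open>l j\<close>, and adjoining \<open>l i\<close> and the reverse of \<open>l j\<close> gives a new loop at \<open>x\<close>. Only the signs
  that \<open>g\<close> induces on the square roots of \<open>z - 1\<close> and \<open>z + 1\<close> are recorded. Since
  \<open>f z \<mp> 1 = (2 u \<mp> 1)\<^sup>2 / (4 u)\<close> for \<open>u = h z\<close>, they constrain the signs of the four new loops. For a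
  suitable set of good signs, some loop is good, and every good loop moves some word of length two
  and has a good new loop. Hence for every \<open>k\<close> there are two words
  of length \<open>k\<close> that differ in their first two letters and whose points are joined by a lift under
  \<open>f\<^sup>k\<close> of one fixed loop. By compactness, two different sequences have the same code.

  Conversely, an s-Cantor disc of \<open>f\<close> itself contains a radial, whose coding map is injective, so \<open>f\<close>
  is never s-Cantor. For large \<open>a\<close>, an s-Cantor disc of \<open>f \<circ> f\<close> is a round disc from which wedges
  with tips near \<open>\<plusminus>1\<close> are removed.
\<close>


subsection \<open>The sphere as a metric space\<close>

text \<open>The radial is arbitrary, so its loops can only be handled through invariants that are
  computable for every choice of paths. The two signs suffice because the discriminant of
  \<open>u\<^sup>2 - x * u + 1/4\<close> is \<open>x\<^sup>2 - 1\<close>: a loop at \<open>x\<close>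
  exchanges the two values of \<open>u\<close> above \<open>x\<close> exactly if its two signs
  differ, and then it moves every preimage. The signs of a loop do not determine those of its new
  loops. They do so only up to an ambiguity, and reflection resolves it: since
  \<open>- y - 1 = \<i>\<^sup>2 * (y + 1)\<close>, passing from \<open>y\<close> to
  \<open>- y\<close> interchanges the roles of the two roots, so that of the new loops at
  \<open>y\<close> and at \<open>- y\<close> one can be forced to be good. What counts as good has
  to depend on the signs of the radial itself. On the analytic side the obstacle is parity:
  \<open>D\<close> is backward invariant under two steps only. Limits of inverse branches are
  therefore compared at times of equal parity, and itineraries use the sixteen branches of the
  second iterate.\<close>

definition unFin :: "rsphere \<Rightarrow> complex" where
  "unFin x = fst (stereo x) / of_real (1 - snd (stereo x))"

lemma norm_sq_plus_1_pos: "0 < (cmod z)\<^sup>2 + 1"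
  by (smt (verit) zero_le_power2)

lemma of_real_norm_sq_plus_1_neq_0 [simp]: "(complex_of_real (cmod z))\<^sup>2 + 1 \<noteq> 0"
proof -
  have "(complex_of_real (cmod z))\<^sup>2 + 1 = of_real ((cmod z)\<^sup>2 + 1)" by simp
  then show ?thesis using norm_sq_plus_1_pos[of z] by (metis of_real_eq_0_iff less_irrefl)
qed

lemma unFin_Fin [simp]: "unFin (Fin z) = z"
proof -
  have "1 - ((cmod z)\<^sup>2 - 1) / ((cmod z)\<^sup>2 + 1) = 2 / ((cmod z)\<^sup>2 + 1)"
    using norm_sq_plus_1_pos[of z] by (simp add: field_simps)
  then show ?thesis
    using norm_sq_plus_1_pos[of z] by (simp add: unFin_def)
qed

lemma continuous_on_stereo: "continuous_on S stereo"
  by (auto simp: continuous_on_iff dist_rsphere_def)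

lemma continuous_on_Fin [continuous_intros]:
  "continuous_on S g \<Longrightarrow> continuous_on S (\<lambda>x. Fin (g x))"
proof (rule continuous_on_compose2[of UNIV Fin])
  have "continuous_on UNIV (\<lambda>z. stereo (Fin z))"
    using norm_sq_plus_1_pos by (auto intro!: continuous_intros simp: order_less_imp_not_eq2)
  then show "continuous_on UNIV Fin"
    by (simp add: continuous_on_iff dist_rsphere_def)
qed auto

lemma snd_stereo_less_1: "x \<noteq> Infty \<Longrightarrow> snd (stereo x) < 1"
  by (cases x) (simp_all add: norm_sq_plus_1_pos divide_less_eq)

lemma continuous_on_unFin: "continuous_on (- {Infty}) unFin"
  unfolding unFin_def
  by (intro continuous_intros continuous_on_stereo) (auto dest!: snd_stereo_less_1)

lemma homeomorphism_Fin: "homeomorphism UNIV (- {Infty}) Fin unFin"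
proof (rule homeomorphismI)
  show "continuous_on UNIV Fin" by (intro continuous_intros)
  show "Fin (unFin y) = y" if "y \<in> - {Infty}" for y
    using that by (cases y) auto
qed (auto simp: continuous_on_unFin)

lemma open_Fin_image: "open S \<Longrightarrow> open (Fin ` S)"
proof -
  assume S: "open S"
  have "openin (top_of_set (- {Infty})) (Fin ` S)"
    using homeomorphism_imp_open_map[OF homeomorphism_Fin] S by auto
  then show ?thesis
    using openin_open_trans[of "- {Infty}" "Fin ` S"] by auto
qed

lemma compact_Fin_image: "compact S \<Longrightarrow> compact (Fin ` S)"
  by (intro compact_continuous_image continuous_intros)

lemma not_Infty_iff: "x \<noteq> Infty \<longleftrightarrow> (\<exists>z. x = Fin z)"
  by (cases x) auto

lemma dist_Fin_Infty: "dist (Fin z) Infty = 2 / sqrt ((cmod z)\<^sup>2 + 1)"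
proof -
  let ?n = "(cmod z)\<^sup>2 + 1"
  have n: "?n > 0" by (rule norm_sq_plus_1_pos)
  have "1 - ((cmod z)\<^sup>2 - 1) / ?n = 2 / ?n" using n by (simp add: field_simps)
  then have b: "((cmod z)\<^sup>2 - 1) / ?n - 1 = - (2 / ?n)" by simp
  have e: "(2 / ?n * cmod z)\<^sup>2 + (2 / ?n)\<^sup>2 = (2 / ?n)\<^sup>2 * ?n"
    by (simp add: power_mult_distrib power_divide distrib_left)
  have "(2 / x)\<^sup>2 * x = 4 / x" if "x > 0" for x :: real
    using that by (simp add: power2_eq_square)
  then have "(2 / ?n)\<^sup>2 * ?n = 4 / ?n" using n .
  with e have "(2 / ?n * cmod z)\<^sup>2 + (2 / ?n)\<^sup>2 = 4 / ?n" by (rule trans)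
  moreover have "cmod (of_real (2 / ?n) * z) = 2 / ?n * cmod z"
    using n by (simp only: norm_mult norm_of_real abs_of_pos zero_less_divide_iff) simp
  then have "dist (Fin z) Infty = sqrt ((2 / ?n * cmod z)\<^sup>2 + (2 / ?n)\<^sup>2)"
    unfolding dist_rsphere_def stereo.simps dist_norm diff_Pair norm_Pair
    by (simp only: diff_zero b norm_minus_cancel real_norm_def power2_abs power2_minus)
  ultimately show ?thesis by (simp add: real_sqrt_divide)
qed

lemma dist_Fin_Infty_le: "z \<noteq> 0 \<Longrightarrow> dist (Fin z) Infty \<le> 2 / cmod z"
proof -
  assume "z \<noteq> 0"
  moreover have "cmod z \<le> sqrt ((cmod z)\<^sup>2 + 1)" by (rule real_le_rsqrt) simp
  ultimately show ?thesis unfolding dist_Fin_Infty by (intro divide_left_mono mult_pos_pos) (auto simp: norm_sq_plus_1_pos)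
qed

subsection \<open>Iteration of the quartic map\<close>

definition qf :: "complex \<Rightarrow> complex \<Rightarrow> complex" where
  "qf a z = a * (z\<^sup>2 - 1) + 1 / (4 * a * (z\<^sup>2 - 1))"

abbreviation iter :: "complex \<Rightarrow> nat \<Rightarrow> complex \<Rightarrow> rsphere" where
  "iter a n z \<equiv> (quartic a ^^ n) (Fin z)"

lemma quartic_Fin_eq_iff: "quartic a (Fin z) = Fin w \<longleftrightarrow> z\<^sup>2 \<noteq> 1 \<and> w = qf a z"
  by (auto simp: qf_def)

lemma quartic_eq_Fin_iff: "quartic a x = Fin w \<longleftrightarrow> (\<exists>z. x = Fin z \<and> z\<^sup>2 \<noteq> 1 \<and> w = qf a z)"
  by (cases x) (auto simp: qf_def)

lemma quartic_minus [simp]: "quartic a (Fin (- z)) = quartic a (Fin z)"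
  by simp

declare quartic.simps(1) [simp del]

lemma iter_Infty [simp]: "(quartic a ^^ n) Infty = Infty"
  by (induction n) auto

text \<open>Iterating in homogeneous coordinates avoids the case distinction at the poles.\<close>

fun hstep :: "complex \<Rightarrow> complex \<times> complex \<Rightarrow> complex \<times> complex" where
  "hstep a (p, q) = (4 * a\<^sup>2 * (p\<^sup>2 - q\<^sup>2)\<^sup>2 + q ^ 4, 4 * a * (p\<^sup>2 - q\<^sup>2) * q\<^sup>2)"

fun toS :: "complex \<times> complex \<Rightarrow> rsphere" where
  "toS (p, q) = (if q = 0 then Infty else Fin (p / q))"

definition hit :: "complex \<Rightarrow> nat \<Rightarrow> complex \<Rightarrow> complex \<times> complex" where
  "hit a n z = (hstep a ^^ n) (z, 1)"

lemma joukowski_frac: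
  fixes a D Q :: complex
  assumes "a \<noteq> 0" "D \<noteq> 0" "Q \<noteq> 0"
  shows "a * (D / Q) + 1 / (4 * a * (D / Q)) = (4 * a\<^sup>2 * D\<^sup>2 + Q\<^sup>2) / (4 * a * D * Q)"
  using assms by (simp add: field_simps power2_eq_square)

lemma quartic_toS:
  assumes "a \<noteq> 0" "x \<noteq> (0, 0)"
  shows "quartic a (toS x) = toS (hstep a x)" "hstep a x \<noteq> (0, 0)"
proof -
  obtain p q where x: "x = (p, q)" by (cases x)
  have pq: "p\<^sup>2 = q\<^sup>2 \<Longrightarrow> q \<noteq> 0" using assms x by auto
  show "hstep a x \<noteq> (0, 0)"
    using assms pq by (auto simp: x)
  show "quartic a (toS x) = toS (hstep a x)"
  proof (cases "q = 0 \<or> p\<^sup>2 = q\<^sup>2")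
    case True
    then show ?thesis
      using assms pq by (auto simp: x quartic.simps(1) power_divide)
  next
    case False
    then have "(p / q)\<^sup>2 - 1 \<noteq> 0" and e: "(p / q)\<^sup>2 - 1 = (p\<^sup>2 - q\<^sup>2) / q\<^sup>2"
      by (auto simp: field_simps)
    then have "quartic a (toS x) = Fin (a * ((p\<^sup>2 - q\<^sup>2) / q\<^sup>2) + 1 / (4 * a * ((p\<^sup>2 - q\<^sup>2) / q\<^sup>2)))"
      using False by (simp add: x quartic.simps(1))
    moreover have "p\<^sup>2 - q\<^sup>2 \<noteq> 0" using False by simp
    then have "a * ((p\<^sup>2 - q\<^sup>2) / q\<^sup>2) + 1 / (4 * a * ((p\<^sup>2 - q\<^sup>2) / q\<^sup>2))
      = (4 * a\<^sup>2 * (p\<^sup>2 - q\<^sup>2)\<^sup>2 + q ^ 4) / (4 * a * (p\<^sup>2 - q\<^sup>2) * q\<^sup>2)"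
      using False assms(1) joukowski_frac[of a "p\<^sup>2 - q\<^sup>2" "q\<^sup>2"] by simp
    ultimately show ?thesis using False assms by (simp add: x)
  qed
qed

lemma iter_eq_toS:
  assumes "a \<noteq> 0"
  shows "iter a n z = toS (hit a n z)" "hit a n z \<noteq> (0, 0)"
proof -
  have "iter a n z = toS (hit a n z) \<and> hit a n z \<noteq> (0, 0)"
  proof (induction n)
    case (Suc n)
    then show ?case using quartic_toS[OF assms, of "hit a n z"] by (simp add: hit_def)
  qed (simp add: hit_def)
  then show "iter a n z = toS (hit a n z)" "hit a n z \<noteq> (0, 0)" by auto
qed

lemma hit_holomorphic: "(\<lambda>z. fst (hit a n z)) holomorphic_on S" "(\<lambda>z. snd (hit a n z)) holomorphic_on S"
proof -
  have "(\<lambda>z. fst (hit a n z)) holomorphic_on S \<and> (\<lambda>z. snd (hit a n z)) holomorphic_on S"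
  proof (induction n)
    case (Suc n)
    have "fst (hit a (Suc n) z) = 4 * a\<^sup>2 * ((fst (hit a n z))\<^sup>2 - (snd (hit a n z))\<^sup>2)\<^sup>2 + snd (hit a n z) ^ 4"
      "snd (hit a (Suc n) z) = 4 * a * ((fst (hit a n z))\<^sup>2 - (snd (hit a n z))\<^sup>2) * (snd (hit a n z))\<^sup>2" for z
      by (cases "hit a n z"; simp add: hit_def)+
    with Suc show ?case by (auto intro!: holomorphic_intros)
  qed (auto simp: hit_def intro!: holomorphic_intros)
  then show "(\<lambda>z. fst (hit a n z)) holomorphic_on S" "(\<lambda>z. snd (hit a n z)) holomorphic_on S" by auto
qed

lemma iter_eq_Fin_iff:
  assumes "a \<noteq> 0"
  shows "iter a n z = Fin w \<longleftrightarrow> snd (hit a n z) \<noteq> 0 \<and> fst (hit a n z) = w * snd (hit a n z)"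
proof -
  obtain p q where "hit a n z = (p, q)" by fastforce
  then show ?thesis using iter_eq_toS[OF assms, of n z] by auto
qed

text \<open>The form of an iterate to which Montel's theorem and the identity theorem apply. Where
  the iterate is infinite the division yields the default value 0, so uses are guarded by
  finiteness.\<close>

definition phi :: "complex \<Rightarrow> nat \<Rightarrow> complex \<Rightarrow> complex" where
  "phi a n z = fst (hit a n z) / snd (hit a n z)"

lemma phi_eq: "a \<noteq> 0 \<Longrightarrow> iter a n z = Fin w \<Longrightarrow> phi a n z = w"
  by (auto simp: iter_eq_Fin_iff phi_def)

lemma phi_holomorphic:
  assumes "a \<noteq> 0" "\<And>z. z \<in> S \<Longrightarrow> iter a n z \<noteq> Infty"
  shows "phi a n holomorphic_on S"
proof -
  have "snd (hit a n z) \<noteq> 0" if "z \<in> S" for z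
    using assms(2)[OF that] unfolding not_Infty_iff iter_eq_Fin_iff[OF assms(1)] by auto
  then show ?thesis unfolding phi_def by (intro holomorphic_intros hit_holomorphic) auto
qed

lemma iter_phi: "a \<noteq> 0 \<Longrightarrow> iter a n z \<noteq> Infty \<Longrightarrow> iter a n z = Fin (phi a n z)"
  by (metis not_Infty_iff phi_eq)

subsection \<open>Escape\<close>

text \<open>The summand \<open>8 / cmod a\<close> gives \<open>cmod a * cmod z \<ge> 8\<close>
  beyond this radius; there the quadratic term dominates and the modulus at least doubles, see
  \<open>qf_growth\<close>.\<close>

definition escR :: "complex \<Rightarrow> real" where "escR a = 2 + 8 / cmod a"

definition big :: "complex \<Rightarrow> rsphere \<Rightarrow> bool" where
  "big a x \<longleftrightarrow> (\<forall>w. x = Fin w \<longrightarrow> cmod w > escR a)"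

lemma escR_ge: "escR a \<ge> 2"
  by (simp add: escR_def)

lemma big_simps [simp]: "big a Infty" "big a (Fin w) \<longleftrightarrow> cmod w > escR a"
  by (auto simp: big_def)

lemma qf_growth:
  assumes a: "a \<noteq> 0" and z: "cmod z \<ge> escR a"
  shows "cmod (qf a z) \<ge> 2 * cmod z"
proof -
  have z2: "cmod z \<ge> 2" using z escR_ge[of a] by simp
  have "cmod z \<ge> 8 / cmod a" using z by (simp add: escR_def)
  then have az: "cmod a * cmod z \<ge> 8" using a by (simp add: field_simps)
  have "cmod (z\<^sup>2 - 1) \<ge> (cmod z)\<^sup>2 - 1"
    by (metis norm_one norm_power norm_triangle_ineq2)
  moreover have "(cmod z)\<^sup>2 \<ge> 4" using power_mono[OF z2, of 2] by simp
  ultimately have w: "cmod (z\<^sup>2 - 1) \<ge> 3/4 * (cmod z)\<^sup>2" by simp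
  have "cmod a * cmod (z\<^sup>2 - 1) \<ge> cmod a * (3/4 * (cmod z)\<^sup>2)"
    using w by (intro mult_left_mono) auto
  moreover have "(cmod a * cmod z) * (3/4 * cmod z) \<ge> 8 * (3/4 * cmod z)"
    using az by (intro mult_right_mono) auto
  ultimately have 1: "cmod (a * (z\<^sup>2 - 1)) \<ge> 6 * cmod z"
    unfolding norm_mult power2_eq_square[of "cmod z"] by (simp add: mult_ac)
  then have "cmod (4 * a * (z\<^sup>2 - 1)) \<ge> 1" using z2 by (simp add: norm_mult)
  then have "cmod (1 / (4 * a * (z\<^sup>2 - 1))) \<le> 1"
    unfolding norm_divide norm_one divide_le_eq_1 by linarith
  then show ?thesis
    using 1 z2 norm_diff_ineq[of "a * (z\<^sup>2 - 1)" "1 / (4 * a * (z\<^sup>2 - 1))"]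
    by (simp add: qf_def)
qed

lemma big_quartic:
  assumes "a \<noteq> 0" "big a x"
  shows "big a (quartic a x)"
  unfolding big_def
proof (intro allI impI)
  fix w assume "quartic a x = Fin w"
  then obtain z where z: "x = Fin z" "w = qf a z" by (auto simp: quartic_eq_Fin_iff)
  then show "escR a < cmod w"
    using assms qf_growth[of a z] escR_ge[of a] by simp
qed

lemma big_iter_mono:
  assumes "a \<noteq> 0" "big a ((quartic a ^^ n) x)" "n \<le> m"
  shows "big a ((quartic a ^^ m) x)"
  using assms(3,2) by (induction m rule: dec_induct) (auto intro: big_quartic[OF assms(1)])

lemma big_iter_growth:
  assumes "a \<noteq> 0" "big a x" "(quartic a ^^ n) x = Fin w"
  shows "cmod w \<ge> 2 ^ n"
  using assms(3)
proof (induction n arbitrary: w)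
  case 0
  then show ?case using assms(2) escR_ge[of a] by auto
next
  case (Suc n)
  then obtain z where z: "(quartic a ^^ n) x = Fin z" "w = qf a z"
    by (auto simp: quartic_eq_Fin_iff)
  have "big a ((quartic a ^^ n) x)" using big_iter_mono[OF assms(1), of 0 x n] assms(2) by simp
  then have "cmod z \<ge> escR a" using z by simp
  then show ?case using Suc.IH[OF z(1)] qf_growth[OF assms(1), of z] z by simp
qed

text \<open>These are the points of the plane with bounded orbit. Under the assumptions of
  \<open>disc\<close> the set turns out to be the Julia set, see \<open>julia_eq\<close>.\<close>

definition filled :: "complex \<Rightarrow> complex set" where
  "filled a = {z. \<forall>n. \<not> big a (iter a n z)}"

lemma filled_notin_Infty: "z \<in> filled a \<Longrightarrow> iter a n z \<noteq> Infty"
  by (metis (mono_tags, lifting) big_simps(1) filled_def mem_Collect_eq)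

lemma filled_subset: "filled a \<subseteq> cball 0 (escR a)"
  by (auto simp: filled_def dest: spec[of _ 0])

text \<open>In homogeneous coordinates the inequality stays meaningful at the poles of the iterate,
  so openness of escape follows from continuity alone.\<close>

lemma big_iter_iff:
  assumes "a \<noteq> 0"
  shows "big a (iter a n z) \<longleftrightarrow> escR a * cmod (snd (hit a n z)) < cmod (fst (hit a n z))"
proof -
  obtain p q where pq: "hit a n z = (p, q)" by fastforce
  have "(p, q) \<noteq> (0, 0)" using iter_eq_toS(2)[OF assms, of n z] pq by simp
  then show ?thesis
    using pq by (auto simp: iter_eq_toS(1)[OF assms] norm_divide pos_less_divide_eq)
qed

lemma open_big_iter: "a \<noteq> 0 \<Longrightarrow> open {z. big a (iter a n z)}"
  unfolding big_iter_iff
  by (intro open_Collect_less continuous_intros holomorphic_on_imp_continuous_on hit_holomorphic)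

lemma filled_compl: "- filled a = (\<Union>n. {z. big a (iter a n z)})"
  by (auto simp: filled_def)

lemma compact_filled: "a \<noteq> 0 \<Longrightarrow> compact (filled a)"
proof -
  assume "a \<noteq> 0"
  then have "open (- filled a)" unfolding filled_compl by (intro open_UN) (auto intro: open_big_iter)
  then have "closed (filled a)" by (simp add: closed_def)
  then show ?thesis
    using filled_subset bounded_cball bounded_subset compact_eq_bounded_closed by blast
qed

lemma filled_iter_iff:
  assumes "a \<noteq> 0" "iter a k z = Fin w"
  shows "z \<in> filled a \<longleftrightarrow> w \<in> filled a"
proof -
  have s: "iter a (n + k) z = iter a n w" for n
    by (simp add: funpow_add assms(2))
  show ?thesis
  proof
    assume "z \<in> filled a"
    then show "w \<in> filled a" unfolding filled_def by (simp flip: s)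
  next
    assume w: "w \<in> filled a"
    have "\<not> big a (iter a n z)" for n
    proof
      assume "big a (iter a n z)"
      then have "big a (iter a (n + k) z)" by (rule big_iter_mono[OF assms(1)]) simp
      then show False using w s by (auto simp: filled_def)
    qed
    then show "z \<in> filled a" by (simp add: filled_def)
  qed
qed

text \<open>Having escaped at time \<open>n\<close> is an open condition and persists, and
  afterwards the modulus doubles at every step. So one time and one rate serve a whole
  neighbourhood.\<close>

lemma escape_nbhd:
  assumes "a \<noteq> 0" "z \<notin> filled a"
  obtains d n where "d > 0" "\<And>z' m w. z' \<in> ball z d \<Longrightarrow> n \<le> m \<Longrightarrow> iter a m z' = Fin w \<Longrightarrow> cmod w \<ge> 2 ^ (m - n)"
    "\<And>z' m. z' \<in> ball z d \<Longrightarrow> n \<le> m \<Longrightarrow> big a (iter a m z')"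
proof -
  obtain n where n: "big a (iter a n z)" using assms by (auto simp: filled_def)
  obtain d where d: "d > 0" "ball z d \<subseteq> {z. big a (iter a n z)}"
    using open_big_iter[OF assms(1), of n] n unfolding open_contains_ball by blast
  show thesis
  proof (rule that[OF d(1)])
    fix z' m w assume z': "z' \<in> ball z d" "n \<le> m"
    have b: "big a (iter a n z')" using d z' by auto
    then show "big a (iter a m z')" by (rule big_iter_mono[OF assms(1) _ z'(2)])
    assume "iter a m z' = Fin w"
    then have "(quartic a ^^ (m - n)) (iter a n z') = Fin w"
      using z'(2) by (simp flip: funpow_add[unfolded comp_def, THEN fun_cong])
    then show "cmod w \<ge> 2 ^ (m - n)" using big_iter_growth[OF assms(1) b] by simp
  qed
qed


subsection \<open>Lifts\<close>

text \<open>The critical points with \<open>u = \<plusminus>1/2\<close> are sent to \<plusminus>1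
  and then to infinity, which is fixed. Hence apart from \<plusminus>1 the finite postcritical
  points all lie on the orbit of 0.\<close>

definition postcrit :: "complex \<Rightarrow> complex set" where
  "postcrit a = {1, - 1} \<union> {w. \<exists>k>0. iter a k 0 = Fin w}"

lemma iter_add: "iter a n z = Fin w \<Longrightarrow> iter a (m + n) z = iter a m w"
  by (simp add: funpow_add)

lemma iter_Suc_pole: "z\<^sup>2 = 1 \<Longrightarrow> iter a (Suc n) z = Infty"
  by (simp add: funpow_Suc_right quartic.simps(1) del: funpow.simps)

text \<open>The complement of the postcritical set is backward invariant, so a lift that avoids it
  can be lifted again.\<close>

lemma postcrit_back:
  assumes "iter a n z = Fin w" "w \<notin> postcrit a"
  shows "z \<notin> postcrit a"
proof
  assume "z \<in> postcrit a"
  then consider "z\<^sup>2 = 1" | k where "k > 0" "iter a k 0 = Fin z" by (auto simp: postcrit_def)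
  then show False
  proof cases
    case 1
    then have "n = 0" using assms iter_Suc_pole[of z] by (cases n) auto
    with 1 assms show False by (auto simp: postcrit_def power2_eq_1_iff)
  next
    case 2
    then have "iter a (n + k) 0 = Fin w" using iter_add[OF 2(2), of n] assms(1) by simp
    moreover have "0 < n + k" using 2(1) by simp
    ultimately show False using assms(2) unfolding postcrit_def by blast
  qed
qed

lemma qf_0_postcrit: "qf a 0 \<in> postcrit a"
  unfolding postcrit_def by (auto simp: quartic_Fin_eq_iff intro!: exI[of _ "1::nat"])

lemma pm1_postcrit: "1 \<in> postcrit a" "- 1 \<in> postcrit a"
  by (auto simp: postcrit_def)

text \<open>Over the unit interval this is a lifted path; over a region with \<open>g\<close> the
  identity it is an inverse branch of the \<open>n\<close>-th iterate. One notion for both lets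
  paths be pushed through branches.\<close>

definition lifts :: "complex \<Rightarrow> nat \<Rightarrow> 'a::topological_space set \<Rightarrow> ('a \<Rightarrow> complex) \<Rightarrow> ('a \<Rightarrow> complex) \<Rightarrow> bool"
  where "lifts a n S g L \<longleftrightarrow> continuous_on S L \<and> (\<forall>x\<in>S. iter a n (L x) = Fin (g x))"

lemma liftsD: "lifts a n S g L \<Longrightarrow> x \<in> S \<Longrightarrow> iter a n (L x) = Fin (g x)"
  by (simp add: lifts_def)

lemma lifts_cont: "lifts a n S g L \<Longrightarrow> continuous_on S L"
  by (simp add: lifts_def)

lemma lifts_subset: "lifts a n S g L \<Longrightarrow> T \<subseteq> S \<Longrightarrow> lifts a n T g L"
  by (auto simp: lifts_def intro: continuous_on_subset)

lemma lifts_cong: "lifts a n S g L \<Longrightarrow> (\<And>x. x \<in> S \<Longrightarrow> g x = g' x) \<Longrightarrow> lifts a n S g' L"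
  by (auto simp: lifts_def)

lemma lifts_compose:
  "lifts a m S g g1 \<Longrightarrow> lifts a n S g1 L \<Longrightarrow> lifts a (m + n) S g L"
  by (auto simp: lifts_def funpow_add)

lemma lifts_precomp:
  "lifts a n S g L \<Longrightarrow> continuous_on T h \<Longrightarrow> h ` T \<subseteq> S \<Longrightarrow> lifts a n T (\<lambda>x. g (h x)) (\<lambda>x. L (h x))"
  by (auto simp: lifts_def intro: continuous_on_compose2)

lemma lifts_push:
  assumes "a \<noteq> 0" "lifts a (m + n) S g L"
  shows "lifts a m S g (\<lambda>x. phi a n (L x))" "lifts a n S (\<lambda>x. phi a n (L x)) L"
proof -
  have fin: "iter a n (L x) \<noteq> Infty" if "x \<in> S" for x
    using liftsD[OF assms(2) that] by (auto simp: funpow_add)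
  then have e: "iter a n (L x) = Fin (phi a n (L x))" if "x \<in> S" for x
    using iter_phi[OF assms(1)] that by blast
  have "phi a n holomorphic_on L ` S"
    by (rule phi_holomorphic[OF assms(1)]) (use fin in auto)
  then have "continuous_on (L ` S) (phi a n)"
    by (rule holomorphic_on_imp_continuous_on)
  then have "continuous_on S (\<lambda>x. phi a n (L x))"
    using lifts_cont[OF assms(2)] by (rule continuous_on_compose2) auto
  then show "lifts a m S g (\<lambda>x. phi a n (L x))" "lifts a n S (\<lambda>x. phi a n (L x)) L"
    using assms(2) e by (auto simp: lifts_def funpow_add)
qed

lemma lifts_notin_postcrit: "lifts a n S g L \<Longrightarrow> x \<in> S \<Longrightarrow> g x \<notin> postcrit a \<Longrightarrow> L x \<notin> postcrit a"
  using postcrit_back liftsD by blast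

text \<open>Multiply \<open>w = u + 1 / (4 * u)\<close> by \<open>u\<close>. The quadratic has
  nonzero constant term and thereby excludes \<open>u = 0\<close>, that is, the poles.\<close>

lemma qf_eq_iff:
  assumes "a \<noteq> 0"
  shows "quartic a (Fin z) = Fin w \<longleftrightarrow> (let u = a * (z\<^sup>2 - 1) in u\<^sup>2 - w * u + 1/4 = 0)"
proof (cases "z\<^sup>2 = 1")
  case False
  then have "a * (z\<^sup>2 - 1) \<noteq> 0" using assms by simp
  moreover have "w = u + 1 / (4 * u) \<longleftrightarrow> u\<^sup>2 - w * u + 1/4 = 0" if "u \<noteq> 0" for u
  proof -
    have "w = u + 1 / (4 * u) \<longleftrightarrow> w * (4 * u) = (u + 1 / (4 * u)) * (4 * u)" using that by simp
    also have "(u + 1 / (4 * u)) * (4 * u) = 4 * u\<^sup>2 + 1"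
      using that by (simp add: distrib_right power2_eq_square)
    also have "w * (4 * u) = 4 * u\<^sup>2 + 1 \<longleftrightarrow> (4 * u\<^sup>2 + 1) - w * (4 * u) = 0"
      by (simp only: right_minus_eq) auto
    also have "(4 * u\<^sup>2 + 1) - w * (4 * u) = 4 * (u\<^sup>2 - w * u + 1/4)"
      by (simp add: algebra_simps)
    also have "4 * (u\<^sup>2 - w * u + 1/4) = 0 \<longleftrightarrow> u\<^sup>2 - w * u + 1/4 = 0"
      by (simp only: mult_eq_0_iff) simp
    finally show ?thesis .
  qed
  ultimately show ?thesis using False by (simp add: quartic_Fin_eq_iff qf_def Let_def mult.assoc)
qed (simp add: quartic_Fin_eq_iff)

lemma root_neg_a:
  assumes "a \<noteq> 0" "(- a)\<^sup>2 - w * (- a) + 1/4 = 0"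
  shows "w = qf a 0"
proof -
  have "quartic a (Fin 0) = Fin w" unfolding qf_eq_iff[OF assms(1)] using assms(2) by (simp add: Let_def)
  then show ?thesis by (simp add: quartic_Fin_eq_iff)
qed

text \<open>Solving for \<open>u\<close> takes a root of \<open>g\<^sup>2 - 1\<close>, and solving
  for \<open>z\<close> a root of \<open>1 + u / a\<close> for each of the two \<open>u\<close>. The
  three excluded values are those at which one of these radicands vanishes, and over a contractible
  set nonvanishing functions have continuous roots.\<close>

lemma four_lifts:
  fixes S :: "'a::real_normed_vector set"
  assumes a: "a \<noteq> 0" and S: "contractible S" and g: "continuous_on S g"
    and avoid: "\<And>x. x \<in> S \<Longrightarrow> g x \<noteq> 1 \<and> g x \<noteq> - 1 \<and> g x \<noteq> qf a 0"
  obtains L :: "nat \<Rightarrow> 'a \<Rightarrow> complex" where "\<And>i. lifts a 1 S g (L i)"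
    "\<And>x. x \<in> S \<Longrightarrow> bij_betw (\<lambda>i. L i x) {1..4} {z. quartic a (Fin z) = Fin (g x)}"
proof -
  have nz: "(g x)\<^sup>2 - 1 \<noteq> 0" if "x \<in> S" for x
    using avoid[OF that] by (auto simp: power2_eq_1_iff)
  have c: "continuous_on S (\<lambda>x. (g x)\<^sup>2 - 1)" by (intro continuous_intros g)
  then obtain r where r: "continuous_on S r" "\<And>x. x \<in> S \<Longrightarrow> (g x)\<^sup>2 - 1 = (r x)\<^sup>2"
    using continuous_sqrt_on_contractible[OF c S] nz by blast
  have rn: "r x \<noteq> 0" if "x \<in> S" for x using nz[OF that] r(2)[OF that] by auto
  have root: "((g x + e * r x) / 2)\<^sup>2 - g x * ((g x + e * r x) / 2) + 1/4 = 0"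
    if x: "x \<in> S" and e: "e\<^sup>2 = 1" for x e
  proof -
    define h where "h = (g x + e * r x) / 2"
    have "e * r x = 2 * h - g x" by (simp add: h_def add_divide_distrib)
    then have "(2 * h - g x)\<^sup>2 = (g x)\<^sup>2 - 1" using e by (simp add: r(2)[OF x] power_mult_distrib flip: \<open>e * r x = _\<close>)
    moreover have "(2 * h - g x)\<^sup>2 = 4 * (h\<^sup>2 - g x * h + 1/4) + (g x)\<^sup>2 - 1"
      by (simp add: power2_eq_square algebra_simps)
    ultimately have "4 * (h\<^sup>2 - g x * h + 1/4) = 0" by simp
    then show ?thesis unfolding h_def by (simp only: mult_eq_0_iff) simp
  qed
  have rootD: "u = (g x + r x) / 2 \<or> u = (g x - r x) / 2"
    if x: "x \<in> S" and u: "u\<^sup>2 - g x * u + 1/4 = 0" for x u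
  proof -
    have "(2 * u - g x)\<^sup>2 = 4 * (u\<^sup>2 - g x * u + 1/4) + (g x)\<^sup>2 - 1"
      by (simp add: power2_eq_square algebra_simps)
    then have "(2 * u - g x)\<^sup>2 = (r x)\<^sup>2" unfolding u using r(2)[OF x] by simp
    then have "2 * u - g x = r x \<or> 2 * u - g x = - r x" by (simp add: power2_eq_iff)
    then show ?thesis by (auto simp: field_simps)
  qed
  have "\<exists>s. continuous_on S s \<and> (\<forall>x\<in>S. 1 + (g x + e * r x) / 2 / a = (s x)\<^sup>2)
     \<and> (\<forall>x\<in>S. s x \<noteq> 0)" if e: "e\<^sup>2 = 1" for e
  proof -
    have nz: "1 + (g x + e * r x) / 2 / a \<noteq> 0" if "x \<in> S" for x
    proof
      assume "1 + (g x + e * r x) / 2 / a = 0"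
      moreover have "y = (1 + y / a) * a - a" for y using a by (simp add: field_simps)
      from this[of "(g x + e * r x) / 2"] have "(g x + e * r x) / 2 = (1 + (g x + e * r x) / 2 / a) * a - a" .
      ultimately have "(g x + e * r x) / 2 = - a" by simp
      then have "g x = qf a 0" using root[OF that e] root_neg_a[OF a] by simp
      then show False using avoid[OF that] by simp
    qed
    have c: "continuous_on S (\<lambda>x. 1 + (g x + e * r x) / 2 / a)"
      by (intro continuous_intros g r) (use a in auto)
    then obtain s where s: "continuous_on S s" "\<And>x. x \<in> S \<Longrightarrow> 1 + (g x + e * r x) / 2 / a = (s x)\<^sup>2"
      using continuous_sqrt_on_contractible[OF c S] nz by blast
    then show ?thesis using nz by (metis zero_power2)
  qed
  from this[of 1] this[of "- 1"] obtain s t where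
    s: "continuous_on S s" "\<And>x. x \<in> S \<Longrightarrow> 1 + (g x + r x) / 2 / a = (s x)\<^sup>2" "\<And>x. x \<in> S \<Longrightarrow> s x \<noteq> 0" and
    t: "continuous_on S t" "\<And>x. x \<in> S \<Longrightarrow> 1 + (g x - r x) / 2 / a = (t x)\<^sup>2" "\<And>x. x \<in> S \<Longrightarrow> t x \<noteq> 0"
    by auto
  have us: "a * ((s x)\<^sup>2 - 1) = (g x + r x) / 2" "a * ((t x)\<^sup>2 - 1) = (g x - r x) / 2" if "x \<in> S" for x
    using a that by (simp_all flip: s(2) t(2))
  define L :: "nat \<Rightarrow> 'a \<Rightarrow> complex" where
    "L i x = (if i = 1 then s x else if i = 2 then - s x else if i = 3 then t x else - t x)" for i x
  have fib: "{z. quartic a (Fin z) = Fin (g x)} = {s x, - s x, t x, - t x}" if x: "x \<in> S" for x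
  proof -
    have rp: "w = (g x + r x) / 2 \<Longrightarrow> w\<^sup>2 - g x * w + 1/4 = 0"
      and rm: "w = (g x - r x) / 2 \<Longrightarrow> w\<^sup>2 - g x * w + 1/4 = 0" for w
      using root[OF x one_power2] root[OF x power2_minus[of 1, unfolded one_power2]]
      unfolding mult_1 mult_minus1 add_uminus_conv_diff by (simp_all only:)
    have "quartic a (Fin z) = Fin (g x) \<longleftrightarrow> a * (z\<^sup>2 - 1) = (g x + r x) / 2 \<or> a * (z\<^sup>2 - 1) = (g x - r x) / 2" for z
      unfolding qf_eq_iff[OF a] Let_def using rootD[OF x] rp rm by blast
    also have "\<dots> z \<longleftrightarrow> z\<^sup>2 = (s x)\<^sup>2 \<or> z\<^sup>2 = (t x)\<^sup>2" for z
      unfolding us[OF x, symmetric] using a by simp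
    finally show ?thesis by (auto simp: power2_eq_iff)
  qed
  have ne: "(s x)\<^sup>2 \<noteq> (t x)\<^sup>2" if "x \<in> S" for x
  proof
    assume "(s x)\<^sup>2 = (t x)\<^sup>2"
    then have "(g x + r x) / 2 = (g x - r x) / 2" using us[OF that] by simp
    then show False using rn[OF that] by (simp add: field_simps)
  qed
  have i4: "{1..4} = {1, 2, 3, 4::nat}" by auto
  show thesis
  proof (rule that)
    have c: "continuous_on S (L i)" for i
      unfolding L_def by (cases "i = 1"; cases "i = 2"; cases "i = 3"; simp add: s t continuous_on_minus)
    have "L i x \<in> {z. quartic a (Fin z) = Fin (g x)}" if "x \<in> S" for i x
      unfolding fib[OF that] by (auto simp: L_def)
    with c show "lifts a 1 S g (L i)" for i by (auto simp: lifts_def)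
    show "bij_betw (\<lambda>i. L i x) {1..4} {z. quartic a (Fin z) = Fin (g x)}" if x: "x \<in> S" for x
    proof -
      have "s x \<noteq> t x" "- s x \<noteq> t x" "s x \<noteq> - t x" "t x \<noteq> s x" "- t x \<noteq> s x" "t x \<noteq> - s x"
        using ne[OF x] by (metis power2_minus)+
      then show ?thesis
        unfolding fib[OF x] bij_betw_def i4 using s(3)[OF x] t(3)[OF x]
        by (auto simp: L_def inj_on_def)
    qed
  qed
qed

text \<open>The two values of \<open>u\<close> over a point have product 1/4, and each belongs to an
  opposite pair of points. The point of the disjunction is that it is a closed condition on
  \<open>z\<close> and \<open>z'\<close>.\<close>

lemma same_fibre:
  assumes a: "a \<noteq> 0" and "quartic a (Fin z) = Fin w" "quartic a (Fin z') = Fin w" "z \<noteq> z'"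
  shows "z' = - z \<or> 4 * (a * (z\<^sup>2 - 1)) * (a * (z'\<^sup>2 - 1)) = 1"
proof -
  define u u' where "u = a * (z\<^sup>2 - 1)" and "u' = a * (z'\<^sup>2 - 1)"
  have 1: "u\<^sup>2 - w * u + 1/4 = 0" and 2: "u'\<^sup>2 - w * u' + 1/4 = 0"
    using assms(2,3) unfolding qf_eq_iff[OF a] Let_def u_def u'_def by auto
  have nz: "u \<noteq> 0" using 1 by auto
  show ?thesis
  proof (cases "u = u'")
    case True
    then have "z\<^sup>2 = z'\<^sup>2" using a by (simp add: u_def u'_def)
    then show ?thesis using assms(4) by (auto simp: power2_eq_iff)
  next
    case False
    have "(u - u') * (u + u' - w) = (u\<^sup>2 - w * u + 1/4) - (u'\<^sup>2 - w * u' + 1/4)"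
      by (simp add: algebra_simps power2_eq_square)
    then have "w = u + u'" using 1 2 False by simp
    then have "4 * u * u' = 1" using 1 by (simp add: algebra_simps power2_eq_square add_eq_0_iff2)
    then show ?thesis by (simp add: u_def u'_def)
  qed
qed

text \<open>The closed condition of \<open>same_fibre\<close> fails on the diagonal:
  \<open>z = - z\<close> forces the critical point 0, and \<open>4 * u * u = 1\<close> forces the
  value \<plusminus>1.\<close>

lemma fibre_excl:
  assumes a: "a \<noteq> 0" and "quartic a (Fin z) = Fin w" "w \<noteq> 1" "w \<noteq> - 1" "w \<noteq> qf a 0"
  shows "z \<noteq> 0" "4 * (a * (z\<^sup>2 - 1)) * (a * (z\<^sup>2 - 1)) \<noteq> 1"
proof -
  show "z \<noteq> 0" using assms by (auto simp: quartic_Fin_eq_iff)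
  define u where "u = a * (z\<^sup>2 - 1)"
  have 1: "u\<^sup>2 - w * u + 1/4 = 0"
    using assms(2) unfolding qf_eq_iff[OF a] Let_def u_def by auto
  show "4 * (a * (z\<^sup>2 - 1)) * (a * (z\<^sup>2 - 1)) \<noteq> 1"
    unfolding u_def[symmetric]
  proof
    assume u: "4 * u * u = 1"
    then have "(2 * u)\<^sup>2 = 1" by (simp add: power2_eq_square mult.assoc)
    then have "2 * u = 1 \<or> 2 * u = - 1" by (simp only: power2_eq_1_iff)
    moreover have "u * (2 * u - w) = (u\<^sup>2 - w * u + 1/4) + (4 * u * u - 1) / 4"
      by (simp add: algebra_simps power2_eq_square diff_divide_distrib)
    then have "u * (2 * u - w) = 0" unfolding 1 u by simp
    then have "2 * u = w" using u by auto
    ultimately show False using assms(3,4) by auto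
  qed
qed

lemma lift1_unique:
  assumes a: "a \<noteq> 0" and S: "connected S" and L: "lifts a 1 S g L1" "lifts a 1 S g L2"
    and avoid: "\<And>x. x \<in> S \<Longrightarrow> g x \<noteq> 1 \<and> g x \<noteq> - 1 \<and> g x \<noteq> qf a 0"
    and x: "x0 \<in> S" "L1 x0 = L2 x0" "x \<in> S"
  shows "L1 x = L2 x"
proof (rule ccontr)
  assume ne: "L1 x \<noteq> L2 x"
  note c = lifts_cont[OF L(1)] lifts_cont[OF L(2)]
  \<comment> \<open>\<open>A\<close> is the set where the lifts agree and \<open>B\<close> the
    closed condition from \<open>same_fibre\<close>. They cover \<open>S\<close>, and by
    \<open>fibre_excl\<close> they are disjoint.\<close>
  define A where "A = {y \<in> S. L1 y - L2 y = 0}"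
  define B where "B = {y \<in> S. (L1 y + L2 y) * (4 * (a * ((L1 y)\<^sup>2 - 1)) * (a * ((L2 y)\<^sup>2 - 1)) - 1) = 0}"
  have q: "quartic a (Fin (L1 y)) = Fin (g y)" "quartic a (Fin (L2 y)) = Fin (g y)" if "y \<in> S" for y
    using liftsD[OF L(1) that] liftsD[OF L(2) that] by auto
  have "closedin (top_of_set S) A" "closedin (top_of_set S) B"
    unfolding A_def B_def by (intro continuous_closedin_preimage_constant continuous_intros c)+
  moreover have "S \<subseteq> A \<union> B"
    using same_fibre[OF a q] by (fastforce simp: A_def B_def)
  moreover have "A \<inter> B = {}"
    using fibre_excl[OF a q(1)] avoid by (force simp: A_def B_def)
  moreover have "x0 \<in> A" using x by (auto simp: A_def)
  moreover have "x \<in> B" using \<open>S \<subseteq> A \<union> B\<close> x ne by (auto simp: A_def)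
  ultimately show False
    using S unfolding connected_closedin by blast
qed

lemma lift_unique:
  assumes a: "a \<noteq> 0" and S: "connected S" and L: "lifts a n S g L1" "lifts a n S g L2"
    and avoid: "\<And>x. x \<in> S \<Longrightarrow> g x \<notin> postcrit a"
    and x: "x0 \<in> S" "L1 x0 = L2 x0" "x \<in> S"
  shows "L1 x = L2 x"
  using L x
proof (induction n arbitrary: L1 L2 x)
  case 0
  then show ?case by (auto simp: lifts_def)
next
  case (Suc n)
  have L': "lifts a (n + 1) S g L1" "lifts a (n + 1) S g L2" using Suc.prems by simp_all
  note p1 = lifts_push[OF a L'(1)] and p2 = lifts_push[OF a L'(2)]
  have e: "phi a 1 (L1 y) = phi a 1 (L2 y)" if "y \<in> S" for y
    by (rule Suc.IH[OF p1(1) p2(1) x(1)]) (use Suc.prems that in auto)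
  have "phi a 1 (L1 y) \<notin> postcrit a" if "y \<in> S" for y
    using lifts_notin_postcrit[OF p1(1) that avoid[OF that]] .
  then have "phi a 1 (L1 y) \<noteq> 1 \<and> phi a 1 (L1 y) \<noteq> - 1 \<and> phi a 1 (L1 y) \<noteq> qf a 0" if "y \<in> S" for y
    using that pm1_postcrit qf_0_postcrit by metis
  moreover have "lifts a 1 S (\<lambda>x. phi a 1 (L1 x)) L2"
    using p2(2) by (rule lifts_cong) (use e in auto)
  ultimately show ?case using lift1_unique[OF a S p1(2)] Suc.prems by blast
qed

lemma lift_exists:
  fixes S :: "'a::real_normed_vector set"
  assumes a: "a \<noteq> 0" and S: "contractible S" and g: "continuous_on S g"
    and avoid: "\<And>x. x \<in> S \<Longrightarrow> g x \<notin> postcrit a"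
    and x: "x0 \<in> S" "iter a n z0 = Fin (g x0)"
  obtains L where "lifts a n S g L" "L x0 = z0"
proof -
  have "\<exists>L. lifts a n S g L \<and> L x0 = z0"
    using x(2)
  proof (induction n arbitrary: z0)
    case 0
    then show ?case using g by (auto simp: lifts_def)
  next
    case (Suc n)
    have "quartic a (Fin z0) \<noteq> Infty" using Suc.prems by (auto simp: funpow_Suc_right simp del: funpow.simps)
    then obtain z1 where z1: "quartic a (Fin z0) = Fin z1" by (cases "quartic a (Fin z0)") auto
    have "iter a n z1 = Fin (g x0)" using Suc.prems z1 by (simp add: funpow_Suc_right del: funpow.simps)
    then obtain g1 where g1: "lifts a n S g g1" "g1 x0 = z1" using Suc.IH by blast
    have "g1 x \<notin> postcrit a" if "x \<in> S" for x using lifts_notin_postcrit[OF g1(1) that avoid[OF that]] .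
    then have "g1 x \<noteq> 1 \<and> g1 x \<noteq> - 1 \<and> g1 x \<noteq> qf a 0" if "x \<in> S" for x
      using that pm1_postcrit qf_0_postcrit by metis
    then obtain L :: "nat \<Rightarrow> 'a \<Rightarrow> complex" where L: "\<And>i. lifts a 1 S g1 (L i)"
      "\<And>x. x \<in> S \<Longrightarrow> bij_betw (\<lambda>i. L i x) {1..4} {z. quartic a (Fin z) = Fin (g1 x)}"
      using four_lifts[OF a S lifts_cont[OF g1(1)]] by metis
    have "z0 \<in> (\<lambda>i. L i x0) ` {1..4}" using bij_betw_imp_surj_on[OF L(2)[OF x(1)]] g1(2) z1 by simp
    then obtain i where "L i x0 = z0" by auto
    moreover have "lifts a (n + 1) S g (L i)" using lifts_compose[OF g1(1) L(1)] .
    ultimately show ?case by auto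
  qed
  then show thesis using that by blast
qed

text \<open>The difference quotient of \<open>h\<close> is that of \<open>g\<close> divided by
  \<open>h y + h x\<close>, whose limit \<open>2 * h x\<close> is nonzero.\<close>

lemma sqrt_holomorphic:
  assumes "open S" "continuous_on S h" "g holomorphic_on S"
    and "\<And>x. x \<in> S \<Longrightarrow> (h x)\<^sup>2 = g x" "\<And>x. x \<in> S \<Longrightarrow> g x \<noteq> 0"
  shows "h holomorphic_on S"
  unfolding holomorphic_on_open[OF assms(1)]
proof
  fix x assume x: "x \<in> S"
  have hx: "h x \<noteq> 0" using assms(4,5)[OF x] by auto
  obtain g' where g': "(g has_field_derivative g') (at x)"
    using assms(3) x holomorphic_on_open[OF assms(1)] by blast
  have ch: "(h \<longlongrightarrow> h x) (at x)"
    using assms(1,2) x continuous_on_eq_continuous_at by (metis isCont_def)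
  then have l2: "((\<lambda>y. h y + h x) \<longlongrightarrow> h x + h x) (at x)" by (intro tendsto_intros)
  have lim: "((\<lambda>y. (g y - g x) / (y - x) / (h y + h x)) \<longlongrightarrow> g' / (h x + h x)) (at x)"
    by (rule tendsto_divide[OF g'[unfolded has_field_derivative_iff] l2]) (use hx in simp)
  have "((\<lambda>y. (h y - h x) / (y - x)) \<longlongrightarrow> g' / (h x + h x)) (at x)"
  proof (rule Lim_transform_eventually[OF lim])
    have "eventually (\<lambda>y. h y + h x \<noteq> 0) (at x)"
      by (rule tendsto_imp_eventually_ne[OF l2]) (use hx in simp)
    moreover have "eventually (\<lambda>y. y \<in> S) (at x)"
      using assms(1) x by (auto simp: eventually_at_topological)
    ultimately show "\<forall>\<^sub>F y in at x. (g y - g x) / (y - x) / (h y + h x) = (h y - h x) / (y - x)"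
    proof eventually_elim
      case (elim y)
      have "g y - g x = (h y - h x) * (h y + h x)"
        using assms(4)[OF elim(2)] assms(4)[OF x] by (simp add: algebra_simps power2_eq_square flip: assms(4))
      then show ?case using elim(1) by simp
    qed
  qed
  then show "\<exists>f'. (h has_field_derivative f') (at x)" unfolding has_field_derivative_iff by blast
qed

text \<open>Two applications of \<open>sqrt_holomorphic\<close>: \<open>2 * u - g\<close> is a root
  of \<open>g\<^sup>2 - 1\<close>, and then \<open>L\<close> is a root of
  \<open>u / a + 1\<close>.\<close>

lemma lift1_holomorphic:
  assumes a: "a \<noteq> 0" and S: "open S" and g: "g holomorphic_on S" and L: "lifts a 1 S g L"
    and avoid: "\<And>x. x \<in> S \<Longrightarrow> g x \<noteq> 1 \<and> g x \<noteq> - 1 \<and> g x \<noteq> qf a 0"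
  shows "L holomorphic_on S"
proof -
  note c = lifts_cont[OF L]
  have q: "quartic a (Fin (L x)) = Fin (g x)" if "x \<in> S" for x using liftsD[OF L that] by simp
  define u where "u x = a * ((L x)\<^sup>2 - 1)" for x
  have u: "(u x)\<^sup>2 - g x * u x + 1/4 = 0" if "x \<in> S" for x
    using q[OF that] unfolding qf_eq_iff[OF a] Let_def u_def .
  have "(\<lambda>x. 2 * u x - g x) holomorphic_on S"
  proof (rule sqrt_holomorphic[OF S])
    show "continuous_on S (\<lambda>x. 2 * u x - g x)"
      unfolding u_def by (intro continuous_intros c holomorphic_on_imp_continuous_on g)
    show "(\<lambda>x. (g x)\<^sup>2 - 1) holomorphic_on S" by (intro holomorphic_intros g)
    show "(2 * u x - g x)\<^sup>2 = (g x)\<^sup>2 - 1" if "x \<in> S" for x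
    proof -
      have "(2 * u x - g x)\<^sup>2 - ((g x)\<^sup>2 - 1) = 4 * ((u x)\<^sup>2 - g x * u x + 1/4)"
        by (simp add: algebra_simps power2_eq_square)
      then show ?thesis using u[OF that] by simp
    qed
    show "(g x)\<^sup>2 - 1 \<noteq> 0" if "x \<in> S" for x using avoid[OF that] by (auto simp: power2_eq_1_iff)
  qed
  moreover have "(\<lambda>x. (r x + g x) / 2 / a + 1) holomorphic_on S" if "r holomorphic_on S" for r
    using a that by (intro holomorphic_intros g) auto
  ultimately have "(\<lambda>x. ((2 * u x - g x) + g x) / 2 / a + 1) holomorphic_on S" by blast
  then show ?thesis
  proof (rule sqrt_holomorphic[OF S c])
    show "(L x)\<^sup>2 = ((2 * u x - g x) + g x) / 2 / a + 1" for x using a by (simp add: u_def)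
    then show "((2 * u x - g x) + g x) / 2 / a + 1 \<noteq> 0" if "x \<in> S" for x
      using fibre_excl(1)[OF a q[OF that]] avoid[OF that] by (metis power_eq_0_iff)
  qed
qed

lemma lift_holomorphic:
  assumes a: "a \<noteq> 0" and S: "open S" and g: "g holomorphic_on S" and L: "lifts a n S g L"
    and avoid: "\<And>x. x \<in> S \<Longrightarrow> g x \<notin> postcrit a"
  shows "L holomorphic_on S"
  using L
proof (induction n arbitrary: L)
  case 0
  then show ?case using g by (auto simp: lifts_def cong: holomorphic_cong)
next
  case (Suc n)
  have L': "lifts a (n + 1) S g L" using Suc.prems by simp
  note p = lifts_push[OF a L']
  have "phi a 1 (L y) \<notin> postcrit a" if "y \<in> S" for y
    using lifts_notin_postcrit[OF p(1) that avoid[OF that]] .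
  then have "phi a 1 (L y) \<noteq> 1 \<and> phi a 1 (L y) \<noteq> - 1 \<and> phi a 1 (L y) \<noteq> qf a 0" if "y \<in> S" for y
    using that pm1_postcrit qf_0_postcrit by metis
  then show ?case using lift1_holomorphic[OF a S Suc.IH[OF p(1)] p(2)] by blast
qed

subsection \<open>Lifting paths\<close>

definition lift_ends :: "complex \<Rightarrow> nat \<Rightarrow> (real \<Rightarrow> complex) \<Rightarrow> complex \<Rightarrow> complex \<Rightarrow> bool" where
  "lift_ends a n \<gamma> z z' \<longleftrightarrow> (\<exists>\<delta>. lifts a n {0..1} \<gamma> \<delta> \<and> \<delta> 0 = z \<and> \<delta> 1 = z')"

definition opath :: "complex \<Rightarrow> (real \<Rightarrow> complex) \<Rightarrow> bool" where
  "opath a \<gamma> \<longleftrightarrow> path \<gamma> \<and> path_image \<gamma> \<inter> postcrit a = {}"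

lemma opathD: "opath a \<gamma> \<Longrightarrow> t \<in> {0..1} \<Longrightarrow> \<gamma> t \<notin> postcrit a" "opath a \<gamma> \<Longrightarrow> continuous_on {0..1} \<gamma>"
  by (auto simp: opath_def path_def path_image_def disjoint_iff)

lemma opath_join: "opath a \<gamma> \<Longrightarrow> opath a \<gamma>' \<Longrightarrow> pathfinish \<gamma> = pathstart \<gamma>' \<Longrightarrow> opath a (\<gamma> +++ \<gamma>')"
  by (auto simp: opath_def path_image_join)

lemma opath_reverse: "opath a \<gamma> \<Longrightarrow> opath a (reversepath \<gamma>)"
  by (auto simp: opath_def)

lemma opath_lift:
  assumes "opath a \<gamma>" "lifts a n {0..1} \<gamma> \<delta>"
  shows "opath a \<delta>"
  unfolding opath_def path_def path_image_def
  using lifts_cont[OF assms(2)] lifts_notin_postcrit[OF assms(2)] opathD(1)[OF assms(1)] by auto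

lemma lift_path_ex:
  assumes "a \<noteq> 0" "opath a \<gamma>" "iter a n z = Fin (\<gamma> 0)"
  obtains \<delta> where "lifts a n {0..1} \<gamma> \<delta>" "\<delta> 0 = z"
  by (rule lift_exists[OF assms(1) _ opathD(2)[OF assms(2)] opathD(1)[OF assms(2)], of 0 n z])
     (use assms that in \<open>auto intro: convex_imp_contractible\<close>)

lemma lift_path_unique:
  assumes "a \<noteq> 0" "opath a \<gamma>" "lifts a n {0..1} \<gamma> \<delta>" "lifts a n {0..1} \<gamma> \<delta>'" "\<delta> 0 = \<delta>' 0" "t \<in> {0..1}"
  shows "\<delta> t = \<delta>' t"
  by (rule lift_unique[OF assms(1) _ assms(3,4) opathD(1)[OF assms(2)], of 0]) (use assms in auto)

lemma lift_ends_total: "a \<noteq> 0 \<Longrightarrow> opath a \<gamma> \<Longrightarrow> iter a n z = Fin (pathstart \<gamma>) \<Longrightarrow> \<exists>z'. lift_ends a n \<gamma> z z'"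
  unfolding lift_ends_def pathstart_def using lift_path_ex by metis

lemma lift_ends_unique: "a \<noteq> 0 \<Longrightarrow> opath a \<gamma> \<Longrightarrow> lift_ends a n \<gamma> z z1 \<Longrightarrow> lift_ends a n \<gamma> z z2 \<Longrightarrow> z1 = z2"
  unfolding lift_ends_def using lift_path_unique[of a \<gamma> n _ _ 1] by auto

lemma lift_ends_fibre: "lift_ends a n \<gamma> z z' \<Longrightarrow> iter a n z = Fin (pathstart \<gamma>)" "lift_ends a n \<gamma> z z' \<Longrightarrow> iter a n z' = Fin (pathfinish \<gamma>)"
  by (auto simp: lift_ends_def lifts_def pathstart_def pathfinish_def)

lemma lifts_join:
  assumes "lifts a n {0..1} \<gamma> \<delta>" "lifts a n {0..1} \<gamma>' \<delta>'" "\<delta> 1 = \<delta>' 0"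
  shows "lifts a n {0..1} (\<gamma> +++ \<gamma>') (\<delta> +++ \<delta>')"
proof -
  have "path (\<delta> +++ \<delta>')"
    using assms by (intro path_join_imp) (auto simp: lifts_def path_def pathfinish_def pathstart_def)
  then show ?thesis using assms by (auto simp: lifts_def path_def joinpaths_def)
qed

lemma lifts_reverse: "lifts a n {0..1} \<gamma> \<delta> \<Longrightarrow> lifts a n {0..1} (reversepath \<gamma>) (reversepath \<delta>)"
  using path_reversepath[of \<delta>] by (auto simp: lifts_def path_def reversepath_def)

lemma lift_ends_join: "lift_ends a n \<gamma> z z' \<Longrightarrow> lift_ends a n \<gamma>' z' z'' \<Longrightarrow> lift_ends a n (\<gamma> +++ \<gamma>') z z''"
  unfolding lift_ends_def by (metis lifts_join pathstart_def pathfinish_def pathstart_join pathfinish_join)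

lemma lift_ends_reverse: "lift_ends a n \<gamma> z z' \<Longrightarrow> lift_ends a n (reversepath \<gamma>) z' z"
  unfolding lift_ends_def by (metis lifts_reverse pathstart_def pathfinish_def pathstart_reversepath pathfinish_reversepath)

lemma lift_ends_compose: "lifts a n {0..1} \<gamma> \<delta> \<Longrightarrow> lift_ends a m \<delta> z z' \<Longrightarrow> lift_ends a (n + m) \<gamma> z z'"
  unfolding lift_ends_def using lifts_compose by blast


subsection \<open>Consequences of a backward invariant disc\<close>

lemma big_iter_norm:
  assumes "a \<noteq> 0" "escR a < cmod z" "iter a n z = Fin w"
  shows "cmod z \<le> cmod w"
  using assms(3)
proof (induction n arbitrary: w)
  case 0
  then show ?case by simp
next
  case (Suc n)
  then obtain y where y: "iter a n z = Fin y" "w = qf a y"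
    by (auto simp: quartic_eq_Fin_iff)
  have "cmod z \<le> cmod y" using Suc.IH y(1) .
  then show ?case using qf_growth[OF assms(1), of y] assms(2) y(2) escR_ge[of a] by simp
qed

lemma iter_norm_bound:
  assumes "a \<noteq> 0" "iter a n z = Fin w"
  shows "cmod z \<le> max (escR a) (cmod w)"
  using big_iter_norm[OF assms(1) _ assms(2)] by fastforce

text \<open>The equation \<open>P = w * Q\<close> survives limits even where poles accumulate: a
  limit with \<open>Q = 0\<close> would have \<open>P = 0\<close> too, which homogeneous coordinates
  exclude.\<close>

lemma closed_iter_preimage:
  assumes a: "a \<noteq> 0" and C: "compact C"
  shows "closed {z. iter a n z \<in> Fin ` C}"
proof -
  let ?P = "\<lambda>z. fst (hit a n z)" and ?Q = "\<lambda>z. snd (hit a n z)"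
  have e: "iter a n z \<in> Fin ` C \<longleftrightarrow> (\<exists>w\<in>C. ?P z = w * ?Q z)" for z
  proof
    assume "\<exists>w\<in>C. ?P z = w * ?Q z"
    then obtain w where w: "w \<in> C" "?P z = w * ?Q z" by blast
    have "?Q z \<noteq> 0" using iter_eq_toS(2)[OF a, of n z] w(2) by (metis mult_zero_right prod.collapse)
    then show "iter a n z \<in> Fin ` C" using w iter_eq_Fin_iff[OF a, of n z w] by auto
  qed (auto simp: iter_eq_Fin_iff[OF a])
  have cP: "continuous_on UNIV ?P" and cQ: "continuous_on UNIV ?Q"
    by (intro holomorphic_on_imp_continuous_on hit_holomorphic)+
  show ?thesis
    unfolding e closed_sequential_limits
  proof (intro allI impI, elim conjE)
    fix x l assume x: "\<forall>n. x n \<in> {z. \<exists>w\<in>C. ?P z = w * ?Q z}" and l: "x \<longlonglongrightarrow> l"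
    then obtain w where w: "\<And>n. w n \<in> C" "\<And>n. ?P (x n) = w n * ?Q (x n)" by (simp; metis)
    obtain r w0 where r: "strict_mono r" "w0 \<in> C" "(w \<circ> r) \<longlonglongrightarrow> w0"
      using seq_compactE[of C w] compact_imp_seq_compact[OF C] w(1) by blast
    have xr: "(\<lambda>n. x (r n)) \<longlonglongrightarrow> l" using LIMSEQ_subseq_LIMSEQ[OF l r(1)] by (simp add: comp_def)
    have "(\<lambda>n. ?P (x (r n))) \<longlonglongrightarrow> ?P l" "(\<lambda>n. ?Q (x (r n))) \<longlonglongrightarrow> ?Q l"
      by (rule continuous_on_tendsto_compose[OF cP xr] continuous_on_tendsto_compose[OF cQ xr]; simp)+
    moreover from this(2) have "(\<lambda>n. w (r n) * ?Q (x (r n))) \<longlonglongrightarrow> w0 * ?Q l"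
      using r(3) by (intro tendsto_mult) (auto simp: comp_def)
    then have "(\<lambda>n. ?P (x (r n))) \<longlonglongrightarrow> w0 * ?Q l" unfolding w(2) .
    ultimately have "?P l = w0 * ?Q l" using LIMSEQ_unique by blast
    then show "l \<in> {z. \<exists>w\<in>C. ?P z = w * ?Q z}" using r(2) by auto
  qed
qed

lemma uniform_limit_compose_seq:
  fixes f :: "nat \<Rightarrow> 'a::metric_space \<Rightarrow> 'b::metric_space"
  assumes u: "uniform_limit C f G sequentially" and G: "continuous_on C G"
    and y: "\<forall>\<^sub>F n in sequentially. y n \<in> C" "y \<longlonglongrightarrow> l" "l \<in> C"
  shows "(\<lambda>n. f n (y n)) \<longlonglongrightarrow> G l"
proof (rule tendstoI)
  fix e :: real assume "e > 0"
  then have e: "e / 2 > 0" by simp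
  have "(\<lambda>n. G (y n)) \<longlonglongrightarrow> G l" by (rule continuous_on_tendsto_compose[OF G y(2,3,1)])
  from tendstoD[OF this e] uniform_limitD[OF u e] y(1)
  show "\<forall>\<^sub>F n in sequentially. dist (f n (y n)) (G l) < e"
  proof eventually_elim
    case (elim n)
    then have "dist (f n (y n)) (G (y n)) < e / 2" by auto
    then show ?case using elim(1) dist_triangle[of "f n (y n)" "G l" "G (y n)"] by simp
  qed
qed

text \<open>A planar s-Cantor disc of the second iterate. The excluded points are the critical
  values of the second iterate in the plane: \<plusminus>1, the image of 0 and its second image. The
  last may be infinite, which is why its condition is stated on the sphere.\<close>

locale disc =
  fixes a :: complex and D :: "complex set"
  assumes a0: "a \<noteq> 0" and Dh: "D homeomorphic cball (0::complex) 1"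
    and D1: "1 \<notin> D" "- 1 \<notin> D" and Dv: "qf a 0 \<notin> D" and Dfv: "iter a 2 0 \<notin> Fin ` D"
    and Dback: "\<And>z. iter a 2 z \<in> Fin ` D \<Longrightarrow> z \<in> D"
begin

lemma compact_D: "compact D"
  using homeomorphic_compactness[OF Dh] by simp

lemma contractible_D: "contractible D"
  using homeomorphic_contractible_eq[OF Dh] by (simp add: convex_imp_contractible)

text \<open>By invariance of domain the open unit disc has an open image. Holomorphic arguments take
  place on \<open>E\<close>, and density carries closed conditions from there to all of
  \<open>D\<close>.\<close>

lemma D_dense_interior:
  obtains E where "open E" "connected E" "E \<noteq> {}" "E \<subseteq> D" "D \<subseteq> closure E"
proof -
  obtain h k where hk: "homeomorphism (cball (0::complex) 1) D h k"
    using Dh homeomorphic_sym unfolding homeomorphic_def by metis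
  then have c: "continuous_on (cball 0 1) h" and im: "h ` cball 0 1 = D" and inj: "inj_on h (cball 0 1)"
    by (auto simp: homeomorphism_def intro: inj_on_inverseI)
  have c': "continuous_on (ball 0 1) h" using c continuous_on_subset ball_subset_cball by blast
  show thesis
  proof (rule that[of "h ` ball 0 1"])
    show "open (h ` ball 0 1)"
      using invariance_of_domain[OF c'] inj inj_on_subset ball_subset_cball by blast
    show "connected (h ` ball 0 1)" using c' by (intro connected_continuous_image) auto
    have "h ` closure (ball 0 1) \<subseteq> closure (h ` ball 0 1)"
      by (rule image_closure_subset) (use c in \<open>simp_all add: closure_subset\<close>)
    then show "D \<subseteq> closure (h ` ball 0 1)" using im by simp
    show "h ` ball 0 1 \<noteq> {}" by simp
    show "h ` ball 0 1 \<subseteq> D" using im ball_subset_cball by blast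
  qed
qed

lemma Dback_even: "iter a (2 * n) z \<in> Fin ` D \<Longrightarrow> z \<in> D"
proof (induction n)
  case (Suc n)
  obtain y where y: "iter a (2 * n) z = Fin y"
    using Suc.prems by (cases "iter a (2 * n) z") auto
  have "iter a (2 + 2 * n) z = iter a 2 y" using iter_add[OF y] .
  then have "y \<in> D" using Suc.prems Dback by simp
  then show ?case using Suc.IH y by auto
qed auto

lemma postcrit_D: "postcrit a \<inter> D = {}"
proof -
  have "iter a k 0 \<notin> Fin ` D" if "k > 0" for k
    using that
  proof (induction k rule: less_induct)
    case (less k)
    consider "k = 1" | "k = 2" | j where "k = 2 + j" "j > 0"
      using less.prems by (metis One_nat_def Suc_lessI add_2_eq_Suc less_imp_Suc_add neq0_conv numeral_2_eq_2 add_Suc plus_1_eq_Suc add.commute)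
    then show ?case
    proof cases
      case 1
      then show ?thesis using Dv by (auto simp: quartic_Fin_eq_iff)
    next
      case 2
      then show ?thesis using Dfv by simp
    next
      case 3
      show ?thesis
      proof
        assume d: "iter a k 0 \<in> Fin ` D"
        obtain w where w: "iter a j 0 = Fin w"
          using d 3 by (cases "iter a j 0") (auto simp: funpow_add)
        have "iter a k 0 = iter a 2 w" using iter_add[OF w, of 2] 3 by simp
        then have "w \<in> D" using d Dback by simp
        then show False using less.IH[of j] 3 w by auto
      qed
    qed
  qed
  then have "w \<notin> D" if "k > 0" "iter a k 0 = Fin w" for k w using that by auto
  then show ?thesis unfolding postcrit_def using D1 by blast
qed

text \<open>Even iterates never lead from the complement of \<open>D\<close> into \<open>D\<close>.
  So the functions \<open>1 / (f^(2n) - c)\<close> with \<open>c\<close> inside \<open>D\<close> are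
  uniformly bounded on this connected complement. Near infinity they tend to 0, hence a limit of
  them vanishes everywhere; at a point of the filled set, however, they stay away from 0.\<close>

lemma escape_outside_D: "filled a \<subseteq> D"
proof
  fix z0 assume z0: "z0 \<in> filled a"
  show "z0 \<in> D"
  proof (rule ccontr)
    assume z0D: "z0 \<notin> D"
    obtain E where "open E" "E \<noteq> {}" "E \<subseteq> D" using D_dense_interior by metis
    then obtain c r where r: "r > 0" "ball c r \<subseteq> D" by (metis all_not_in_conv open_contains_ball subset_trans)
    let ?P = "\<lambda>n z. fst (hit a (2 * n) z)" and ?Q = "\<lambda>n z. snd (hit a (2 * n) z)"
    \<comment> \<open>This is \<open>1 / (f^(2n) z - c)\<close>, extended by 0 across the poles of
      the iterate.\<close>
    define G where "G n z = ?Q n z / (?P n z - c * ?Q n z)" for n z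
    have op: "open (- D)" using compact_D by (simp add: compact_imp_closed open_Compl)
    have con: "connected (- D)"
      using connected_complement_homeomorphic_convex_compact[OF Dh] by simp
    have key: "?P n z - c * ?Q n z \<noteq> 0 \<and> cmod (G n z) \<le> 1 / r" if "z \<in> - D" for n z
    proof (cases "?Q n z = 0")
      case True
      then show ?thesis using iter_eq_toS(2)[OF a0, of "2 * n" z] r(1) by (auto simp: G_def prod_eq_iff)
    next
      case False
      define w where "w = ?P n z / ?Q n z"
      have "iter a (2 * n) z = Fin w" using False by (simp add: iter_eq_Fin_iff[OF a0] w_def)
      then have "w \<notin> D" using that Dback_even by auto
      then have "cmod (w - c) \<ge> r" using r(2) by (force simp: dist_norm norm_minus_commute)
      moreover have "?P n z - c * ?Q n z = (w - c) * ?Q n z" using False by (simp add: w_def algebra_simps)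
      moreover have "w - c \<noteq> 0" using calculation r(1) by auto
      moreover have "G n z = 1 / (w - c)" using False calculation by (simp add: G_def)
      ultimately show ?thesis using False r(1) by (simp add: norm_divide frac_le)
    qed
    have hol: "G n holomorphic_on - D" for n
      unfolding G_def by (intro holomorphic_intros hit_holomorphic) (use key in auto)
    obtain g q where g: "g holomorphic_on - D" and q: "strict_mono (q::nat\<Rightarrow>nat)"
      and lim: "\<And>x. x \<in> - D \<Longrightarrow> (\<lambda>n. G (q n) x) \<longlonglongrightarrow> g x"
    proof (rule Montel[OF op, of "range G" G])
      show "\<exists>B. \<forall>h\<in>range G. \<forall>z\<in>K. cmod (h z) \<le> B" if "compact K" "K \<subseteq> - D" for K
        using key that by (intro exI[of _ "1 / r"]) auto
    qed (use hol in auto)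
    obtain M where M: "\<And>z. z \<in> D \<Longrightarrow> cmod z \<le> M" using compact_imp_bounded[OF compact_D] unfolding bounded_iff by blast
    define S where "S = - cball (0::complex) (max M (escR a))"
    have S: "open S" "S \<subseteq> - D" using M by (force simp: S_def)+
    have "max M (escR a) + 1 > 0" using escR_ge[of a] by (simp add: max_def)
    then have "of_real (max M (escR a) + 1) \<in> S"
      by (simp only: S_def Compl_iff mem_cball_0 norm_of_real abs_of_pos)
    then have "S \<noteq> {}" by blast
    have g0: "g z = 0" if "z \<in> S" for z
    proof -
      have z: "z \<in> - D" and zb: "escR a < cmod z" using that S by (auto simp: S_def)
      have "(\<lambda>n. G (q n) z) \<longlonglongrightarrow> 0"
      proof (rule tendstoI)
        fix e :: real assume e: "e > 0"
        obtain n0 where n0: "cmod c + 1 / e < 2 ^ n0" using real_arch_pow[of 2 "cmod c + 1 / e"] by auto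
        have "dist (G (q n) z) 0 < e" if n: "n \<ge> n0" for n
        proof (cases "?Q (q n) z = 0")
          case True
          then show ?thesis using e by (simp add: G_def)
        next
          case False
          define w where "w = ?P (q n) z / ?Q (q n) z"
          have "iter a (2 * q n) z = Fin w" using False by (simp add: iter_eq_Fin_iff[OF a0] w_def)
          then have "cmod w \<ge> 2 ^ (2 * q n)" using big_iter_growth[OF a0, of "Fin z"] zb by simp
          moreover have "n0 \<le> 2 * q n" using n seq_suble[OF q, of n] by simp
          then have "(2::real) ^ n0 \<le> 2 ^ (2 * q n)" by (intro power_increasing) auto
          ultimately have "1 / e < cmod w - cmod c" using n0 by linarith
          then have *: "1 / e < cmod (w - c)" using norm_triangle_ineq2[of w c] by simp
          have pos: "cmod (w - c) > 0" using * e by (meson divide_pos_pos less_trans zero_less_one)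
          have "?P (q n) z - c * ?Q (q n) z = (w - c) * ?Q (q n) z"
            using False by (simp add: w_def algebra_simps)
          then have Gw: "G (q n) z = 1 / (w - c)" using False by (simp add: G_def)
          have "1 / cmod (w - c) < e" using * e pos by (simp add: field_simps)
          then show ?thesis unfolding Gw by (simp add: norm_divide)
        qed
        then show "\<forall>\<^sub>F n in sequentially. dist (G (q n) z) 0 < e"
          by (auto simp: eventually_sequentially)
      qed
      then show ?thesis using lim[OF z] LIMSEQ_unique by blast
    qed
    have "g z0 = 0"
      by (rule analytic_continuation_open[OF S(1) op \<open>S \<noteq> {}\<close> con S(2) g, of "\<lambda>_. 0"]) (use g0 z0D in auto)
    then have l0: "(\<lambda>n. G (q n) z0) \<longlonglongrightarrow> 0" using lim z0D by force
    have low: "cmod (G n z0) \<ge> 1 / (escR a + cmod c)" for n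
    proof -
      obtain w where w: "iter a (2 * n) z0 = Fin w" using filled_notin_Infty[OF z0] not_Infty_iff by blast
      then have Q: "?Q n z0 \<noteq> 0" and P: "?P n z0 = w * ?Q n z0" by (auto simp: iter_eq_Fin_iff[OF a0])
      have "\<not> big a (Fin w)" using z0 w unfolding filled_def by (metis mem_Collect_eq)
      then have "cmod w \<le> escR a" by simp
      then have "cmod (w - c) \<le> escR a + cmod c" using norm_triangle_ineq4[of w c] by simp
      moreover have "w - c \<noteq> 0" using key[of z0 n] z0D P by auto
      moreover have "G n z0 = 1 / (w - c)" using Q P by (simp add: G_def flip: left_diff_distrib)
      ultimately show ?thesis using escR_ge[of a] by (simp add: norm_divide frac_le)
    qed
    have "escR a + cmod c > 0" using escR_ge[of a] norm_ge_zero[of c] by linarith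
    then have "0 < 1 / (escR a + cmod c)" by simp
    from tendstoD[OF l0 this] obtain n where "cmod (G (q n) z0) < 1 / (escR a + cmod c)"
      by (auto simp: eventually_sequentially)
    then show False using low[of "q n"] by simp
  qed
qed

lemma postcrit_filled: "postcrit a \<inter> filled a = {}"
  using postcrit_D escape_outside_D by blast

lemma zero_escapes: "0 \<notin> filled a"
proof
  assume "0 \<in> filled a"
  then have "qf a 0 \<in> filled a" using filled_iter_iff[OF a0, of 1 0] by (simp add: quartic_Fin_eq_iff)
  then show False using postcrit_filled qf_0_postcrit by blast
qed

text \<open>The orbit of 0 escapes, so it meets a bounded set at finitely many times only. This
  gives closedness of the postcritical set in the plane.\<close>

lemma finite_postcrit_cball: "finite (postcrit a \<inter> cball 0 R)"
proof -
  obtain n where n: "big a (iter a n 0)" using zero_escapes by (auto simp: filled_def)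
  obtain m where m: "R < 2 ^ m" using real_arch_pow[of 2 R] by auto
  have "postcrit a \<inter> cball 0 R \<subseteq> {1, - 1} \<union> unFin ` (\<lambda>k. iter a k 0) ` {..n + m}"
  proof
    fix w assume w: "w \<in> postcrit a \<inter> cball 0 R"
    show "w \<in> {1, - 1} \<union> unFin ` (\<lambda>k. iter a k 0) ` {..n + m}"
    proof (cases "w \<in> {1, - 1}")
      case False
      then obtain k where k: "iter a k 0 = Fin w" using w by (auto simp: postcrit_def)
      have "k \<le> n + m"
      proof (rule ccontr)
        assume "\<not> k \<le> n + m"
        then have e: "k = (k - n) + n" and "m \<le> k - n" by auto
        have "(quartic a ^^ (k - n)) (iter a n 0) = Fin w"
          using k e by (metis comp_apply funpow_add)
        then have "cmod w \<ge> 2 ^ (k - n)" using big_iter_growth[OF a0 n] by blast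
        moreover have "(2::real) ^ m \<le> 2 ^ (k - n)" using \<open>m \<le> k - n\<close> by (intro power_increasing) auto
        moreover have "cmod w \<le> R" using w by simp
        ultimately show False using m by linarith
      qed
      moreover have "w = unFin (iter a k 0)" using k by simp
      ultimately show ?thesis by blast
    qed blast
  qed
  then show ?thesis by (rule finite_subset) simp
qed

lemma closed_postcrit: "closed (postcrit a)"
  unfolding closed_limpt
proof (intro allI impI)
  fix x assume "x islimpt postcrit a"
  then have "infinite (postcrit a \<inter> cball x 1)" by (simp add: islimpt_eq_infinite_cball)
  moreover have "cball x 1 \<subseteq> cball 0 (cmod x + 1)"
    by (auto simp: dist_norm) (smt (verit) norm_triangle_ineq2 norm_minus_commute)
  ultimately have "infinite (postcrit a \<inter> cball 0 (cmod x + 1))"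
    using finite_subset[of "postcrit a \<inter> cball x 1" "postcrit a \<inter> cball 0 (cmod x + 1)"] by blast
  then show "x \<in> postcrit a" using finite_postcrit_cball by blast
qed

lemma closed_D_preimage: "closed {z. iter a 2 z \<in> Fin ` D}"
  by (rule closed_iter_preimage[OF a0 compact_D])

text \<open>Since \<open>quartic a\<close> is even, forward invariance would make \<open>D\<close> symmetric, and Brouwer's
  theorem would put the fixed point 0 of the reflection into \<open>D\<close>.\<close>

lemma not_forward_invariant: "\<not> D \<subseteq> {z. iter a 2 z \<in> Fin ` D}"
proof
  assume sub: "D \<subseteq> {z. iter a 2 z \<in> Fin ` D}"
  have "- z \<in> D" if "z \<in> D" for z
  proof (rule Dback)
    have "iter a 2 (- z) = iter a 2 z" by (simp add: numeral_2_eq_2 funpow_Suc_right del: funpow.simps)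
    then show "iter a 2 (- z) \<in> Fin ` D" using sub that by auto
  qed
  moreover have "\<exists>y\<in>cball 0 1. g y = y" if g: "continuous_on (cball 0 1) g" "g \<in> cball 0 1 \<rightarrow> cball (0::complex) 1" for g
  proof -
    obtain y where "y \<in> cball 0 1" "g y = y"
      by (rule brouwer[of "cball (0::complex) 1" g]) (use g in auto)
    then show ?thesis by blast
  qed
  then have "\<forall>f. continuous_on D f \<and> f \<in> D \<rightarrow> D \<longrightarrow> (\<exists>x\<in>D. f x = x)"
    unfolding homeomorphic_fixpoint_property[OF Dh] by blast
  then have "continuous_on D uminus \<and> uminus \<in> D \<rightarrow> D \<longrightarrow> (\<exists>x\<in>D. - x = x)" by blast
  ultimately have "\<exists>x\<in>D. - x = x" by (auto intro: continuous_intros)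
  then have "0 \<in> D" by (auto simp: minus_equation_iff)
  then show False using sub Dfv by auto
qed

end


subsection \<open>Contraction of inverse branches\<close>

lemma iter_Infty_add: "iter a n z = Infty \<Longrightarrow> iter a (m + n) z = Infty"
  by (simp add: funpow_add)

context disc
begin

text \<open>Otherwise Montel's theorem yields a nonconstant limit of inverse branches, whose image lies
  in the filled set; comparing successive branches there produces lifts of the identity of \<open>D\<close>
  that converge to the identity, so that \<open>D\<close> would be forward invariant.\<close>

lemma contraction_deriv:
  assumes r: "r > 0" and disj: "ball p (2 * r) \<inter> postcrit a = {}"
  shows "\<exists>N. \<forall>k\<ge>N. k mod 2 = b \<longrightarrow> (\<forall>S. lifts a k (ball p (2 * r)) (\<lambda>x. x) S \<longrightarrow>
    (\<forall>x\<in>cball p r. cmod (deriv S x) \<le> 1 / 2))"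
proof (rule ccontr)
  let ?B = "ball p (2 * r)"
  assume "\<not> ?thesis"
  then have "\<forall>N. \<exists>k S x. k \<ge> N \<and> k mod 2 = b \<and> lifts a k ?B (\<lambda>x. x) S \<and> x \<in> cball p r \<and> cmod (deriv S x) > 1 / 2"
    by (meson not_le)
  then obtain kk SS xx where kk: "\<And>N. kk N \<ge> N" "\<And>N. kk N mod 2 = b"
    and SS: "\<And>N. lifts a (kk N) ?B (\<lambda>x. x) (SS N)"
    and xx: "\<And>N. xx N \<in> cball p r" "\<And>N. cmod (deriv (SS N) (xx N)) > 1 / 2"
    by metis
  have hol: "SS N holomorphic_on ?B" for N
    by (rule lift_holomorphic[OF a0 _ _ SS]) (use disj in \<open>auto intro: holomorphic_intros\<close>)
  have SSb: "cmod (SS N x) \<le> max (escR a) (cmod p + 2 * r)" if "x \<in> ?B" for N x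
  proof -
    have "cmod (SS N x) \<le> max (escR a) (cmod x)"
      by (rule iter_norm_bound[OF a0 liftsD[OF SS that]])
    moreover have "cmod x \<le> cmod p + 2 * r"
      using that norm_triangle_sub[of x p] by (simp add: dist_norm norm_minus_commute)
    ultimately show ?thesis by simp
  qed
  obtain g q where g: "g holomorphic_on ?B" and q: "strict_mono (q::nat\<Rightarrow>nat)"
    and lim: "\<And>x. x \<in> ?B \<Longrightarrow> (\<lambda>n. SS (q n) x) \<longlonglongrightarrow> g x"
    and ulim: "\<And>K. compact K \<Longrightarrow> K \<subseteq> ?B \<Longrightarrow> uniform_limit K (SS \<circ> q) g sequentially"
  proof (rule Montel[of ?B "range SS" SS])
    show "\<exists>B. \<forall>h\<in>range SS. \<forall>z\<in>K. cmod (h z) \<le> B" if "compact K" "K \<subseteq> ?B" for K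
      using that SSb by blast
  qed (use hol in auto)
  define s where "s j = SS (q j)" for j
  define k where "k j = kk (q j)" for j
  have k: "k j \<ge> j" "k j mod 2 = b" for j
    using kk[of "q j"] seq_suble[OF q, of j] by (auto simp: k_def)
  have s: "lifts a (k j) ?B (\<lambda>x. x) (s j)" for j using SS by (simp add: s_def k_def)
  have lim: "(\<lambda>j. s j x) \<longlonglongrightarrow> g x" if "x \<in> ?B" for x using lim[OF that] by (simp add: s_def)
  \<comment> \<open>If the limit were constant, the Cauchy estimate on a disc of radius
    \<open>r / 2\<close> would bound the derivatives by
    \<open>(r / 8) / (r / 2) = 1 / 4\<close>.\<close>
  have nonconst: "\<not> g constant_on ?B"
  proof
    assume "g constant_on ?B"
    then obtain c where c: "\<And>x. x \<in> ?B \<Longrightarrow> g x = c" by (auto simp: constant_on_def)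
    have sub: "cball p (3 / 2 * r) \<subseteq> ?B" using r by (intro cball_subset_ball_iff[THEN iffD2]) auto
    have "uniform_limit (cball p (3 / 2 * r)) (SS \<circ> q) g sequentially" by (rule ulim[OF _ sub]) simp
    from uniform_limitD[OF this, of "r / 8"] r
    obtain n where "\<forall>x\<in>cball p (3 / 2 * r). dist ((SS \<circ> q) n x) (g x) < r / 8"
      unfolding eventually_sequentially by auto
    then have n: "\<And>x. x \<in> cball p (3 / 2 * r) \<Longrightarrow> dist (s n x) (g x) < r / 8"
      by (simp add: s_def)
    define x where "x = xx (q n)"
    have x: "x \<in> cball p r" "cmod (deriv (s n) x) > 1 / 2" using xx by (auto simp: x_def s_def)
    have cb: "cball x (r / 2) \<subseteq> cball p (3 / 2 * r)"
      using x(1) by (auto simp: dist_norm) (smt (verit) norm_diff_triangle_ineq norm_triangle_ineq4 norm_minus_commute diff_add_cancel add_diff_eq diff_diff_eq2 norm_triangle_ineq)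
    have h: "s n holomorphic_on ?B" using hol by (simp add: s_def)
    have h': "(\<lambda>y. s n y - c) holomorphic_on cball x (r / 2)"
      by (intro holomorphic_intros holomorphic_on_subset[OF h]) (use cb sub in blast)
    have "cmod ((deriv ^^ 1) (\<lambda>y. s n y - c) x) \<le> fact 1 * (r / 8) / (r / 2) ^ 1"
    proof (rule Cauchy_inequality)
      show "(\<lambda>y. s n y - c) holomorphic_on ball x (r / 2)" using h' holomorphic_on_subset ball_subset_cball by blast
      show "continuous_on (cball x (r / 2)) (\<lambda>y. s n y - c)" using h' by (rule holomorphic_on_imp_continuous_on)
      show "cmod (s n y - c) \<le> r / 8" if "cmod (x - y) = r / 2" for y
      proof -
        have "y \<in> cball p (3 / 2 * r)" using cb that by (auto simp: dist_norm)
        then show ?thesis using n[of y] c sub by (force simp: dist_norm)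
      qed
    qed (use r in auto)
    moreover have "x \<in> ?B" using x(1) r by auto
    then have "s n field_differentiable at x" using h holomorphic_on_imp_differentiable_at by blast
    then have "deriv (\<lambda>y. s n y - c) x = deriv (s n) x" by (simp add: deriv_diff)
    ultimately show False using x(2) r by simp
  qed
  define O' where "O' = g ` ?B"
  have O': "open O'" unfolding O'_def by (rule open_mapping_thm[OF g _ _ _ _ nonconst]) auto
  \<comment> \<open>If a limit value \<open>y = g x\<close> escaped, its neighbours
    \<open>s j x\<close> would be sent far away by the iterate of order \<open>k j\<close>; but they
    are sent to \<open>x\<close>.\<close>
  have OK: "O' \<subseteq> filled a"
  proof
    fix y assume "y \<in> O'"
    then obtain x where x: "x \<in> ?B" "y = g x" by (auto simp: O'_def)
    show "y \<in> filled a"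
    proof (rule ccontr)
      assume "y \<notin> filled a"
      then obtain d n where d: "d > 0" and esc: "\<And>z' m w. z' \<in> ball y d \<Longrightarrow> n \<le> m \<Longrightarrow> iter a m z' = Fin w \<Longrightarrow> cmod w \<ge> 2 ^ (m - n)"
        using escape_nbhd[OF a0] by metis
      obtain m where m: "cmod x < 2 ^ m" using real_arch_pow[of 2 "cmod x"] by auto
      have "\<forall>\<^sub>F j in sequentially. dist (s j x) y < d" using tendstoD[OF lim[OF x(1)] d] x(2) by simp
      moreover have "\<forall>\<^sub>F j in sequentially. j \<ge> n + m" by (rule eventually_ge_at_top)
      ultimately have "\<forall>\<^sub>F j in sequentially. False"
      proof eventually_elim
        case (elim j)
        then have "n \<le> k j" "m \<le> k j - n" using k(1)[of j] by auto
        then have "cmod x \<ge> 2 ^ (k j - n)"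
          using esc[of "s j x" "k j" x] liftsD[OF s x(1), of j] elim by (auto simp: dist_commute)
        moreover have "(2::real) ^ m \<le> 2 ^ (k j - n)" using \<open>m \<le> k j - n\<close> by (intro power_increasing) auto
        ultimately show False using m by linarith
      qed
      then show False by simp
    qed
  qed
  have filb: "cmod (phi a n y) \<le> escR a \<and> phi a n y \<in> filled a \<and> iter a n y = Fin (phi a n y)" if "y \<in> O'" for n y
  proof -
    have yf: "y \<in> filled a" using OK that by blast
    have e: "iter a n y = Fin (phi a n y)" using iter_phi[OF a0 filled_notin_Infty[OF yf]] .
    then have "phi a n y \<in> filled a" using filled_iter_iff[OF a0 e] yf by simp
    then show ?thesis using e filled_subset[of a] by auto
  qed
  have phol: "phi a n holomorphic_on O'" for n
    by (rule phi_holomorphic[OF a0]) (use OK filled_notin_Infty in blast)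
  obtain G u where G: "G holomorphic_on O'" and u: "strict_mono (u::nat\<Rightarrow>nat)"
    and Glim: "\<And>x. x \<in> O' \<Longrightarrow> (\<lambda>n. phi a (k (u n)) x) \<longlonglongrightarrow> G x"
    and Gulim: "\<And>K. compact K \<Longrightarrow> K \<subseteq> O' \<Longrightarrow> uniform_limit K ((\<lambda>n. phi a (k n)) \<circ> u) G sequentially"
  proof (rule Montel[OF O', of "range (\<lambda>n. phi a (k n))" "\<lambda>n. phi a (k n)"])
    show "\<exists>B. \<forall>h\<in>range (\<lambda>n. phi a (k n)). \<forall>z\<in>K. cmod (h z) \<le> B" if "compact K" "K \<subseteq> O'" for K
      using that filb by blast
  qed (use phol in auto)
  have comp: "(\<lambda>n. phi a (k (u n)) (s (v n) x)) \<longlonglongrightarrow> G (g x)"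
    if x: "x \<in> ?B" and v: "filterlim v sequentially sequentially" for x v
  proof -
    have gx: "g x \<in> O'" using x by (simp add: O'_def)
    then obtain e where e: "e > 0" "cball (g x) e \<subseteq> O'" using O' open_contains_cball by blast
    have l: "(\<lambda>n. s (v n) x) \<longlonglongrightarrow> g x" using filterlim_compose[OF lim[OF x] v] .
    have "uniform_limit (cball (g x) e) (\<lambda>n. phi a (k (u n))) G sequentially"
      using Gulim[OF _ e(2)] by (simp add: comp_def)
    moreover have "continuous_on (cball (g x) e) G"
      using G e(2) holomorphic_on_imp_continuous_on continuous_on_subset by blast
    moreover have "\<forall>\<^sub>F n in sequentially. s (v n) x \<in> cball (g x) e"
      using tendstoD[OF l e(1)] by eventually_elim (simp add: dist_commute)
    ultimately show ?thesis by (rule uniform_limit_compose_seq[OF _ _ _ l]) (use e in simp)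
  qed
  \<comment> \<open>Along the subsequence the iterate undoes its own branch, so the limit of
    iterates is a left inverse of the limit of branches.\<close>
  have Gg: "G (g x) = x" if "x \<in> ?B" for x
  proof -
    have "filterlim u sequentially sequentially" using u by (rule filterlim_subseq)
    from comp[OF that this] have "(\<lambda>n. phi a (k (u n)) (s (u n) x)) \<longlonglongrightarrow> G (g x)" .
    moreover have "phi a (k (u n)) (s (u n) x) = x" for n using phi_eq[OF a0 liftsD[OF s that]] .
    ultimately show ?thesis using LIMSEQ_unique[OF _ tendsto_const] by simp
  qed
  have BK: "?B \<subseteq> filled a"
  proof
    fix x assume x: "x \<in> ?B"
    have "(\<lambda>n. phi a (k (u n)) (g x)) \<longlonglongrightarrow> x" using Glim[of "g x"] x Gg[OF x] by (simp add: O'_def)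
    moreover have "closed (filled a)" using compact_filled[OF a0] compact_imp_closed by blast
    moreover have "phi a (k (u n)) (g x) \<in> filled a" for n using filb[of "g x"] x by (simp add: O'_def)
    ultimately show "x \<in> filled a" unfolding closed_sequential_limits by metis
  qed
  then have BD: "?B \<subseteq> D" using escape_outside_D by blast
  \<comment> \<open>Combining an iterate with a strictly later branch leaves a branch of order
    \<open>m n\<close>, positive and even, that tends to the identity. Evenness is the reason for
    fixing the parity \<open>b\<close>.\<close>
  define v where "v n = k (u n) + 1" for n
  define R where "R n x = phi a (k (u n)) (s (v n) x)" for n x
  define m where "m n = k (v n) - k (u n)" for n
  have km: "k (v n) = m n + k (u n)" "m n \<ge> 1" "even (m n)" for n
  proof -
    have "k (v n) \<ge> k (u n) + 1" using k(1)[of "v n"] by (simp add: v_def)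
    moreover have "k (v n) mod 2 = k (u n) mod 2" using k(2) by metis
    ultimately show "k (v n) = m n + k (u n)" "m n \<ge> 1" "even (m n)"
      by (auto simp: m_def mod2_eq_if split: if_splits)
  qed
  have "v n \<ge> n" for n using k(1)[of "u n"] seq_suble[OF u, of n] by (simp add: v_def)
  then have vlim: "filterlim v sequentially sequentially"
    by (rule filterlim_at_top_mono[OF filterlim_ident always_eventually[rule_format]])
  have Rlim: "(\<lambda>n. R n x) \<longlonglongrightarrow> x" if "x \<in> ?B" for x
    unfolding R_def using comp[OF that vlim] Gg[OF that] by simp
  have Rl: "lifts a (m n) ?B (\<lambda>x. x) (R n)" for n
    unfolding R_def by (rule lifts_push(1)[OF a0]) (use s[of "v n"] km(1) in simp)
  have pB: "p \<in> ?B" using r by simp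
  \<comment> \<open>Now \<open>D\<close> is contractible and free of postcritical points, so the
    local branch extends to all of \<open>D\<close>.\<close>
  have "\<exists>T. lifts a (m n) D (\<lambda>x. x) T \<and> T p = R n p" for n
    by (rule lift_exists[OF a0 contractible_D, of "\<lambda>x. x" p "m n" "R n p"])
       (use postcrit_D BD pB liftsD[OF Rl pB, of n] in auto)
  then obtain T where T: "\<And>n. lifts a (m n) D (\<lambda>x. x) (T n)" "\<And>n. T n p = R n p" by metis
  have TR: "T n x = R n x" if "x \<in> ?B" for n x
    by (rule lift_unique[OF a0 _ lifts_subset[OF T(1) BD] Rl, of p]) (use disj pB T(2) that in auto)
  obtain E where E: "open E" "connected E" "E \<noteq> {}" "E \<subseteq> D" "D \<subseteq> closure E"
    using D_dense_interior by metis
  have Thol: "T n holomorphic_on E" for n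
    by (rule lift_holomorphic[OF a0 E(1) _ lifts_subset[OF T(1) E(4)]]) (use postcrit_D E(4) in \<open>auto intro: holomorphic_intros\<close>)
  \<comment> \<open>The point \<open>T n x\<close> reaches \<open>x\<close> in
    \<open>m n \<ge> 2\<close> steps. After the first two of them an even number remains, so both
    \<open>T n x\<close> and its second image lie in \<open>D\<close>.\<close>
  have Tx: "T n x \<in> D \<and> iter a 2 (T n x) \<in> Fin ` D" if "x \<in> D" for n x
  proof -
    have i: "iter a (m n) (T n x) = Fin x" using liftsD[OF T(1) that] .
    obtain m' where m': "m n = 2 * m' + 2" using km(2,3)[of n] by (metis One_nat_def Suc_1 Suc_leD add_2_eq_Suc' dvd_def mult_Suc_right not_less_eq_eq add.commute less_eq_Suc_le mult_0_right not0_implies_Suc not_one_le_zero)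
    have "iter a (2 * (m' + 1)) (T n x) = Fin x" using i m' by simp
    then have 1: "T n x \<in> D" using Dback_even[of "m' + 1"] that by auto
    have f: "iter a (2 * m' + 2) (T n x) = Fin x" using i m' by simp
    obtain y where y: "iter a 2 (T n x) = Fin y"
      using f iter_Infty_add[of 2 a "T n x" "2 * m'"] by (cases "iter a 2 (T n x)") auto
    then have "iter a (2 * m') y = Fin x" using f iter_add[OF y] by simp
    then have "y \<in> D" using Dback_even[of m' y] that by auto
    then show ?thesis using 1 y by simp
  qed
  obtain M where M: "\<And>z. z \<in> D \<Longrightarrow> cmod z \<le> M" using compact_imp_bounded[OF compact_D] unfolding bounded_iff by blast
  obtain T' w where T': "T' holomorphic_on E" and w: "strict_mono (w::nat\<Rightarrow>nat)"
    and Tlim: "\<And>x. x \<in> E \<Longrightarrow> (\<lambda>n. T (w n) x) \<longlonglongrightarrow> T' x"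
  proof (rule Montel[OF E(1), of "range T" T])
    show "\<exists>B. \<forall>h\<in>range T. \<forall>z\<in>K. cmod (h z) \<le> B" if "compact K" "K \<subseteq> E" for K
      using that Tx M E(4) by (intro exI[of _ M]) blast
  qed (use Thol in auto)
  have "?B \<inter> E \<noteq> {}"
    using pB BD E(5) open_Int_closure_eq_empty[of ?B E] by blast
  have "T' x = x" if "x \<in> E" for x
  proof (rule analytic_continuation_open[OF _ E(1) \<open>?B \<inter> E \<noteq> {}\<close> E(2) _ T', of "\<lambda>x. x"])
    fix y assume y: "y \<in> ?B \<inter> E"
    have "(\<lambda>n. T (w n) y) \<longlonglongrightarrow> y"
      using LIMSEQ_subseq_LIMSEQ[OF Rlim w, of y] TR y by (simp add: comp_def)
    then show "T' y = y" using Tlim y LIMSEQ_unique by blast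
  qed (use E that in \<open>auto intro: holomorphic_intros\<close>)
  then have "(\<lambda>n. T (w n) x) \<longlonglongrightarrow> x" if "x \<in> E" for x using Tlim[OF that] that by simp
  moreover have "T (w n) x \<in> {z. iter a 2 z \<in> Fin ` D}" if "x \<in> E" for n x using Tx E(4) that by blast
  ultimately have "E \<subseteq> {z. iter a 2 z \<in> Fin ` D}"
    using closed_D_preimage unfolding closed_sequential_limits by (metis subsetI)
  then have "closure E \<subseteq> {z. iter a 2 z \<in> Fin ` D}" using closed_D_preimage by (rule closure_minimal)
  then show False using E(5) not_forward_invariant by blast
qed

text \<open>Both parities of \<open>contraction_deriv\<close> are merged, and the derivative bound
  becomes a Lipschitz bound on the convex ball.\<close>

lemma contraction:
  assumes "p \<notin> postcrit a"
  obtains r N where "r > 0" "\<And>k S x y. k \<ge> N \<Longrightarrow> lifts a k (ball p (2 * r)) (\<lambda>x. x) S \<Longrightarrow>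
    x \<in> ball p r \<Longrightarrow> y \<in> ball p r \<Longrightarrow> dist (S x) (S y) \<le> dist x y / 2" "ball p (2 * r) \<inter> postcrit a = {}"
proof -
  have "open (- postcrit a)" using closed_postcrit by (simp add: open_Compl)
  then obtain e where e: "e > 0" "ball p e \<subseteq> - postcrit a" using assms by (auto simp: open_contains_ball)
  define r where "r = e / 2"
  have r: "r > 0" and disj: "ball p (2 * r) \<inter> postcrit a = {}" using e by (auto simp: r_def)
  obtain N0 N1 where N0: "\<And>k S x. k \<ge> N0 \<Longrightarrow> k mod 2 = 0 \<Longrightarrow> lifts a k (ball p (2 * r)) (\<lambda>x. x) S \<Longrightarrow> x \<in> cball p r \<Longrightarrow> cmod (deriv S x) \<le> 1 / 2"
    and N1: "\<And>k S x. k \<ge> N1 \<Longrightarrow> k mod 2 = 1 \<Longrightarrow> lifts a k (ball p (2 * r)) (\<lambda>x. x) S \<Longrightarrow> x \<in> cball p r \<Longrightarrow> cmod (deriv S x) \<le> 1 / 2"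
    using contraction_deriv[OF r disj] by metis
  define N where "N = max N0 N1"
  have N: "cmod (deriv S x) \<le> 1 / 2" if "k \<ge> N" "lifts a k (ball p (2 * r)) (\<lambda>x. x) S" "x \<in> cball p r" for k S x
    using N0[OF _ _ that(2,3)] N1[OF _ _ that(2,3)] that(1)
    by (cases "k mod 2 = 0") (auto simp: N_def)
  show thesis
  proof (rule that[OF r _ disj])
    fix k S x y assume k: "k \<ge> N" and S: "lifts a k (ball p (2 * r)) (\<lambda>x. x) S"
      and xy: "x \<in> ball p r" "y \<in> ball p r"
    have hol: "S holomorphic_on ball p (2 * r)"
      by (rule lift_holomorphic[OF a0 _ _ S]) (use disj in \<open>auto intro: holomorphic_intros\<close>)
    have "cmod (S x - S y) \<le> 1 / 2 * cmod (x - y)"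
    proof (rule field_differentiable_bound[of "ball p r" S "deriv S"])
      show "(S has_field_derivative deriv S z) (at z within ball p r)" if "z \<in> ball p r" for z
        using holomorphic_derivI[OF hol] that r by auto
      show "cmod (deriv S z) \<le> 1 / 2" if "z \<in> ball p r" for z using N[OF k S] that by auto
    qed (use xy in auto)
    then show "dist (S x) (S y) \<le> dist x y / 2" by (simp add: dist_norm)
  qed
qed

end


section \<open>Exponential shrinking of lifted paths\<close>

context disc
begin

text \<open>A backward invariant set containing \<open>A0\<close>: lifts of paths in
  \<open>A0\<close> stay in it, so that contraction at its points can be applied again and again.
  The filled set is added to make it closed.\<close>

definition back_orbit :: "complex set \<Rightarrow> complex set" where
  "back_orbit A0 = filled a \<union> {z. \<exists>k. iter a k z \<in> Fin ` A0}"

lemma back_orbit_superset: "A0 \<subseteq> back_orbit A0"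
  unfolding back_orbit_def by (auto intro: exI[of _ 0])

lemma back_orbit_back:
  assumes "iter a k z = Fin w" "w \<in> back_orbit A0"
  shows "z \<in> back_orbit A0"
proof -
  have "iter a (j + k) z = iter a j w" for j using iter_add[OF assms(1)] .
  then have "iter a j w \<in> Fin ` A0 \<Longrightarrow> iter a (j + k) z \<in> Fin ` A0" for j by simp
  then show ?thesis
    using assms(2) filled_iter_iff[OF a0 assms(1)] unfolding back_orbit_def by blast
qed

lemma back_orbit_postcrit: "A0 \<inter> postcrit a = {} \<Longrightarrow> back_orbit A0 \<inter> postcrit a = {}"
  using postcrit_filled postcrit_back unfolding back_orbit_def by fastforce

text \<open>Preimages of \<open>A0\<close> accumulate only at the filled set. Near any other point
  orbits escape beyond the bound of \<open>A0\<close> after a fixed time, so locally the union of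
  preimages is finite, and each of them is closed.\<close>

lemma compact_back_orbit:
  assumes A0: "compact A0"
  shows "compact (back_orbit A0)"
proof -
  obtain M where M: "\<And>w. w \<in> A0 \<Longrightarrow> cmod w \<le> M"
    using compact_imp_bounded[OF A0] unfolding bounded_iff by blast
  have "cmod z \<le> max (escR a) M" if "z \<in> back_orbit A0" for z
    using that unfolding back_orbit_def
  proof
    assume "z \<in> filled a"
    then show ?thesis using filled_subset[of a] by auto
  next
    assume "z \<in> {z. \<exists>k. iter a k z \<in> Fin ` A0}"
    then obtain k w where "iter a k z = Fin w" "w \<in> A0" by auto
    then show ?thesis using iter_norm_bound[OF a0] M by (meson max.mono order_refl order_trans)
  qed
  then have bd: "bounded (back_orbit A0)" unfolding bounded_iff by blast
  have "\<exists>T. open T \<and> l \<in> T \<and> T \<subseteq> - back_orbit A0" if l: "l \<in> - back_orbit A0" for l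
  proof -
    have "l \<notin> filled a" using l by (auto simp: back_orbit_def)
    then obtain d n where d: "d > 0"
      and esc: "\<And>z' m w. z' \<in> ball l d \<Longrightarrow> n \<le> m \<Longrightarrow> iter a m z' = Fin w \<Longrightarrow> cmod w \<ge> 2 ^ (m - n)"
      and bg: "\<And>z' m. z' \<in> ball l d \<Longrightarrow> n \<le> m \<Longrightarrow> big a (iter a m z')"
      using escape_nbhd[OF a0] by metis
    obtain j where j: "M < 2 ^ j" using real_arch_pow[of 2 M] by auto
    define C where "C = (\<Union>k<n + j. {z. iter a k z \<in> Fin ` A0})"
    have "closed C" unfolding C_def by (intro closed_UN ballI closed_iter_preimage[OF a0 A0]) auto
    moreover have "l \<notin> C" using l by (auto simp: C_def back_orbit_def)
    moreover have "z \<notin> back_orbit A0" if z: "z \<in> ball l d" "z \<notin> C" for z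
    proof
      assume "z \<in> back_orbit A0"
      moreover have "z \<notin> filled a" using bg[OF z(1) order_refl] by (auto simp: filled_def)
      ultimately obtain k w where k: "iter a k z = Fin w" "w \<in> A0" unfolding back_orbit_def by blast
      then have "\<not> k < n + j" using z(2) by (auto simp: C_def)
      then have "n \<le> k" "j \<le> k - n" by auto
      then have "cmod w \<ge> 2 ^ (k - n)" using esc[OF z(1) _ k(1)] by blast
      moreover have "(2::real) ^ j \<le> 2 ^ (k - n)" using \<open>j \<le> k - n\<close> by (intro power_increasing) auto
      ultimately show False using M[OF k(2)] j by linarith
    qed
    ultimately show ?thesis using d by (intro exI[of _ "ball l d - C"]) (auto simp: open_Diff)
  qed
  then have "open (- back_orbit A0)" using open_subopen[of "- back_orbit A0"] by blast
  then show ?thesis using bd by (simp add: compact_eq_bounded_closed closed_def)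
qed

lemma path_contract:
  assumes A: "compact A" "A \<inter> postcrit a = {}"
  obtains \<rho> N where "\<rho> > 0" "N > 0"
    "\<And>k \<gamma> \<delta> s t. k \<ge> N \<Longrightarrow> lifts a k {0..1} \<gamma> \<delta> \<Longrightarrow> path \<gamma> \<Longrightarrow> \<gamma> 0 \<in> A \<Longrightarrow> \<gamma> ` {0..1} \<subseteq> ball (\<gamma> 0) s \<Longrightarrow>
      s \<le> \<rho> \<Longrightarrow> t \<in> {0..1} \<Longrightarrow> \<delta> t \<in> ball (\<delta> 0) (s / 2)"
proof -
  have "\<exists>r N. r > 0 \<and> (\<forall>k S x y. k \<ge> N \<longrightarrow> lifts a k (ball p (2 * r)) (\<lambda>x. x) S \<longrightarrow>
    x \<in> ball p r \<longrightarrow> y \<in> ball p r \<longrightarrow> dist (S x) (S y) \<le> dist x y / 2) \<and> ball p (2 * r) \<inter> postcrit a = {}" if "p \<in> A" for p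
  proof -
    have "p \<notin> postcrit a" using that A by blast
    from contraction[OF this] show ?thesis by metis
  qed
  then obtain r N where r: "\<And>p. p \<in> A \<Longrightarrow> r p > 0"
    and N: "\<And>p k S x y. p \<in> A \<Longrightarrow> k \<ge> N p \<Longrightarrow> lifts a k (ball p (2 * r p)) (\<lambda>x. x) S \<Longrightarrow>
      x \<in> ball p (r p) \<Longrightarrow> y \<in> ball p (r p) \<Longrightarrow> dist (S x) (S y) \<le> dist x y / 2"
    and disj: "\<And>p. p \<in> A \<Longrightarrow> ball p (2 * r p) \<inter> postcrit a = {}"
    by metis
  obtain F where F: "F \<subseteq> A" "finite F" "A \<subseteq> (\<Union>p\<in>F. ball p (r p / 2))"
  proof (rule compactE_image[OF A(1), of A "\<lambda>p. ball p (r p / 2)"])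
    show "A \<subseteq> (\<Union>p\<in>A. ball p (r p / 2))" using r by force
  qed auto
  \<comment> \<open>With half the radius, a path that starts in \<open>ball p (r p / 2)\<close> and
    stays within \<rho> of its start remains in \<open>ball p (r p)\<close>, where
    \<open>contraction\<close> applies.\<close>
  define \<rho> where "\<rho> = Min (insert 1 ((\<lambda>p. r p / 2) ` F))"
  define N' where "N' = Max (insert 1 (N ` F))"
  have \<rho>: "\<rho> > 0" "\<And>p. p \<in> F \<Longrightarrow> \<rho> \<le> r p / 2"
  proof -
    show "\<rho> > 0" using F r by (auto simp: \<rho>_def Min_gr_iff)
    show "\<rho> \<le> r p / 2" if "p \<in> F" for p
      unfolding \<rho>_def by (rule Min.coboundedI) (use F that in auto)
  qed
  have N': "N' > 0" "\<And>p. p \<in> F \<Longrightarrow> N p \<le> N'"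
    using F by (auto simp: N'_def Max_gr_iff)
  show thesis
  proof (rule that[OF \<rho>(1) N'(1)])
    fix k \<gamma> \<delta> s t
    assume k: "N' \<le> k" and L: "lifts a k {0..1} \<gamma> \<delta>" and \<gamma>: "path \<gamma>" "\<gamma> 0 \<in> A" "\<gamma> ` {0..1} \<subseteq> ball (\<gamma> 0) s"
      and s: "s \<le> \<rho>" and t: "t \<in> {0..1::real}"
    obtain p where p: "p \<in> F" "\<gamma> 0 \<in> ball p (r p / 2)" using F(3) \<gamma>(2) by blast
    have pA: "p \<in> A" using p(1) F(1) by blast
    have in_ball: "\<gamma> u \<in> ball p (r p)" if "u \<in> {0..1}" for u
    proof -
      have "dist (\<gamma> 0) (\<gamma> u) < s" using \<gamma>(3) that unfolding image_subset_iff mem_ball by blast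
      then show ?thesis using p(2) s \<rho>(2)[OF p(1)] dist_triangle[of p "\<gamma> u" "\<gamma> 0"] by simp
    qed
    have sub: "ball p (r p) \<subseteq> ball p (2 * r p)" using r[OF pA] by (intro subset_ball) simp
    have op: "opath a \<gamma>"
      using \<gamma>(1) in_ball sub disj[OF pA] unfolding opath_def path_image_def by blast
    obtain S where S: "lifts a k (ball p (2 * r p)) (\<lambda>x. x) S" "S (\<gamma> 0) = \<delta> 0"
    proof (rule lift_exists[OF a0 _ _ _ _, of "ball p (2 * r p)" "\<lambda>x. x" "\<gamma> 0" k "\<delta> 0"])
      show "iter a k (\<delta> 0) = Fin (\<gamma> 0)" using liftsD[OF L] by simp
      show "\<gamma> 0 \<in> ball p (2 * r p)" using in_ball[of 0] sub by auto
    qed (use disj[OF pA] in \<open>auto intro: convex_imp_contractible\<close>)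
    have SL: "lifts a k {0..1} \<gamma> (\<lambda>u. S (\<gamma> u))"
    proof (rule lifts_precomp[OF S(1)])
      show "continuous_on {0..1} \<gamma>" using \<gamma>(1) by (simp add: path_def)
      show "\<gamma> ` {0..1} \<subseteq> ball p (2 * r p)" using in_ball sub by blast
    qed
    have "\<delta> u = S (\<gamma> u)" if "u \<in> {0..1}" for u
      by (rule lift_path_unique[OF a0 op L SL]) (use S(2) that in auto)
    then have "dist (\<delta> 0) (\<delta> t) = dist (S (\<gamma> 0)) (S (\<gamma> t))" using t by simp
    also have "\<dots> \<le> dist (\<gamma> 0) (\<gamma> t) / 2"
      by (rule N[OF pA _ S(1)]) (use k N'(2)[OF p(1)] in_ball t in auto)
    also have "\<dots> < s / 2"
    proof -
      have "dist (\<gamma> 0) (\<gamma> t) < s" using \<gamma>(3) t unfolding image_subset_iff mem_ball by blast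
      then show ?thesis by simp
    qed
    finally show "\<delta> t \<in> ball (\<delta> 0) (s / 2)" by simp
  qed
qed

text \<open>The constant depends on the path only through the number \<open>M\<close> of pieces
  needed to make its oscillation smaller than \<rho>. It is therefore common to all paths with a
  common modulus of continuity, which \<open>inverse_branch_diameter\<close> exploits.\<close>

lemma lift_shrink:
  assumes A0: "compact A0" "A0 \<inter> postcrit a = {}"
  obtains \<theta> \<rho> where "0 < \<theta>" "\<theta> < 1" "\<rho> > 0"
    "\<And>M. M > 0 \<Longrightarrow> \<exists>C\<ge>0. \<forall>\<gamma> k \<delta>. path \<gamma> \<longrightarrow> path_image \<gamma> \<subseteq> A0 \<longrightarrow>
      (\<forall>t\<in>{0..1}. \<forall>t'\<in>{0..1}. \<bar>t - t'\<bar> \<le> 1 / real M \<longrightarrow> dist (\<gamma> t) (\<gamma> t') < \<rho>) \<longrightarrow>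
      lifts a k {0..1} \<gamma> \<delta> \<longrightarrow> dist (\<delta> 0) (\<delta> 1) \<le> C * \<theta> ^ k"
proof -
  define A where "A = back_orbit A0"
  have A: "compact A" "A \<inter> postcrit a = {}" "A0 \<subseteq> A"
    using compact_back_orbit back_orbit_postcrit back_orbit_superset A0 by (auto simp: A_def)
  have Aback: "z \<in> A" if "iter a k z = Fin w" "w \<in> A" for k z w
    using back_orbit_back that unfolding A_def by blast
  obtain \<rho> N where \<rho>: "\<rho> > 0" "N > 0" and
    contr: "\<And>k \<gamma> \<delta> s t. k \<ge> N \<Longrightarrow> lifts a k {0..1} \<gamma> \<delta> \<Longrightarrow> path \<gamma> \<Longrightarrow> \<gamma> 0 \<in> A \<Longrightarrow> \<gamma> ` {0..1} \<subseteq> ball (\<gamma> 0) s \<Longrightarrow>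
      s \<le> \<rho> \<Longrightarrow> t \<in> {0..1} \<Longrightarrow> \<delta> t \<in> ball (\<delta> 0) (s / 2)"
    using path_contract[OF A(1,2)] by metis
  \<comment> \<open>Every block of \<open>N\<close> steps halves the radius, as the intermediate
    lift again starts in the backward invariant set \<open>A\<close>.\<close>
  have iterated: "\<delta> t \<in> ball (\<delta> 0) (s / 2 ^ Suc j)"
    if "k \<ge> Suc j * N" "lifts a k {0..1} \<gamma> \<delta>" "path \<gamma>" "\<gamma> 0 \<in> A" "\<gamma> ` {0..1} \<subseteq> ball (\<gamma> 0) s" "s \<le> \<rho>" "t \<in> {0..1}"
    for j k \<gamma> \<delta> s t
    using that
  proof (induction j arbitrary: k \<gamma> s)
    case 0
    then show ?case using contr[of k \<gamma> \<delta> s t] by simp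
  next
    case (Suc j)
    define k' where "k' = k - N"
    have k: "k = N + k'" "k' \<ge> Suc j * N" using Suc.prems(1) by (auto simp: k'_def)
    define \<delta>' where "\<delta>' = (\<lambda>t. phi a k' (\<delta> t))"
    have L: "lifts a N {0..1} \<gamma> \<delta>'" "lifts a k' {0..1} \<delta>' \<delta>"
      using lifts_push[OF a0 Suc.prems(2)[unfolded k(1)]] by (auto simp: \<delta>'_def)
    have s0: "s > 0" using Suc.prems(5) by (metis ball_eq_empty image_is_empty not_le subset_empty atLeastAtMost_iff empty_iff zero_le_one order_refl)
    have "\<delta> t \<in> ball (\<delta> 0) (s / 2 / 2 ^ Suc j)"
    proof (rule Suc.IH[OF k(2) L(2)])
      show "path \<delta>'" using lifts_cont[OF L(1)] by (simp add: path_def)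
      show "\<delta>' 0 \<in> A" using liftsD[OF L(1), of 0] Suc.prems(4) Aback by simp
      show "\<delta>' ` {0..1} \<subseteq> ball (\<delta>' 0) (s / 2)"
        using contr[OF order_refl L(1) Suc.prems(3,4,5,6)] by blast
    qed (use s0 Suc.prems in auto)
    then show ?case by simp
  qed
  obtain B where B: "B \<ge> 0" "\<And>z. z \<in> A \<Longrightarrow> cmod z \<le> B"
    using compact_imp_bounded[OF A(1)] unfolding bounded_iff by (metis norm_ge_zero order_trans linear)
  define \<theta> where "\<theta> = (1 / 2 :: real) powr (1 / real N)"
  have \<theta>0: "\<theta> > 0" by (simp add: \<theta>_def)
  have \<theta>N: "\<theta> ^ N = 1 / 2"
    using \<rho>(2) by (simp add: \<theta>_def powr_powr flip: powr_realpow)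
  have \<theta>1: "\<theta> < 1"
  proof (rule ccontr)
    assume "\<not> \<theta> < 1"
    then have "\<theta> ^ N \<ge> 1" by (simp add: one_le_power)
    then show False using \<theta>N by simp
  qed
  show thesis
  proof (rule that[OF \<theta>0 \<theta>1 \<rho>(1)])
    fix M :: nat assume M: "M > 0"
    \<comment> \<open>The term \<open>2 * B\<close> covers the case of fewer than \<open>N\<close>
      steps; the outer factor 2 absorbs the rounding in \<open>k div N\<close>.\<close>
    define C where "C = 2 * (2 * B + real M * \<rho>)"
    have C0: "C \<ge> 0" using B \<rho> by (simp add: C_def)
    have "dist (\<delta> 0) (\<delta> 1) \<le> C * \<theta> ^ k"
      if \<gamma>: "path \<gamma>" "path_image \<gamma> \<subseteq> A0"
      and mod: "\<And>t t'. t \<in> {0..1} \<Longrightarrow> t' \<in> {0..1} \<Longrightarrow> \<bar>t - t'\<bar> \<le> 1 / real M \<Longrightarrow> dist (\<gamma> t) (\<gamma> t') < \<rho>"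
      and L: "lifts a k {0..1} \<gamma> \<delta>" for \<gamma> k \<delta>
    proof -
      have \<gamma>A: "\<gamma> t \<in> A" if "t \<in> {0..1}" for t using \<gamma>(2) A(3) that unfolding path_image_def by blast
      then have \<delta>A: "\<delta> t \<in> A" if "t \<in> {0..1}" for t using Aback[OF liftsD[OF L that]] that by blast
      have kdiv: "\<theta> ^ k \<ge> (1 / 2) ^ Suc (k div N)"
      proof -
        have "k \<le> N * Suc (k div N)" using dividend_less_times_div[OF \<rho>(2), of k] by (simp add: less_imp_le)
        then have "\<theta> ^ (N * Suc (k div N)) \<le> \<theta> ^ k" using \<theta>0 \<theta>1 by (intro power_decreasing) auto
        then show ?thesis unfolding power_mult \<theta>N .
      qed
      show ?thesis
      proof (cases "k div N")
        case 0
        have "dist (\<delta> 0) (\<delta> 1) \<le> 2 * B"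
          using B(2)[OF \<delta>A, of 0] B(2)[OF \<delta>A, of 1] norm_triangle_ineq4[of "\<delta> 0" "\<delta> 1"] by (simp add: dist_norm)
        also have "\<dots> \<le> C * (1 / 2)" using \<rho> by (simp add: C_def)
        also have "\<dots> \<le> C * \<theta> ^ k" using kdiv C0 unfolding 0 by (intro mult_left_mono) auto
        finally show ?thesis .
      next
        case (Suc j)
        have kj: "k \<ge> Suc j * N" using Suc by (metis div_times_less_eq_dividend)
        have step: "dist (\<delta> (real i / M)) (\<delta> (real (Suc i) / M)) \<le> \<rho> / 2 ^ Suc j" if "i < M" for i
        proof -
          define h where "h t = (real i + t) / M" for t :: real
          have h: "h t \<in> {0..1}" if "t \<in> {0..1}" for t
            using that \<open>i < M\<close> by (auto simp: h_def divide_le_eq)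
          have hc: "continuous_on {0..1} h" unfolding h_def by (intro continuous_intros) (use M in auto)
          have "lifts a k {0..1} (\<lambda>t. \<gamma> (h t)) (\<lambda>t. \<delta> (h t))"
            using lifts_precomp[OF L hc] h by blast
          moreover have "path (\<lambda>t. \<gamma> (h t))"
            unfolding path_def by (rule continuous_on_compose2[OF \<gamma>(1)[unfolded path_def] hc]) (use h in auto)
          moreover have "(\<lambda>t. \<gamma> (h t)) ` {0..1} \<subseteq> ball (\<gamma> (h 0)) \<rho>"
          proof safe
            fix t :: real assume t: "t \<in> {0..1}"
            have "\<bar>h 0 - h t\<bar> \<le> 1 / real M" using t by (simp add: h_def divide_right_mono flip: diff_divide_distrib)
            then show "\<gamma> (h t) \<in> ball (\<gamma> (h 0)) \<rho>" using mod[of "h 0" "h t"] h t by simp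
          qed
          ultimately have "\<delta> (h 1) \<in> ball (\<delta> (h 0)) (\<rho> / 2 ^ Suc j)"
            using iterated[OF kj, of "\<lambda>t. \<gamma> (h t)" "\<lambda>t. \<delta> (h t)" \<rho> 1] \<gamma>A h by simp
          then show ?thesis by (simp add: h_def add.commute)
        qed
        have "dist (\<delta> 0) (\<delta> (real i / M)) \<le> real i * (\<rho> / 2 ^ Suc j)" if "i \<le> M" for i
          using that
        proof (induction i)
          case (Suc i)
          then show ?case
            using step[of i] dist_triangle[of "\<delta> 0" "\<delta> (real (Suc i) / M)" "\<delta> (real i / M)"]
            by (simp add: distrib_right add_divide_distrib)
        qed simp
        from this[of M] have "dist (\<delta> 0) (\<delta> 1) \<le> real M * (\<rho> / 2 ^ Suc j)" using M by simp
        also have "\<dots> = 2 * (real M * \<rho>) * (1 / 2) ^ Suc (k div N)"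
          unfolding Suc by (simp add: power_divide)
        also have "\<dots> \<le> C * (1 / 2) ^ Suc (k div N)"
          using B by (intro mult_right_mono) (auto simp: C_def)
        also have "\<dots> \<le> C * \<theta> ^ k" using kdiv C0 by (intro mult_left_mono)
        finally show ?thesis .
      qed
    qed
    then show "\<exists>C\<ge>0. \<forall>\<gamma> k \<delta>. path \<gamma> \<longrightarrow> path_image \<gamma> \<subseteq> A0 \<longrightarrow>
      (\<forall>t\<in>{0..1}. \<forall>t'\<in>{0..1}. \<bar>t - t'\<bar> \<le> 1 / real M \<longrightarrow> dist (\<gamma> t) (\<gamma> t') < \<rho>) \<longrightarrow>
      lifts a k {0..1} \<gamma> \<delta> \<longrightarrow> dist (\<delta> 0) (\<delta> 1) \<le> C * \<theta> ^ k"
      using C0 by blast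
  qed
qed

lemma path_modulus:
  assumes "path \<gamma>" "\<rho> > 0"
  obtains M :: nat where "M > 0" "\<And>t t'. t \<in> {0..1} \<Longrightarrow> t' \<in> {0..1} \<Longrightarrow> \<bar>t - t'\<bar> \<le> 1 / real M \<Longrightarrow> dist (\<gamma> t) (\<gamma> t') < \<rho>"
proof -
  have "uniformly_continuous_on {0..1} \<gamma>"
    using assms(1) compact_uniformly_continuous unfolding path_def by blast
  then obtain d where d: "d > 0" "\<And>t t'. t \<in> {0..1} \<Longrightarrow> t' \<in> {0..1} \<Longrightarrow> dist t' t < d \<Longrightarrow> dist (\<gamma> t') (\<gamma> t) < \<rho>"
    using assms(2) unfolding uniformly_continuous_on_def by metis
  obtain n where n: "1 / real (Suc n) < d" using d(1) nat_approx_posE by blast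
  show thesis
  proof (rule that[of "Suc n"])
    fix t t' :: real assume "t \<in> {0..1}" "t' \<in> {0..1}" "\<bar>t - t'\<bar> \<le> 1 / real (Suc n)"
    then show "dist (\<gamma> t) (\<gamma> t') < \<rho>" using d(2)[of t' t] n by (simp add: dist_real_def)
  qed simp
qed

lemma paths_shrink:
  assumes "finite I" "\<And>i. i \<in> I \<Longrightarrow> opath a (\<gamma> i)"
  obtains \<theta> C where "0 < \<theta>" "\<theta> < 1" "C \<ge> 0"
    "\<And>i k z z'. i \<in> I \<Longrightarrow> lift_ends a k (\<gamma> i) z z' \<Longrightarrow> dist z z' \<le> C * \<theta> ^ k"
proof -
  have "compact (\<Union>i\<in>I. path_image (\<gamma> i))" "(\<Union>i\<in>I. path_image (\<gamma> i)) \<inter> postcrit a = {}"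
    using assms by (auto simp: opath_def compact_path_image intro!: compact_UN)
  from lift_shrink[OF this] obtain \<theta> \<rho> where \<theta>: "0 < \<theta>" "\<theta> < 1" "\<rho> > 0" and
    sh: "\<And>M. M > 0 \<Longrightarrow> \<exists>C\<ge>0. \<forall>\<gamma>' k \<delta>. path \<gamma>' \<longrightarrow> path_image \<gamma>' \<subseteq> (\<Union>i\<in>I. path_image (\<gamma> i)) \<longrightarrow>
      (\<forall>t\<in>{0..1}. \<forall>t'\<in>{0..1}. \<bar>t - t'\<bar> \<le> 1 / real M \<longrightarrow> dist (\<gamma>' t) (\<gamma>' t') < \<rho>) \<longrightarrow>
      lifts a k {0..1} \<gamma>' \<delta> \<longrightarrow> dist (\<delta> 0) (\<delta> 1) \<le> C * \<theta> ^ k"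
    by metis
  have "\<exists>C\<ge>0. \<forall>k z z'. lift_ends a k (\<gamma> i) z z' \<longrightarrow> dist z z' \<le> C * \<theta> ^ k" if i: "i \<in> I" for i
  proof -
    have p: "path (\<gamma> i)" using assms(2)[OF i] by (simp add: opath_def)
    obtain M :: nat where M: "M > 0" "\<And>t t'. t \<in> {0..1} \<Longrightarrow> t' \<in> {0..1} \<Longrightarrow> \<bar>t - t'\<bar> \<le> 1 / real M \<Longrightarrow> dist (\<gamma> i t) (\<gamma> i t') < \<rho>"
      using path_modulus[OF p \<theta>(3)] by metis
    obtain C where "C \<ge> 0" and C: "\<And>\<gamma>' k \<delta>. path \<gamma>' \<Longrightarrow> path_image \<gamma>' \<subseteq> (\<Union>i\<in>I. path_image (\<gamma> i)) \<Longrightarrow>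
      (\<forall>t\<in>{0..1}. \<forall>t'\<in>{0..1}. \<bar>t - t'\<bar> \<le> 1 / real M \<longrightarrow> dist (\<gamma>' t) (\<gamma>' t') < \<rho>) \<Longrightarrow>
      lifts a k {0..1} \<gamma>' \<delta> \<Longrightarrow> dist (\<delta> 0) (\<delta> 1) \<le> C * \<theta> ^ k"
      using sh[OF M(1)] by metis
    have "dist z z' \<le> C * \<theta> ^ k" if "lift_ends a k (\<gamma> i) z z'" for k z z'
      using that C[OF p] M(2) i unfolding lift_ends_def by blast
    then show ?thesis using \<open>C \<ge> 0\<close> by blast
  qed
  then obtain C where C: "\<And>i. i \<in> I \<Longrightarrow> C i \<ge> 0" "\<And>i k z z'. i \<in> I \<Longrightarrow> lift_ends a k (\<gamma> i) z z' \<Longrightarrow> dist z z' \<le> C i * \<theta> ^ k"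
    by metis
  show thesis
  proof (rule that[OF \<theta>(1,2), of "\<Sum>i\<in>I. C i"])
    show "0 \<le> (\<Sum>i\<in>I. C i)" by (rule sum_nonneg) (rule C(1))
    fix i k z z' assume i: "i \<in> I" "lift_ends a k (\<gamma> i) z z'"
    have "C i \<le> (\<Sum>i\<in>I. C i)" by (rule member_le_sum) (use i assms C in auto)
    then have "C i * \<theta> ^ k \<le> (\<Sum>i\<in>I. C i) * \<theta> ^ k" using \<theta> by (intro mult_right_mono) auto
    then show "dist z z' \<le> (\<Sum>i\<in>I. C i) * \<theta> ^ k" using C(2)[OF i] by simp
  qed
qed

end


subsection \<open>Square roots along paths\<close>

text \<open>Continuation of the roots of \<open>z - 1\<close> and \<open>z + 1\<close> along a path,
  recorded by the values at both ends. For a loop, end and start values differ by the two signs of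
  the overview.\<close>

definition roots_along :: "(real \<Rightarrow> complex) \<Rightarrow> complex \<Rightarrow> complex \<Rightarrow> complex \<Rightarrow> complex \<Rightarrow> bool" where
  "roots_along \<gamma> p q p' q' \<longleftrightarrow> (\<exists>\<alpha> \<beta>. continuous_on {0..1} \<alpha> \<and> continuous_on {0..1} \<beta> \<and>
     (\<forall>t\<in>{0..1}. (\<alpha> t)\<^sup>2 = \<gamma> t - 1 \<and> (\<beta> t)\<^sup>2 = \<gamma> t + 1) \<and> \<alpha> 0 = p \<and> \<beta> 0 = q \<and> \<alpha> 1 = p' \<and> \<beta> 1 = q')"

definition sg :: "bool \<Rightarrow> complex" where "sg b = (if b then - 1 else 1)"

lemma sg_sq [simp]: "(sg b)\<^sup>2 = 1" "sg b * sg b = 1" "sg b \<noteq> 0"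
  by (auto simp: sg_def power2_eq_square)

lemma sg_mult: "sg b * sg c = sg (b \<noteq> c)"
  by (auto simp: sg_def)

lemma sg_inj: "x \<noteq> 0 \<Longrightarrow> sg b * x = sg c * x \<longleftrightarrow> b = c"
  by (auto simp: sg_def)

lemma sq_eq_sg: "x\<^sup>2 = y\<^sup>2 \<Longrightarrow> \<exists>b. x = sg b * y"
proof -
  assume "x\<^sup>2 = y\<^sup>2"
  then have "x = y \<or> x = - y" by (simp add: power2_eq_iff)
  then show ?thesis by (auto simp: sg_def intro: exI[of _ True] exI[of _ False])
qed

lemma roots_along_ends:
  assumes "roots_along \<gamma> p q p' q'"
  shows "p\<^sup>2 = \<gamma> 0 - 1" "q\<^sup>2 = \<gamma> 0 + 1" "p'\<^sup>2 = \<gamma> 1 - 1" "q'\<^sup>2 = \<gamma> 1 + 1"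
  using assms unfolding roots_along_def by auto

lemma path_sqrt_ex:
  fixes \<gamma> :: "real \<Rightarrow> complex"
  assumes "continuous_on {0..1} \<gamma>" "\<And>t. t \<in> {0..1} \<Longrightarrow> \<gamma> t \<noteq> 0" "p\<^sup>2 = \<gamma> 0"
  obtains \<alpha> where "continuous_on {0..1} \<alpha>" "\<And>t. t \<in> {0..1} \<Longrightarrow> (\<alpha> t)\<^sup>2 = \<gamma> t" "\<alpha> 0 = p"
proof -
  have "contractible {0..1::real}" by (simp add: convex_imp_contractible)
  from continuous_sqrt_on_contractible[OF assms(1) this assms(2)]
  obtain s where s: "continuous_on {0..1} s" "\<And>t. t \<in> {0..1} \<Longrightarrow> \<gamma> t = (s t)\<^sup>2" by blast
  have "p\<^sup>2 = (s 0)\<^sup>2" using assms(3) s(2)[of 0] by simp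
  then obtain b where "p = sg b * s 0" using sq_eq_sg by blast
  then show thesis
    using s by (intro that[of "\<lambda>t. sg b * s t"]) (auto intro!: continuous_intros simp: power_mult_distrib)
qed

lemma path_sqrt_unique:
  fixes \<gamma> \<alpha> \<beta> :: "real \<Rightarrow> complex"
  assumes "continuous_on {0..1} \<alpha>" "continuous_on {0..1} \<beta>" "\<And>t. t \<in> {0..1} \<Longrightarrow> \<gamma> t \<noteq> 0"
    and sq: "\<And>t. t \<in> {0..1} \<Longrightarrow> (\<alpha> t)\<^sup>2 = \<gamma> t" "\<And>t. t \<in> {0..1} \<Longrightarrow> (\<beta> t)\<^sup>2 = \<gamma> t"
    and "\<alpha> 0 = \<beta> 0" "t \<in> {0..1}"
  shows "\<alpha> t = \<beta> t"
proof (rule ccontr)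
  assume ne: "\<alpha> t \<noteq> \<beta> t"
  define A B where "A = {y \<in> {0..1}. \<alpha> y - \<beta> y = 0}" and "B = {y \<in> {0..1}. \<alpha> y + \<beta> y = 0}"
  have "closedin (top_of_set {0..1}) A" "closedin (top_of_set {0..1}) B"
    unfolding A_def B_def by (intro continuous_closedin_preimage_constant continuous_intros assms)+
  moreover have sub: "{0..1} \<subseteq> A \<union> B"
  proof
    fix y :: real assume y: "y \<in> {0..1}"
    then have "(\<alpha> y)\<^sup>2 = (\<beta> y)\<^sup>2" using sq by simp
    then show "y \<in> A \<union> B" using y by (auto simp: A_def B_def power2_eq_iff)
  qed
  moreover have "A \<inter> B = {}"
  proof (rule ccontr)
    assume "A \<inter> B \<noteq> {}"
    then obtain y where "y \<in> A" "y \<in> B" by blast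
    then have y: "y \<in> {0..1}" "\<alpha> y - \<beta> y = 0" "\<alpha> y + \<beta> y = 0" by (simp_all add: A_def B_def)
    then have "\<alpha> y = 0" by simp
    then show False using sq(1)[OF y(1)] assms(3)[OF y(1)] by simp
  qed
  moreover have "0 \<in> A" using assms by (auto simp: A_def)
  moreover have "t \<in> B" using sub assms(7) ne by (auto simp: A_def)
  moreover have "connected {0..1::real}" by simp
  ultimately show False unfolding connected_closedin by blast
qed

lemma roots_along_total:
  assumes "opath a \<gamma>" "p\<^sup>2 = \<gamma> 0 - 1" "q\<^sup>2 = \<gamma> 0 + 1"
  shows "\<exists>p' q'. roots_along \<gamma> p q p' q'"
proof -
  note c = opathD(2)[OF assms(1)]
  have ne: "\<gamma> t - 1 \<noteq> 0" "\<gamma> t + 1 \<noteq> 0" if "t \<in> {0..1}" for t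
    using opathD(1)[OF assms(1) that] pm1_postcrit[of a] by (auto simp: add_eq_0_iff2)
  obtain \<alpha> where "continuous_on {0..1} \<alpha>" "\<And>t. t \<in> {0..1} \<Longrightarrow> (\<alpha> t)\<^sup>2 = \<gamma> t - 1" "\<alpha> 0 = p"
    by (rule path_sqrt_ex[of "\<lambda>t. \<gamma> t - 1" p]) (use c ne assms in \<open>auto intro: continuous_intros\<close>)
  moreover obtain \<beta> where "continuous_on {0..1} \<beta>" "\<And>t. t \<in> {0..1} \<Longrightarrow> (\<beta> t)\<^sup>2 = \<gamma> t + 1" "\<beta> 0 = q"
    by (rule path_sqrt_ex[of "\<lambda>t. \<gamma> t + 1" q]) (use c ne assms in \<open>auto intro: continuous_intros\<close>)
  ultimately show ?thesis unfolding roots_along_def by blast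
qed

lemma roots_along_unique:
  assumes "opath a \<gamma>" "roots_along \<gamma> p q p1 q1" "roots_along \<gamma> p q p2 q2"
  shows "p1 = p2" "q1 = q2"
proof -
  have ne: "\<gamma> t - 1 \<noteq> 0" "\<gamma> t + 1 \<noteq> 0" if "t \<in> {0..1}" for t
    using opathD(1)[OF assms(1) that] pm1_postcrit[of a] by (auto simp: add_eq_0_iff2)
  obtain \<alpha> \<beta> where 1: "continuous_on {0..1} \<alpha>" "continuous_on {0..1} \<beta>"
     "\<And>t. t\<in>{0..1} \<Longrightarrow> (\<alpha> t)\<^sup>2 = \<gamma> t - 1" "\<And>t. t\<in>{0..1} \<Longrightarrow> (\<beta> t)\<^sup>2 = \<gamma> t + 1" "\<alpha> 0 = p" "\<beta> 0 = q" "\<alpha> 1 = p1" "\<beta> 1 = q1"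
    using assms(2) unfolding roots_along_def by blast
  obtain \<alpha>' \<beta>' where 2: "continuous_on {0..1} \<alpha>'" "continuous_on {0..1} \<beta>'"
     "\<And>t. t\<in>{0..1} \<Longrightarrow> (\<alpha>' t)\<^sup>2 = \<gamma> t - 1" "\<And>t. t\<in>{0..1} \<Longrightarrow> (\<beta>' t)\<^sup>2 = \<gamma> t + 1" "\<alpha>' 0 = p" "\<beta>' 0 = q" "\<alpha>' 1 = p2" "\<beta>' 1 = q2"
    using assms(3) unfolding roots_along_def by blast
  have "\<alpha> 1 = \<alpha>' 1"
    by (rule path_sqrt_unique[OF 1(1) 2(1) ne(1) 1(3) 2(3)]) (use 1 2 in auto)
  moreover have "\<beta> 1 = \<beta>' 1"
    by (rule path_sqrt_unique[OF 1(2) 2(2) ne(2) 1(4) 2(4)]) (use 1 2 in auto)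
  ultimately show "p1 = p2" "q1 = q2" using 1 2 by auto
qed

lemma roots_along_join:
  assumes "roots_along \<gamma> p q p' q'" "roots_along \<gamma>' p' q' p'' q''"
  shows "roots_along (\<gamma> +++ \<gamma>') p q p'' q''"
proof -
  obtain \<alpha> \<beta> where 1: "continuous_on {0..1} \<alpha>" "continuous_on {0..1} \<beta>"
     "\<And>t. t\<in>{0..1} \<Longrightarrow> (\<alpha> t)\<^sup>2 = \<gamma> t - 1" "\<And>t. t\<in>{0..1} \<Longrightarrow> (\<beta> t)\<^sup>2 = \<gamma> t + 1" "\<alpha> 0 = p" "\<beta> 0 = q" "\<alpha> 1 = p'" "\<beta> 1 = q'"
    using assms(1) unfolding roots_along_def by blast
  obtain \<alpha>' \<beta>' where 2: "continuous_on {0..1} \<alpha>'" "continuous_on {0..1} \<beta>'"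
     "\<And>t. t\<in>{0..1} \<Longrightarrow> (\<alpha>' t)\<^sup>2 = \<gamma>' t - 1" "\<And>t. t\<in>{0..1} \<Longrightarrow> (\<beta>' t)\<^sup>2 = \<gamma>' t + 1" "\<alpha>' 0 = p'" "\<beta>' 0 = q'" "\<alpha>' 1 = p''" "\<beta>' 1 = q''"
    using assms(2) unfolding roots_along_def by blast
  have "path (\<alpha> +++ \<alpha>')" "path (\<beta> +++ \<beta>')"
    using 1 2 by (intro path_join_imp; simp add: path_def pathfinish_def pathstart_def)+
  moreover have "((\<alpha> +++ \<alpha>') t)\<^sup>2 = (\<gamma> +++ \<gamma>') t - 1 \<and> ((\<beta> +++ \<beta>') t)\<^sup>2 = (\<gamma> +++ \<gamma>') t + 1"
    if "t \<in> {0..1}" for t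
    using 1(3,4)[of "2 * t"] 2(3,4)[of "2 * t - 1"] that by (auto simp: joinpaths_def)
  moreover have "(\<alpha> +++ \<alpha>') 0 = p" "(\<beta> +++ \<beta>') 0 = q" "(\<alpha> +++ \<alpha>') 1 = p''" "(\<beta> +++ \<beta>') 1 = q''"
    using 1 2 by (auto simp: joinpaths_def)
  ultimately show ?thesis unfolding roots_along_def path_def by blast
qed

lemma roots_along_reverse:
  assumes "roots_along \<gamma> p q p' q'"
  shows "roots_along (reversepath \<gamma>) p' q' p q"
proof -
  obtain \<alpha> \<beta> where 1: "continuous_on {0..1} \<alpha>" "continuous_on {0..1} \<beta>"
     "\<And>t. t\<in>{0..1} \<Longrightarrow> (\<alpha> t)\<^sup>2 = \<gamma> t - 1" "\<And>t. t\<in>{0..1} \<Longrightarrow> (\<beta> t)\<^sup>2 = \<gamma> t + 1" "\<alpha> 0 = p" "\<beta> 0 = q" "\<alpha> 1 = p'" "\<beta> 1 = q'"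
    using assms(1) unfolding roots_along_def by blast
  have "path (reversepath \<alpha>)" "path (reversepath \<beta>)" using 1(1,2) by (simp_all add: path_def[symmetric])
  then show ?thesis
    using 1 unfolding roots_along_def path_def
    by (intro exI[of _ "reversepath \<alpha>"] exI[of _ "reversepath \<beta>"]) (auto simp: reversepath_def)
qed

lemma roots_along_sign:
  assumes "roots_along \<gamma> p q p' q'"
  shows "roots_along \<gamma> (sg b * p) (sg c * q) (sg b * p') (sg c * q')"
proof -
  obtain \<alpha> \<beta> where 1: "continuous_on {0..1} \<alpha>" "continuous_on {0..1} \<beta>"
     "\<And>t. t\<in>{0..1} \<Longrightarrow> (\<alpha> t)\<^sup>2 = \<gamma> t - 1" "\<And>t. t\<in>{0..1} \<Longrightarrow> (\<beta> t)\<^sup>2 = \<gamma> t + 1" "\<alpha> 0 = p" "\<beta> 0 = q" "\<alpha> 1 = p'" "\<beta> 1 = q'"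
    using assms(1) unfolding roots_along_def by blast
  then show ?thesis unfolding roots_along_def
    by (intro exI[of _ "\<lambda>t. sg b * \<alpha> t"] exI[of _ "\<lambda>t. sg c * \<beta> t"])
       (auto intro!: continuous_intros simp: power_mult_distrib)
qed

text \<open>\<open>- z - 1 = \<i>\<^sup>2 * (z + 1)\<close>, so reflection exchanges the two roots
  up to the factor \<i>. The signs \<open>b\<close> and \<open>c\<close> stay free because the roots
  at the reflected point are chosen independently.\<close>

lemma roots_along_neg:
  assumes "roots_along \<gamma> p q p' q'"
  shows "roots_along (\<lambda>t. - \<gamma> t) (\<i> * sg b * q) (\<i> * sg c * p) (\<i> * sg b * q') (\<i> * sg c * p')"
proof -
  obtain \<alpha> \<beta> where 1: "continuous_on {0..1} \<alpha>" "continuous_on {0..1} \<beta>"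
     "\<And>t. t\<in>{0..1} \<Longrightarrow> (\<alpha> t)\<^sup>2 = \<gamma> t - 1" "\<And>t. t\<in>{0..1} \<Longrightarrow> (\<beta> t)\<^sup>2 = \<gamma> t + 1" "\<alpha> 0 = p" "\<beta> 0 = q" "\<alpha> 1 = p'" "\<beta> 1 = q'"
    using assms(1) unfolding roots_along_def by blast
  then show ?thesis unfolding roots_along_def
    by (intro exI[of _ "\<lambda>t. \<i> * sg b * \<beta> t"] exI[of _ "\<lambda>t. \<i> * sg c * \<alpha> t"])
       (auto intro!: continuous_intros simp: power_mult_distrib)
qed

text \<open>Since \<open>f z - 1\<close> and \<open>f z + 1\<close> are \<open>(2 u - 1)\<^sup>2 / (4 u)\<close> and \<open>(2 u + 1)\<^sup>2 / (4 u)\<close> with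
  \<open>u = a (z - 1) (z + 1)\<close>, the map acts on points equipped with both square roots.\<close>

definition root_up :: "complex \<Rightarrow> complex \<Rightarrow> complex \<Rightarrow> complex \<Rightarrow> complex" where
  "root_up A e p q = (2 * (A * p * q)\<^sup>2 + e) / (2 * A * p * q)"

lemma root_up_alt: "root_up A e p q = (2 * (A * p * q)\<^sup>2 + e) / (2 * (A * p * q))"
  by (simp add: root_up_def mult.assoc)

text \<open>\<open>A * p * q\<close> is a root of \<open>u\<close>, and \<open>root_up\<close> is
  \<open>2 * u + e\<close> divided by twice this root.\<close>

lemma root_up_sq:
  assumes "A\<^sup>2 = a" "a \<noteq> 0" "quartic a (Fin z) = Fin w" "p\<^sup>2 = z - 1" "q\<^sup>2 = z + 1" "e\<^sup>2 = 1"
  shows "(root_up A e p q)\<^sup>2 = w + e"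
proof -
  define u where "u = a * (z\<^sup>2 - 1)"
  have wq: "w = u + 1 / (4 * u)" and "z\<^sup>2 \<noteq> 1"
    using assms(3) by (auto simp: quartic_Fin_eq_iff qf_def u_def mult.assoc)
  then have u0: "u \<noteq> 0" using assms(2) by (simp add: u_def)
  have pq: "(A * p * q)\<^sup>2 = u"
    unfolding power_mult_distrib assms(1,4,5) u_def by (simp add: algebra_simps power2_eq_square)
  have "(root_up A e p q)\<^sup>2 = (2 * (A * p * q)\<^sup>2 + e)\<^sup>2 / (4 * (A * p * q)\<^sup>2)"
    unfolding root_up_alt power_divide by (simp add: power_mult_distrib[of 2 "A * p * q"])
  also have "\<dots> = (4 * u\<^sup>2 + 4 * u * e + e\<^sup>2) / (4 * u)"
    unfolding pq by (simp add: power2_eq_square algebra_simps)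
  also have "\<dots> = w + e" using u0 unfolding wq assms(6) by (simp add: field_simps power2_eq_square)
  finally show ?thesis .
qed

text \<open>\<open>root_up\<close> sees \<open>p\<close> and \<open>q\<close> only through the root
  \<open>A * p * q\<close> of \<open>u\<close>, and it is odd in this root. Hence just the product
  of the two signs survives an application of the map.\<close>

lemma root_up_flip: "(2 * (sg s * X)\<^sup>2 + e) / (2 * (sg s * X)) = sg s * ((2 * X\<^sup>2 + e) / (2 * X))"
  unfolding sg_def
  by (cases s) (simp_all only: if_True if_False mult_1 mult_minus1 power2_minus mult_minus_right divide_minus_right)

lemma root_up_sign: "root_up A e (sg b * p) (sg c * q) = sg (b \<noteq> c) * root_up A e p q"
proof -
  have "A * (sg b * p) * (sg c * q) = sg b * sg c * (A * p * q)" by (simp only: mult_ac)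
  then have "A * (sg b * p) * (sg c * q) = sg (b \<noteq> c) * (A * p * q)" by (simp only: sg_mult)
  then show ?thesis unfolding root_up_alt by (simp only: root_up_flip)
qed

lemma root_up_neg: "root_up A e (\<i> * sg b * q) (\<i> * sg c * p) = sg (b = c) * root_up A e p q"
proof -
  have "A * (\<i> * sg b * q) * (\<i> * sg c * p) = sg (b = c) * (A * p * q)"
  proof -
    have "A * (\<i> * sg b * q) * (\<i> * sg c * p) = \<i> * \<i> * (sg b * sg c) * (A * p * q)" by (simp only: mult_ac)
    also have "\<i> * \<i> * (sg b * sg c) = sg (b = c)" by (cases b; cases c) (simp_all add: sg_def)
    finally show ?thesis .
  qed
  then show ?thesis unfolding root_up_alt by (simp only: root_up_flip)
qed

text \<open>Roots continued along a lift yield roots continued along the path below; for loops this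
  is the source of the relations \<open>m_eq\<close> and \<open>n_eq\<close>.\<close>

lemma roots_along_push:
  assumes A: "A\<^sup>2 = a" "a \<noteq> 0" and L: "lifts a 1 {0..1} \<gamma> \<delta>" and D: "roots_along \<delta> p q p' q'"
  shows "roots_along \<gamma> (root_up A (- 1) p q) (root_up A 1 p q) (root_up A (- 1) p' q') (root_up A 1 p' q')"
proof -
  obtain \<alpha> \<beta> where 1: "continuous_on {0..1} \<alpha>" "continuous_on {0..1} \<beta>"
     "\<And>t. t\<in>{0..1} \<Longrightarrow> (\<alpha> t)\<^sup>2 = \<delta> t - 1" "\<And>t. t\<in>{0..1} \<Longrightarrow> (\<beta> t)\<^sup>2 = \<delta> t + 1" "\<alpha> 0 = p" "\<beta> 0 = q" "\<alpha> 1 = p'" "\<beta> 1 = q'"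
    using D unfolding roots_along_def by blast
  have q: "quartic a (Fin (\<delta> t)) = Fin (\<gamma> t)" if "t \<in> {0..1}" for t using liftsD[OF L that] by simp
  have "2 * A * \<alpha> t * \<beta> t \<noteq> 0" if t: "t \<in> {0..1}" for t
  proof -
    have "(\<delta> t)\<^sup>2 \<noteq> 1" using q[OF t] by (simp add: quartic_Fin_eq_iff)
    then have "\<delta> t \<noteq> 1" "\<delta> t \<noteq> - 1" by auto
    then have "\<delta> t - 1 \<noteq> 0" "\<delta> t + 1 \<noteq> 0" by (auto simp: add_eq_0_iff2)
    then have "\<alpha> t \<noteq> 0" "\<beta> t \<noteq> 0" using 1(3,4)[OF t] by auto
    then show ?thesis using A by auto
  qed
  then have "continuous_on {0..1} (\<lambda>t. root_up A e (\<alpha> t) (\<beta> t))" for e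
    unfolding root_up_def by (intro continuous_intros 1) auto
  moreover have "(root_up A (- 1) (\<alpha> t) (\<beta> t))\<^sup>2 = \<gamma> t - 1" "(root_up A 1 (\<alpha> t) (\<beta> t))\<^sup>2 = \<gamma> t + 1"
    if t: "t \<in> {0..1}" for t
    using root_up_sq[OF A q[OF t] 1(3,4)[OF t], of "- 1"] root_up_sq[OF A q[OF t] 1(3,4)[OF t], of 1] by simp_all
  ultimately show ?thesis unfolding roots_along_def using 1
    by (intro exI[of _ "\<lambda>t. root_up A (- 1) (\<alpha> t) (\<beta> t)"] exI[of _ "\<lambda>t. root_up A 1 (\<alpha> t) (\<beta> t)"]) auto
qed

subsection \<open>A loop that changes both signs\<close>

lemma roots_along_circle:
  assumes R: "R > 1"
  shows "\<exists>p q. roots_along (\<lambda>t. of_real R * exp (2 * of_real pi * \<i> * of_real t)) p q (- p) (- q)"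
proof -
  let ?c = "\<lambda>t. of_real R * exp (2 * of_real pi * \<i> * of_real t)"
  \<comment> \<open>The factor \<open>exp (\<i> * pi * t)\<close> carries the whole rotation. The
    number under \<open>csqrt\<close> stays within \<open>1 / R < 1\<close> of 1, hence off the
    branch cut.\<close>
  define s where "s e t = of_real (sqrt R) * exp (of_real pi * \<i> * of_real t) *
     csqrt (1 + e / of_real R * exp (- (2 * of_real pi * \<i> * of_real t)))" for e :: complex and t :: real
  have cont: "continuous_on {0..1} (s e)" if "cmod e = 1" for e
  proof -
    have "1 + e / of_real R * exp (- (2 * of_real pi * \<i> * of_real t)) \<notin> \<real>\<^sub>\<le>\<^sub>0" for t :: real
    proof
      let ?w = "e / of_real R * exp (- (2 * of_real pi * \<i> * of_real t))"
      assume "1 + ?w \<in> \<real>\<^sub>\<le>\<^sub>0"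
      then have "Re (1 + ?w) \<le> 0" by (auto simp: complex_nonpos_Reals_iff)
      then have "Re ?w \<le> - 1" by simp
      then have "cmod ?w \<ge> 1" using abs_Re_le_cmod[of ?w] by linarith
      moreover have "cmod ?w = 1 / R" using that R by (simp add: norm_mult norm_divide)
      ultimately show False using R by simp
    qed
    then have "continuous_on {0..1} (\<lambda>t::real. csqrt (1 + e / of_real R * exp (- (2 * of_real pi * \<i> * of_real t))))"
      by (intro continuous_on_compose2[OF continuous_on_csqrt] continuous_intros) (use R in auto)
    then show ?thesis unfolding s_def by (intro continuous_intros)
  qed
  have sq: "(s e t)\<^sup>2 = ?c t + e" for e t
  proof -
    have "(s e t)\<^sup>2 = of_real ((sqrt R)\<^sup>2) * (exp (of_real pi * \<i> * of_real t))\<^sup>2 *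
        (1 + e / of_real R * exp (- (2 * of_real pi * \<i> * of_real t)))"
      unfolding s_def by (simp add: power_mult_distrib)
    also have "(exp (of_real pi * \<i> * of_real t))\<^sup>2 = exp (2 * of_real pi * \<i> * of_real t)"
      by (simp add: mult_ac flip: exp_double)
    also have "of_real ((sqrt R)\<^sup>2) = (of_real R :: complex)" using R by simp
    finally show ?thesis using R
      by (simp add: distrib_left mult_ac exp_minus)
  qed
  have ends: "s e 1 = - s e 0" for e
  proof -
    have "exp (of_real pi * \<i>) = - 1" by (simp add: mult.commute)
    moreover have "exp (- (2 * of_real pi * \<i>)) = 1" by (simp add: exp_minus mult_ac)
    ultimately show ?thesis unfolding s_def by simp
  qed
  show ?thesis
    unfolding roots_along_def using cont[of "- 1"] cont[of 1] sq[of "- 1"] sq[of 1] ends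
    by (intro exI[of _ "s (- 1) 0"] exI[of _ "s 1 0"] exI[of _ "s (- 1)"] exI[of _ "s 1"]) auto
qed

context disc
begin

lemma countable_postcrit: "countable (postcrit a)"
proof -
  have "postcrit a \<subseteq> {1, - 1} \<union> unFin ` range (\<lambda>k. iter a k 0)"
    unfolding postcrit_def by (auto simp: image_iff) (metis unFin_Fin)
  then show ?thesis by (rule countable_subset) auto
qed

text \<open>A circle around both 1 and -1 flips both roots. Joining it to \<open>x\<close> by a path
  and back conjugates the loop and leaves the signs unchanged.\<close>

lemma flipping_loop:
  assumes x: "x \<notin> postcrit a" and pq: "p\<^sup>2 = x - 1" "q\<^sup>2 = x + 1"
  obtains g where "opath a g" "pathstart g = x" "pathfinish g = x" "roots_along g p q (- p) (- q)"
proof -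
  \<comment> \<open>Countably many postcritical moduli cannot fill an interval, so some radius above
    1 is free.\<close>
  have "uncountable {1<..<2::real}" by (simp add: uncountable_open_interval)
  moreover have "countable (cmod ` postcrit a)" using countable_postcrit by simp
  ultimately have "\<not> {1<..<2::real} \<subseteq> cmod ` postcrit a" using countable_subset by blast
  then obtain R where R: "R \<in> {1<..<2}" "R \<notin> cmod ` postcrit a" by blast
  define c where "c = (\<lambda>t::real. of_real R * exp (2 * of_real pi * \<i> * of_real t) :: complex)"
  have "cmod (c t) = R" for t using R(1) by (simp add: c_def norm_mult)
  then have cPC: "c t \<notin> postcrit a" for t using R(2) by (metis image_eqI)
  have c01: "c 0 = of_real R" "c 1 = of_real R" by (simp_all add: c_def mult_ac)
  have opc: "opath a c" unfolding opath_def path_def path_image_def using cPC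
    by (auto simp: c_def intro!: continuous_intros)
  obtain p1 q1 where 1: "roots_along c p1 q1 (- p1) (- q1)" using roots_along_circle[of R] R(1) by (auto simp: c_def)
  have "path_connected (- postcrit a)"
    by (rule path_connected_complement_countable[OF _ countable_postcrit]) simp
  then obtain b where b: "path b" "path_image b \<subseteq> - postcrit a" "pathstart b = x" "pathfinish b = of_real R"
    unfolding path_connected_def using x cPC[of 0] c01(1) by (metis ComplI)
  have opb: "opath a b" using b by (auto simp: opath_def)
  obtain p2 q2 where 2: "roots_along b p q p2 q2" using roots_along_total[OF opb, of p q] pq b(3) by (auto simp: pathstart_def)
  have "p2\<^sup>2 = p1\<^sup>2" "q2\<^sup>2 = q1\<^sup>2"
    using roots_along_ends[OF 2] roots_along_ends[OF 1] b(4) c01 by (auto simp: pathfinish_def)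
  then obtain s t where st: "p2 = sg s * p1" "q2 = sg t * q1" using sq_eq_sg by metis
  have 3: "roots_along c p2 q2 (- p2) (- q2)" using roots_along_sign[OF 1, of s t] by (simp add: st)
  have 4: "roots_along (reversepath b) (- p2) (- q2) (- p) (- q)"
    using roots_along_sign[OF roots_along_reverse[OF 2], of True True] by (simp add: sg_def)
  have ends: "pathstart c = of_real R" "pathfinish c = of_real R" using c01 by (simp_all add: pathstart_def pathfinish_def)
  show thesis
  proof (rule that[of "b +++ (c +++ reversepath b)"])
    show "opath a (b +++ c +++ reversepath b)"
      using opb opc b ends by (intro opath_join opath_reverse) auto
    show "roots_along (b +++ c +++ reversepath b) p q (- p) (- q)" using roots_along_join[OF 2 roots_along_join[OF 3 4]] .
  qed (use b in auto)
qed

end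

subsection \<open>Sign combinatorics\<close>

text \<open>Signs are booleans, with \<open>True\<close> for \<open>- 1\<close>, so that \<open>\<noteq>\<close> is multiplication. \<open>b i\<close> tells
  which of the two values \<open>u\<close> belongs to the preimage \<open>i\<close>, and \<open>bar\<close> is the reflection.\<close>

locale sign_data =
  fixes I :: "'i set" and bar :: "'i \<Rightarrow> 'i" and \<epsilon> \<epsilon>' C D :: "'i \<Rightarrow> bool"
  assumes bar: "\<And>i. i \<in> I \<Longrightarrow> bar i \<in> I" and ne: "I \<noteq> {}"
    and block: "\<And>i j. i \<in> I \<Longrightarrow> j \<in> I \<Longrightarrow> (\<epsilon> i \<noteq> \<epsilon>' i) = (\<epsilon> j \<noteq> \<epsilon>' j) \<Longrightarrow> j = i \<or> j = bar i"
    and Cbar: "\<And>i. i \<in> I \<Longrightarrow> C (bar i) = (\<not> D i)"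
    and Dbar: "\<And>i. i \<in> I \<Longrightarrow> D (bar i) = (\<not> C i)"
    and ebar: "\<And>i. i \<in> I \<Longrightarrow> \<epsilon> (bar i) = (\<epsilon> i \<noteq> (C i = D i))"
begin

definition b :: "'i \<Rightarrow> bool" where "b i = (\<epsilon> i \<noteq> \<epsilon>' i)"

text \<open>The choice is dictated by three demands: the trivial pair is never good, some loop is
  good, and a good loop has a good new loop at some index. The three branches distinguish whether
  the product of the signs \<open>C i\<close> and \<open>D i\<close> varies, is always 1, or is
  always -1.\<close>

definition good :: "bool \<Rightarrow> bool \<Rightarrow> bool" where
  "good m n \<longleftrightarrow>
    (if \<exists>i\<in>I. \<exists>j\<in>I. (C i = D i) \<noteq> (C j = D j) then m \<noteq> n
     else if \<forall>i\<in>I. C i = D i then (if \<forall>i\<in>I. \<forall>j\<in>I. (C i = \<epsilon> i) = (C j = \<epsilon> j) then m else n)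
     else (if \<forall>i\<in>I. \<forall>j\<in>I. \<epsilon> i = \<epsilon> j then m else n) \<or> ((\<exists>i\<in>I. \<exists>j\<in>I. C i \<noteq> C j) \<and> m \<noteq> n))"

text \<open>By \<open>block\<close> there are at most two reflection pairs, told apart by
  \<open>b\<close>. A function invariant under reflection is thus constant or equal to
  \<open>b\<close> up to a global sign.\<close>

lemma block_fun:
  assumes "\<And>i. i \<in> I \<Longrightarrow> f (bar i) = f i"
  shows "(\<forall>i\<in>I. \<forall>j\<in>I. f i = f j) \<or> (\<forall>i\<in>I. \<forall>j\<in>I. (f i \<noteq> f j) = (b i \<noteq> b j))"
proof -
  have same: "f i = f j" if "i \<in> I" "j \<in> I" "b i = b j" for i j
    using block[OF that(1,2)] that assms by (auto simp: b_def)
  show ?thesis using same by metis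
qed

end

text \<open>A loop with signs \<open>m\<close> and \<open>n\<close> for the roots of
  \<open>z - 1\<close> and \<open>z + 1\<close>. Its lift leads from preimage \<open>i\<close> to
  \<open>\<pi> i\<close>, and \<open>Mp i\<close>, \<open>Mm i\<close> are the corresponding signs
  of the new loop at \<open>i\<close>. The relations for \<open>m\<close> and \<open>n\<close> come
  from \<open>root_up\<close>, those for \<open>bar i\<close> from reflecting the lift.\<close>

locale sign_action = sign_data I bar \<epsilon> \<epsilon>' C D
  for I :: "'i set" and bar :: "'i \<Rightarrow> 'i" and \<epsilon> \<epsilon>' C D :: "'i \<Rightarrow> bool" +
  fixes m n :: bool and \<pi> :: "'i \<Rightarrow> 'i" and Mp Mm :: "'i \<Rightarrow> bool"
  assumes \<pi>: "\<And>i. i \<in> I \<Longrightarrow> \<pi> i \<in> I"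
    and m_eq: "\<And>i. i \<in> I \<Longrightarrow> m = (\<epsilon> i \<noteq> (\<epsilon> (\<pi> i) \<noteq> (Mp i \<noteq> Mm i)))"
    and n_eq: "\<And>i. i \<in> I \<Longrightarrow> n = (\<epsilon>' i \<noteq> (\<epsilon>' (\<pi> i) \<noteq> (Mp i \<noteq> Mm i)))"
    and Mp_bar: "\<And>i. i \<in> I \<Longrightarrow> Mp (bar i) = (C i \<noteq> (C (\<pi> i) \<noteq> Mm i))"
    and Mm_bar: "\<And>i. i \<in> I \<Longrightarrow> Mm (bar i) = (D i \<noteq> (D (\<pi> i) \<noteq> Mp i))"
begin

text \<open>The product of the two signs is the sign acquired by a root of
  \<open>x\<^sup>2 - 1\<close>, the discriminant of the quadratic for \<open>u\<close>.\<close>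

lemma swap: "i \<in> I \<Longrightarrow> (b i \<noteq> b (\<pi> i)) = (m \<noteq> n)"
  using m_eq[of i] n_eq[of i] unfolding b_def by blast

text \<open>Any one index suffices: the relations at \<open>i\<close> and at \<open>bar i\<close>
  together force one of these two new loops to be good. Where the definition of goodness compares
  different indices, \<open>block_fun\<close> expresses the comparison through \<open>b\<close>, and
  \<open>swap\<close> ties \<open>b\<close> to \<open>m\<close> and \<open>n\<close>.\<close>

lemma good_step: "good m n \<Longrightarrow> \<exists>i\<in>I. good (Mp i) (Mm i)"
proof -
  assume g: "good m n"
  obtain i where i: "i \<in> I" using ne by blast
  define j where "j = \<pi> i"
  have j: "j \<in> I" and bi: "bar i \<in> I" using \<pi>[OF i] bar[OF i] by (auto simp: j_def)
  note eqs = m_eq[OF i] n_eq[OF i] Mp_bar[OF i] Mm_bar[OF i] swap[OF i]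
  note eqs = eqs[folded j_def]
  have CD: "(C (bar i) = D (bar i)) = (C i = D i)" if "i \<in> I" for i using Cbar[OF that] Dbar[OF that] by blast
  consider (mixed) "\<exists>i\<in>I. \<exists>j\<in>I. (C i = D i) \<noteq> (C j = D j)" | (plus) "\<forall>i\<in>I. C i = D i" | (minus) "\<forall>i\<in>I. C i \<noteq> D i"
    by blast
  then show ?thesis
  proof cases
    case mixed
    then have gd: "good m' n' \<longleftrightarrow> m' \<noteq> n'" for m' n' unfolding good_def by (subst if_P) auto
    have "(C i = D i) \<noteq> (C j = D j)"
      using block_fun[of "\<lambda>i. C i = D i"] CD mixed i j g eqs(5) unfolding gd by blast
    \<comment> \<open>Here and in the other cases, what is left is propositional in the signs at
      \<open>i\<close>, \<open>bar i\<close> and \<open>j = \<pi> i\<close>.\<close>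
    then have "(Mp i \<noteq> Mm i) \<or> (Mp (bar i) \<noteq> Mm (bar i))" using eqs by sat
    then show ?thesis using i bi gd by blast
  next
    case plus
    have nm: "\<not> (\<exists>i\<in>I. \<exists>j\<in>I. (C i = D i) \<noteq> (C j = D j))" using plus by blast
    have k: "(C (bar i) = \<epsilon> (bar i)) = (C i = \<epsilon> i)" if "i \<in> I" for i
      using Cbar[OF that] ebar[OF that] plus that by blast
    show ?thesis
    proof (cases "\<forall>i\<in>I. \<forall>j\<in>I. (C i = \<epsilon> i) = (C j = \<epsilon> j)")
      case True
      then have gd: "good m' n' \<longleftrightarrow> m'" for m' n' unfolding good_def if_not_P[OF nm] if_P[OF plus] if_P[OF True] by (simp only:)
      have "(C i = \<epsilon> i) = (C j = \<epsilon> j)" using True i j by blast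
      then have "Mp i \<or> Mp (bar i)" using eqs g[unfolded gd] by sat
      then show ?thesis using i bi gd by blast
    next
      case False
      then have gd: "good m' n' \<longleftrightarrow> n'" for m' n' unfolding good_def if_not_P[OF nm] if_P[OF plus] if_not_P[OF False] by (simp only:)
      have "((C i = \<epsilon> i) \<noteq> (C j = \<epsilon> j)) = (b i \<noteq> b j)" using block_fun[of "\<lambda>i. C i = \<epsilon> i"] k False i j by blast
      moreover have "C i = D i" "C j = D j" using plus i j by auto
      ultimately have "Mm i \<or> Mm (bar i)" using eqs g[unfolded gd] by sat
      then show ?thesis using i bi gd by blast
    qed
  next
    case minus
    have nm: "\<not> (\<exists>i\<in>I. \<exists>j\<in>I. (C i = D i) \<noteq> (C j = D j))" "\<not> (\<forall>i\<in>I. C i = D i)" using minus i by blast+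
    have e: "\<epsilon> (bar i) = \<epsilon> i" and c: "C (bar i) = C i" if "i \<in> I" for i
      using Cbar[OF that] ebar[OF that] minus that by blast+
    have Dij: "C i \<noteq> D i" "C j \<noteq> D j" using minus i j by blast+
    have C2: "(\<forall>i\<in>I. \<forall>j\<in>I. C i = C j) \<or> (\<forall>i\<in>I. \<forall>j\<in>I. (C i \<noteq> C j) = (b i \<noteq> b j))"
      using block_fun[of C] c by blast
    show ?thesis
    proof (cases "\<forall>i\<in>I. \<forall>j\<in>I. \<epsilon> i = \<epsilon> j")
      case True
      then have gd: "good m' n' \<longleftrightarrow> m' \<or> ((\<exists>i\<in>I. \<exists>j\<in>I. C i \<noteq> C j) \<and> m' \<noteq> n')" for m' n' 
        unfolding good_def if_not_P[OF nm(1)] if_not_P[OF nm(2)] if_P[OF True] by (simp only:)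
      have ij: "\<epsilon> i = \<epsilon> j" using True i j by blast
      show ?thesis
      proof (cases "\<exists>i\<in>I. \<exists>j\<in>I. C i \<noteq> C j")
        case c: True
        then have gd: "good m' n' \<longleftrightarrow> m' \<or> m' \<noteq> n'" for m' n' using gd by blast
        have "(C i \<noteq> C j) = (b i \<noteq> b j)" using C2 c i j by blast
        then have "Mp i \<or> Mp i \<noteq> Mm i \<or> Mp (bar i) \<or> Mp (bar i) \<noteq> Mm (bar i)" using eqs ij Dij g[unfolded gd] by sat
        then show ?thesis using i bi gd by blast
      next
        case c: False
        then have gd: "good m' n' \<longleftrightarrow> m'" for m' n' using gd by blast
        have "C i = C j" using c i j by blast
        then have "Mp i \<or> Mp (bar i)" using eqs ij Dij g[unfolded gd] by sat
        then show ?thesis using i bi gd by blast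
      qed
    next
      case False
      then have gd: "good m' n' \<longleftrightarrow> n' \<or> ((\<exists>i\<in>I. \<exists>j\<in>I. C i \<noteq> C j) \<and> m' \<noteq> n')" for m' n' 
        unfolding good_def if_not_P[OF nm(1)] if_not_P[OF nm(2)] if_not_P[OF False] by (simp only:)
      have ij: "(\<epsilon> i \<noteq> \<epsilon> j) = (b i \<noteq> b j)" using block_fun[of \<epsilon>] e False i j by blast
      show ?thesis
      proof (cases "\<exists>i\<in>I. \<exists>j\<in>I. C i \<noteq> C j")
        case c: True
        then have gd: "good m' n' \<longleftrightarrow> n' \<or> m' \<noteq> n'" for m' n' using gd by blast
        have "(C i \<noteq> C j) = (b i \<noteq> b j)" using C2 c i j by blast
        then have "Mm i \<or> Mp i \<noteq> Mm i \<or> Mm (bar i) \<or> Mp (bar i) \<noteq> Mm (bar i)" using eqs ij Dij g[unfolded gd] by sat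
        then show ?thesis using i bi gd by blast
      next
        case c: False
        then have gd: "good m' n' \<longleftrightarrow> n'" for m' n' using gd by blast
        have "C i = C j" using c i j by blast
        then have "Mm i \<or> Mm (bar i)" using eqs ij Dij g[unfolded gd] by sat
        then show ?thesis using i bi gd by blast
      qed
    qed
  qed
qed

text \<open>Unless the product of \<open>C\<close> and \<open>D\<close> varies, flipping both roots
  is itself good. If it varies, take an index with \<open>C i \<noteq> D i\<close>: then \<epsilon>
  is constant on its reflection pair, equal signs keep the lift inside this pair, and so the flip
  reappears as unequal signs of the new loop.\<close>

lemma good_start:
  assumes "m" "n"
  shows "good m n \<or> (\<exists>i\<in>I. good (Mp i) (Mm i))"
proof (cases "\<exists>i\<in>I. \<exists>j\<in>I. (C i = D i) \<noteq> (C j = D j)")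
  case True
  then have gd: "good m' n' \<longleftrightarrow> m' \<noteq> n'" for m' n' unfolding good_def by (subst if_P) auto
  obtain i where i: "i \<in> I" "C i \<noteq> D i" using True by blast
  have "b i = b (\<pi> i)" using swap[OF i(1)] assms by blast
  then have "\<pi> i = i \<or> \<pi> i = bar i" using block[OF i(1) \<pi>[OF i(1)]] by (auto simp: b_def)
  then have "\<epsilon> (\<pi> i) = \<epsilon> i" using ebar[OF i(1)] i(2) by auto
  then have "Mp i \<noteq> Mm i" using m_eq[OF i(1)] assms by blast
  then show ?thesis using i(1) gd by blast
next
  case False
  have "good True True" unfolding good_def if_not_P[OF False] by (simp only: if_cancel simp_thms)
  then show ?thesis using assms by simp
qed

text \<open>If every preimage is fixed, then \<open>m = n\<close> by \<open>swap\<close>, and both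
  are -1 because the trivial pair is not good. By \<open>m_eq\<close> every new loop then has
  unequal signs, hence moves all letters at the next level.\<close>

lemma good_moves:
  assumes "good m n"
  shows "(\<exists>i\<in>I. \<pi> i \<noteq> i) \<or> (\<forall>i\<in>I. Mp i \<noteq> Mm i)"
proof (cases "\<forall>i\<in>I. \<pi> i = i")
  case True
  obtain i where "i \<in> I" using ne by blast
  then have "m = n" using swap[of i] True by auto
  moreover have "\<not> good False False" unfolding good_def by (simp only: if_cancel simp_thms)
  ultimately have "m" using assms by (cases m) auto
  then show ?thesis using m_eq True by auto
qed blast

end


subsection \<open>The coding map\<close>

text \<open>Koenig's lemma: each thinning of the index set makes one more coordinate constant, and
  the constants form the limit sequence.\<close>

lemma constant_on_infinitely_many:
  fixes f :: "nat \<Rightarrow> nat \<Rightarrow> 'b"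
  assumes "finite B" "\<And>k n. f k n \<in> B"
  obtains s where "\<And>m. infinite {k. \<forall>n<m. f k n = s n}"
proof -
  have "\<exists>A :: nat \<Rightarrow> nat set. \<forall>n. infinite (A n) \<and> (A (Suc n) \<subseteq> A n \<and> (\<exists>c. \<forall>k\<in>A (Suc n). f k n = c))"
  proof (rule dependent_nat_choice)
    show "\<exists>A :: nat set. infinite A" by (intro exI[of _ UNIV]) simp
    fix A :: "nat set" and n assume A: "infinite A"
    have "finite ((\<lambda>k. f k n) ` A)" using assms finite_subset[of "(\<lambda>k. f k n) ` A" B] by blast
    from pigeonhole_infinite[OF A this] obtain k0 where "infinite {k \<in> A. f k n = f k0 n}" by blast
    then show "\<exists>A'. infinite A' \<and> A' \<subseteq> A \<and> (\<exists>c. \<forall>k\<in>A'. f k n = c)"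
      by (intro exI[of _ "{k \<in> A. f k n = f k0 n}"]) auto
  qed
  then obtain A where A: "\<And>n. infinite (A n)" "\<And>n. A (Suc n) \<subseteq> A n" "\<And>n. \<exists>c. \<forall>k\<in>A (Suc n). f k n = c" by blast
  then obtain s where s: "\<And>n k. k \<in> A (Suc n) \<Longrightarrow> f k n = s n" by metis
  have "A m \<subseteq> A (Suc n)" if "n < m" for n m
    by (rule lift_Suc_antimono_le[of A, OF A(2)]) (use that in simp)
  then have "A m \<subseteq> {k. \<forall>n<m. f k n = s n}" for m using s by blast
  then have "infinite {k. \<forall>n<m. f k n = s n}" for m using infinite_super[OF _ A(1)] by blast
  then show thesis by (rule that)
qed

lemma geometric_limit:
  fixes f :: "nat \<Rightarrow> complex"
  assumes d: "\<And>n. dist (f n) (f (Suc n)) \<le> C * \<theta> ^ n" and \<theta>: "0 < \<theta>" "\<theta> < 1" and C: "C \<ge> 0"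
  obtains L where "f \<longlonglongrightarrow> L" "\<And>n. dist (f n) L \<le> C / (1 - \<theta>) * \<theta> ^ n"
proof -
  have b: "dist (f n) (f (n + m)) \<le> C / (1 - \<theta>) * (\<theta> ^ n - \<theta> ^ (n + m))" for n m
  proof (induction m)
    case (Suc m)
    have "dist (f n) (f (n + Suc m)) \<le> dist (f n) (f (n + m)) + C * \<theta> ^ (n + m)"
      using dist_triangle[of "f n" "f (n + Suc m)" "f (n + m)"] d[of "n + m"] by simp
    \<comment> \<open>\<open>C * \<theta> ^ (n + m)\<close> is written as a difference of
      consecutive terms of the bound, so that the sum telescopes.\<close>
    also have "\<dots> \<le> C / (1 - \<theta>) * (\<theta> ^ n - \<theta> ^ (n + m)) + C / (1 - \<theta>) * ((1 - \<theta>) * \<theta> ^ (n + m))"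
      using Suc \<theta> by simp
    also have "\<dots> = C / (1 - \<theta>) * (\<theta> ^ n - \<theta> ^ (n + Suc m))"
      unfolding distrib_left[symmetric] by (simp add: left_diff_distrib)
    finally show ?case .
  qed simp
  have b': "dist (f n) (f (n + m)) \<le> C / (1 - \<theta>) * \<theta> ^ n" for n m
  proof -
    have "C / (1 - \<theta>) * (\<theta> ^ n - \<theta> ^ (n + m)) \<le> C / (1 - \<theta>) * \<theta> ^ n"
      using \<theta> C by (intro mult_left_mono) auto
    then show ?thesis using b[of n m] by linarith
  qed
  have lim0: "(\<lambda>n. C / (1 - \<theta>) * \<theta> ^ n) \<longlonglongrightarrow> 0"
    using \<theta> by (intro tendsto_mult_right_zero LIMSEQ_realpow_zero) auto
  have "Cauchy f"
  proof (rule metric_CauchyI)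
    fix e :: real assume "e > 0"
    then have "\<forall>\<^sub>F n in sequentially. C / (1 - \<theta>) * \<theta> ^ n < e / 2"
      using order_tendstoD(2)[OF lim0, of "e / 2"] by simp
    then obtain N where N: "C / (1 - \<theta>) * \<theta> ^ N < e / 2" by (auto simp: eventually_sequentially)
    have "dist (f m) (f n) < e" if "m \<ge> N" "n \<ge> N" for m n
      using b'[of N "m - N"] b'[of N "n - N"] N dist_triangle3[of "f m" "f n" "f N"]
      unfolding le_add_diff_inverse[OF that(1)] le_add_diff_inverse[OF that(2)] by linarith
    then show "\<exists>M. \<forall>m\<ge>M. \<forall>n\<ge>M. dist (f m) (f n) < e" by blast
  qed
  then obtain L where L: "f \<longlonglongrightarrow> L" using Cauchy_convergent convergent_def by blast
  have "dist (f n) L \<le> C / (1 - \<theta>) * \<theta> ^ n" for n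
  proof (rule Lim_bounded)
    show "(\<lambda>m. dist (f n) (f (m + n))) \<longlonglongrightarrow> dist (f n) L"
      by (intro tendsto_intros LIMSEQ_ignore_initial_segment L)
    show "\<forall>m\<ge>0. dist (f n) (f (m + n)) \<le> C / (1 - \<theta>) * \<theta> ^ n"
      using b'[of n] by (simp add: add.commute)
  qed
  then show thesis using L that by blast
qed

section \<open>Words of a radial and the points they lead to\<close>

locale rad = disc +
  fixes l :: "nat \<Rightarrow> real \<Rightarrow> complex" and x :: complex
  assumes l: "\<And>i. i \<in> {1..4} \<Longrightarrow> opath a (l i)" "\<And>i. i \<in> {1..4} \<Longrightarrow> pathstart (l i) = x"
    "\<And>i. i \<in> {1..4} \<Longrightarrow> iter a 1 (pathfinish (l i)) = Fin x"
begin

definition lift_end :: "nat \<Rightarrow> (real \<Rightarrow> complex) \<Rightarrow> complex \<Rightarrow> complex" where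
  "lift_end n \<gamma> z = (THE z'. lift_ends a n \<gamma> z z')"

text \<open>Letters are lifted one after the other, each under one step more than its predecessor.
  This processes a word from its first letter on, so that appending a letter prolongs the path,
  whereas \<open>word_path\<close> lifts the whole tail at once.\<close>

fun word_end :: "nat \<Rightarrow> nat list \<Rightarrow> complex \<Rightarrow> complex" where
  "word_end n [] z = z"
| "word_end n (i # w) z = word_end (Suc n) w (lift_end n (l i) z)"

definition Z :: "(nat \<Rightarrow> nat) \<Rightarrow> nat \<Rightarrow> complex" where
  "Z s k = word_end 0 (map s [0..<k]) x"

lemma x_postcrit: "x \<notin> postcrit a"
  using opathD(1)[OF l(1), of 1 0] l(2)[of 1] by (simp add: pathstart_def)

lemma lift_end_E: "opath a \<gamma> \<Longrightarrow> iter a n z = Fin (pathstart \<gamma>) \<Longrightarrow> lift_ends a n \<gamma> z (lift_end n \<gamma> z)"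
  unfolding lift_end_def using lift_ends_total[OF a0] lift_ends_unique[OF a0] by (metis (no_types, lifting) theI)

lemma lift_end_eq: "opath a \<gamma> \<Longrightarrow> lift_ends a n \<gamma> z z' \<Longrightarrow> lift_end n \<gamma> z = z'"
  using lift_end_E lift_ends_fibre(1) lift_ends_unique[OF a0] by metis

lemma lift_end_l: "i \<in> {1..4} \<Longrightarrow> iter a n z = Fin x \<Longrightarrow> lift_ends a n (l i) z (lift_end n (l i) z)"
  using lift_end_E l by simp

lemma lift_end_fibre:
  assumes "i \<in> {1..4}" "iter a n z = Fin x"
  shows "iter a n (lift_end n (l i) z) = Fin (pathfinish (l i))" "iter a (Suc n) (lift_end n (l i) z) = Fin x"
proof -
  show *: "iter a n (lift_end n (l i) z) = Fin (pathfinish (l i))" using lift_ends_fibre(2)[OF lift_end_l[OF assms]] .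
  show "iter a (Suc n) (lift_end n (l i) z) = Fin x" using iter_add[OF *, of 1] l(3)[OF assms(1)] by simp
qed

lemma lift_end_0: "i \<in> {1..4} \<Longrightarrow> lift_end 0 (l i) x = pathfinish (l i)"
  using lift_ends_fibre(2)[OF lift_end_l, of i 0 x] by simp

lemma word_end_fibre: "set w \<subseteq> {1..4} \<Longrightarrow> iter a n z = Fin x \<Longrightarrow> iter a (n + length w) (word_end n w z) = Fin x"
proof (induction w arbitrary: n z)
  case (Cons i w)
  then have "iter a (Suc n) (lift_end n (l i) z) = Fin x" by (intro lift_end_fibre(2)) auto
  then show ?case using Cons.IH[of "Suc n"] Cons.prems by simp
qed simp

lemma word_end_snoc: "word_end n (w @ [i]) z = lift_end (n + length w) (l i) (word_end n w z)"
  by (induction w arbitrary: n z) auto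

lemma symbol_words: "s \<in> symbol_space 4 \<Longrightarrow> set (map s [0..<k]) \<subseteq> {1..4}"
  by (auto simp: symbol_space_def)

lemma Z_fibre: "s \<in> symbol_space 4 \<Longrightarrow> iter a k (Z s k) = Fin x"
  using word_end_fibre[OF symbol_words, of s 0 x k] by (simp add: Z_def)

lemma Z_Suc: "s \<in> symbol_space 4 \<Longrightarrow> lift_ends a k (l (s k)) (Z s k) (Z s (Suc k))"
  using lift_end_l[OF _ Z_fibre, of "s k" s k] by (simp add: Z_def word_end_snoc symbol_space_def)

definition code :: "(nat \<Rightarrow> nat) \<Rightarrow> complex" where
  "code s = lim (Z s)"

lemma code_limit:
  assumes "\<And>i k z z'. i \<in> {1..4} \<Longrightarrow> lift_ends a k (l i) z z' \<Longrightarrow> dist z z' \<le> C * \<theta> ^ k"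
    and \<theta>: "0 < \<theta>" "\<theta> < 1" "C \<ge> 0" and s: "s \<in> symbol_space 4"
  shows "Z s \<longlonglongrightarrow> code s" "\<And>k. dist (Z s k) (code s) \<le> C / (1 - \<theta>) * \<theta> ^ k"
proof -
  have "dist (Z s k) (Z s (Suc k)) \<le> C * \<theta> ^ k" for k
    using assms(1)[OF _ Z_Suc[OF s]] s by (simp add: symbol_space_def)
  from geometric_limit[OF this \<theta>] obtain L
    where L: "Z s \<longlonglongrightarrow> L" "\<And>n. dist (Z s n) L \<le> C / (1 - \<theta>) * \<theta> ^ n" by blast
  then show "Z s \<longlonglongrightarrow> code s" "\<And>k. dist (Z s k) (code s) \<le> C / (1 - \<theta>) * \<theta> ^ k"
    using limI[OF L(1)] by (simp_all add: code_def)
qed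

lemma Z_tendsto: "s \<in> symbol_space 4 \<Longrightarrow> Z s \<longlonglongrightarrow> code s"
proof -
  assume s: "s \<in> symbol_space 4"
  obtain \<theta> C where "0 < \<theta>" "\<theta> < 1" "C \<ge> 0" "\<And>i k z z'. i \<in> {1..4} \<Longrightarrow> lift_ends a k (l i) z z' \<Longrightarrow> dist z z' \<le> C * \<theta> ^ k"
    using paths_shrink[of "{1..4}" l] l(1) by (metis finite_atLeastAtMost)
  then show ?thesis using code_limit(1) s by blast
qed

text \<open>Lifting the lifted tail under \<open>n\<close> steps is lifting the tail itself under
  \<open>n + 1\<close> steps. Unique lifting turns this into the recursion of
  \<open>word_end\<close>. The claim ranges over all \<open>n\<close> and \<open>z\<close> because
  the induction raises the level.\<close>

lemma word_path_lift:
  assumes L: "\<And>i t. i \<in> {1..4} \<Longrightarrow> t \<in> {0..1} \<Longrightarrow> L i t = Fin (l i t)"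
  shows "w \<noteq> [] \<Longrightarrow> set w \<subseteq> {1..4} \<Longrightarrow> \<exists>\<gamma>. opath a \<gamma> \<and> pathstart \<gamma> = x \<and>
    (\<forall>t\<in>{0..1}. word_path (quartic a) L w t = Fin (\<gamma> t)) \<and>
    (\<forall>n z. iter a n z = Fin x \<longrightarrow> lift_ends a n \<gamma> z (word_end n w z))"
proof (induction w rule: induct_list012)
  case (2 i)
  then show ?case using L l lift_end_l by (intro exI[of _ "l i"]) auto
next
  case (3 i j w)
  have i: "i \<in> {1..4}" using 3 by simp
  obtain \<gamma> where \<gamma>: "opath a \<gamma>" "pathstart \<gamma> = x" "\<And>t. t \<in> {0..1} \<Longrightarrow> word_path (quartic a) L (j # w) t = Fin (\<gamma> t)"
    "\<And>n z. iter a n z = Fin x \<Longrightarrow> lift_ends a n \<gamma> z (word_end n (j # w) z)"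
    using 3 by auto
  define \<Lambda> where "\<Lambda> = lift_path (quartic a) (pathfinish (L i)) (word_path (quartic a) L (j # w))"
  have Li: "pathfinish (L i) = Fin (pathfinish (l i))" using L[OF i] by (simp add: pathfinish_def)
  obtain \<delta> where \<delta>: "lifts a 1 {0..1} \<gamma> \<delta>" "\<delta> 0 = pathfinish (l i)"
    using lift_path_ex[OF a0 \<gamma>(1), of 1 "pathfinish (l i)"] l(3)[OF i] \<gamma>(2) by (auto simp: pathstart_def)
  have "is_lift (quartic a) (pathfinish (L i)) (word_path (quartic a) L (j # w)) (\<lambda>t. Fin (\<delta> t))"
    unfolding is_lift_def path_def Li using \<delta> \<gamma>(3) liftsD[OF \<delta>(1)] lifts_cont[OF \<delta>(1)]
    by (auto simp: pathstart_def intro: continuous_on_Fin)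
  \<comment> \<open>Some lift exists, so the one chosen by \<open>lift_path\<close> is a lift as
    well; on the unit interval it is finite.\<close>
  then have \<Lambda>: "is_lift (quartic a) (pathfinish (L i)) (word_path (quartic a) L (j # w)) \<Lambda>"
    unfolding \<Lambda>_def lift_path_def
    by (rule someI[of "is_lift (quartic a) (pathfinish (L i)) (word_path (quartic a) L (j # w))"])
  define \<delta>' where "\<delta>' t = unFin (\<Lambda> t)" for t
  have fin: "\<Lambda> t = Fin (\<delta>' t)" if "t \<in> {0..1}" for t
  proof -
    have "quartic a (\<Lambda> t) = Fin (\<gamma> t)" using \<Lambda> \<gamma>(3) that unfolding is_lift_def by simp
    then show ?thesis by (cases "\<Lambda> t") (auto simp: \<delta>'_def)
  qed
  have "continuous_on {0..1} \<delta>'" unfolding \<delta>'_def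
    by (rule continuous_on_compose2[OF continuous_on_unFin, of _ \<Lambda>]) (use \<Lambda> fin in \<open>auto simp: is_lift_def path_def\<close>)
  then have \<delta>'l: "lifts a 1 {0..1} \<gamma> \<delta>'"
    using \<Lambda> \<gamma>(3) fin unfolding is_lift_def lifts_def by simp
  have \<delta>'0: "pathstart \<delta>' = pathfinish (l i)"
    using \<Lambda> Li by (simp add: is_lift_def pathstart_def \<delta>'_def)
  have op: "opath a \<delta>'" using opath_lift[OF \<gamma>(1) \<delta>'l] .
  have "lift_ends a n (l i +++ \<delta>') z (word_end n (i # j # w) z)" if z: "iter a n z = Fin x" for n z
  proof -
    define z1 where "z1 = lift_end n (l i) z"
    note f = lift_end_fibre[OF i z, folded z1_def]
    obtain z2 where z2: "lift_ends a n \<delta>' z1 z2" using lift_ends_total[OF a0 op, of n z1] f(1) \<delta>'0 by auto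
    have "lift_ends a (Suc n) \<gamma> z1 z2" using lift_ends_compose[OF \<delta>'l z2] by simp
    then have "z2 = word_end (Suc n) (j # w) z1" using lift_ends_unique[OF a0 \<gamma>(1) \<gamma>(4)[OF f(2)]] by simp
    moreover have "lift_ends a n (l i) z z1" using lift_end_l[OF i z] by (simp add: z1_def)
    ultimately show ?thesis using lift_ends_join[OF _ z2] by (simp add: z1_def)
  qed
  moreover have "opath a (l i +++ \<delta>')" using opath_join[OF l(1)[OF i] op] \<delta>'0 by simp
  moreover have "word_path (quartic a) L (i # j # w) t = Fin ((l i +++ \<delta>') t)" if "t \<in> {0..1}" for t
    using L[OF i, of "2 * t"] fin[of "2 * t - 1"] that by (auto simp: joinpaths_def \<Lambda>_def)
  ultimately show ?case using l(2)[OF i] by (intro exI[of _ "l i +++ \<delta>'"]) auto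
qed simp

lemma coding_seq_eq:
  assumes L: "\<And>i t. i \<in> {1..4} \<Longrightarrow> t \<in> {0..1} \<Longrightarrow> L i t = Fin (l i t)" and s: "s \<in> symbol_space 4"
  shows "coding_seq (quartic a) L s k = Fin (Z s k)"
proof (cases k)
  case 0
  \<comment> \<open>The dummy path of the empty word is constant at the base point, which is also
    the value of \<open>Z\<close> at 0.\<close>
  then show ?thesis using L[of 1 0] l(2)[of 1] by (simp add: coding_seq_def Z_def pathfinish_def pathstart_def)
next
  case (Suc k')
  then have "map s [0..<k] \<noteq> []" by simp
  from word_path_lift[OF L this symbol_words[OF s]] obtain \<gamma> where
    g: "\<forall>t\<in>{0..1}. word_path (quartic a) L (map s [0..<k]) t = Fin (\<gamma> t)"
    and g2: "\<forall>n z. iter a n z = Fin x \<longrightarrow> lift_ends a n \<gamma> z (word_end n (map s [0..<k]) z)" by blast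
  have "lift_ends a 0 \<gamma> x (word_end 0 (map s [0..<k]) x)" using g2[rule_format, of 0 x] by simp
  then have "\<gamma> 1 = Z s k" using lift_ends_fibre(2) by (force simp: Z_def pathfinish_def)
  then show ?thesis using g by (simp add: coding_seq_def pathfinish_def)
qed

lemma coding_map_eq:
  assumes L: "\<And>i t. i \<in> {1..4} \<Longrightarrow> t \<in> {0..1} \<Longrightarrow> L i t = Fin (l i t)" and s: "s \<in> symbol_space 4"
  shows "coding_map (quartic a) L s = Fin (code s)" "s \<in> coding_domain 4 (quartic a) L"
proof -
  have "isCont Fin (code s)"
    using continuous_on_Fin[OF continuous_on_id, of UNIV] by (simp add: continuous_on_eq_continuous_at)
  then have "(\<lambda>k. Fin (Z s k)) \<longlonglongrightarrow> Fin (code s)"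
    using Z_tendsto[OF s] isCont_tendsto_compose by blast
  then have t: "coding_seq (quartic a) L s \<longlonglongrightarrow> Fin (code s)"
  proof -
    have "coding_seq (quartic a) L s = (\<lambda>k. Fin (Z s k))" using coding_seq_eq[OF L s] by (intro ext)
    then show ?thesis using \<open>(\<lambda>k. Fin (Z s k)) \<longlonglongrightarrow> Fin (code s)\<close> by (simp only:)
  qed
  then show "coding_map (quartic a) L s = Fin (code s)" unfolding coding_map_def by (rule limI)
  show "s \<in> coding_domain 4 (quartic a) L" using s t by (auto simp: coding_domain_def convergent_def)
qed

subsection \<open>Moving words along loops\<close>

text \<open>A lift of \<open>g\<close> under \<open>k + 1\<close> steps is a lift of \<delta> under
  \<open>k\<close> steps. Preceded by the last letter of the first word and followed by the reversed
  last letter of the second, it becomes the lift of the new loop. As letters are added at the end,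
  initial letters that differ stay different.\<close>

lemma append_loop:
  assumes ij: "i \<in> {1..4}" "j \<in> {1..4}" and g: "opath a g" and L: "lifts a 1 {0..1} g \<delta>"
    and ends: "\<delta> 0 = pathfinish (l i)" "\<delta> 1 = pathfinish (l j)"
    and w: "set u \<subseteq> {1..4}" "set v \<subseteq> {1..4}" "length u = k" "length v = k"
    and e: "lift_ends a k (l i +++ (\<delta> +++ reversepath (l j))) (word_end 0 u x) (word_end 0 v x)"
  shows "lift_ends a (Suc k) g (word_end 0 (u @ [i]) x) (word_end 0 (v @ [j]) x)"
proof -
  have op: "opath a \<delta>" using opath_lift[OF g L] .
  have fu: "iter a k (word_end 0 u x) = Fin x" and fv: "iter a k (word_end 0 v x) = Fin x"
    using word_end_fibre[of u 0 x] word_end_fibre[of v 0 x] w by auto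
  define z1 where "z1 = word_end 0 (u @ [i]) x"
  have z1: "z1 = lift_end k (l i) (word_end 0 u x)" using word_end_snoc[of 0 u i x] w by (simp add: z1_def)
  have e1: "lift_ends a k (l i) (word_end 0 u x) z1" using lift_end_l[OF ij(1) fu] by (simp add: z1)
  obtain z2 where e2: "lift_ends a k \<delta> z1 z2"
    using lift_ends_total[OF a0 op, of k z1] lift_ends_fibre(2)[OF e1] ends by (auto simp: pathstart_def)
  have opr: "opath a (reversepath (l j))" using opath_reverse[OF l(1)[OF ij(2)]] .
  obtain z3 where e3: "lift_ends a k (reversepath (l j)) z2 z3"
    using lift_ends_total[OF a0 opr, of k z2] lift_ends_fibre(2)[OF e2] ends by (auto simp: pathfinish_def)
  have "opath a (l i +++ (\<delta> +++ reversepath (l j)))"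
    using op opr l(1)[OF ij(1)] ends by (intro opath_join) (auto simp: pathfinish_def pathstart_def reversepath_def joinpaths_def)
  then have "z3 = word_end 0 v x" using lift_ends_unique[OF a0 _ lift_ends_join[OF e1 lift_ends_join[OF e2 e3]] e] by blast
  then have "lift_ends a k (l j) (word_end 0 v x) z2" using lift_ends_reverse[OF e3] by simp
  then have "z2 = word_end 0 (v @ [j]) x"
    using lift_end_eq[OF l(1)[OF ij(2)]] word_end_snoc[of 0 v j x] w by simp
  then show ?thesis using lift_ends_compose[OF L e2] by (simp add: z1_def)
qed

text \<open>The sequences \<open>i, 1, 1, ...\<close> and \<open>j, 1, 1, ...\<close> run through
  the same points after the first letter, since all later lifts start from the common
  endpoint.\<close>

lemma same_endpoint_not_inj:
  assumes "i \<in> {1..4}" "j \<in> {1..4}" "i \<noteq> j" "pathfinish (l i) = pathfinish (l j)"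
  shows "\<exists>s\<in>symbol_space 4. \<exists>s'\<in>symbol_space 4. s \<noteq> s' \<and> code s = code s'"
proof -
  define S where "S i = case_nat i (\<lambda>_. 1 :: nat)" for i
  have S: "S i \<in> symbol_space 4" if "i \<in> {1..4}" for i
    using that by (auto simp: S_def symbol_space_def split: nat.split)
  have "Z (S i) (Suc k) = word_end 1 (map (\<lambda>_. 1) [0..<k]) (pathfinish (l i))" if "i \<in> {1..4}" for i k
  proof -
    have "map (S i) [0..<Suc k] = i # map (\<lambda>_. 1) [0..<k]"
      unfolding map_upt_Suc by (simp add: S_def)
    then show ?thesis using lift_end_0[OF that] by (simp add: Z_def del: upt_Suc)
  qed
  then have "Z (S i) (Suc k) = Z (S j) (Suc k)" for k using assms by simp
  moreover have "(\<lambda>k. Z (S i) (Suc k)) \<longlonglongrightarrow> code (S i)" "(\<lambda>k. Z (S j) (Suc k)) \<longlonglongrightarrow> code (S j)"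
    using Z_tendsto[OF S] assms LIMSEQ_Suc by blast+
  ultimately have "code (S i) = code (S j)" using LIMSEQ_unique by force
  moreover have "S i 0 \<noteq> S j 0" using assms(3) by (simp add: S_def)
  then have "S i \<noteq> S j" by auto
  ultimately show ?thesis using S assms by blast
qed

text \<open>Words of every length with different beginnings end at points joined by lifts of the
  fixed loop \<open>g0\<close>, and these lifts shrink. A subsequence of the pairs of words
  stabilizes to a pair of sequences with distance 0 between the codes.\<close>

lemma loops_not_inj:
  assumes P0: "P g0"
    and loop: "\<And>g. P g \<Longrightarrow> opath a g"
    and step: "\<And>g. P g \<Longrightarrow> \<exists>i\<in>{1..4}. \<exists>j\<in>{1..4}. \<exists>\<delta>. lifts a 1 {0..1} g \<delta> \<and> \<delta> 0 = pathfinish (l i) \<and>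
      \<delta> 1 = pathfinish (l j) \<and> P (l i +++ (\<delta> +++ reversepath (l j)))"
    and base: "\<And>g. P g \<Longrightarrow> \<exists>u v. length u = 2 \<and> length v = 2 \<and> set u \<subseteq> {1..4} \<and> set v \<subseteq> {1..4} \<and> u \<noteq> v \<and>
      lift_ends a 2 g (word_end 0 u x) (word_end 0 v x)"
  shows "\<exists>s\<in>symbol_space 4. \<exists>s'\<in>symbol_space 4. s \<noteq> s' \<and> code s = code s'"
proof -
  have "\<exists>u v. length u = 2 + k \<and> length v = 2 + k \<and> set u \<subseteq> {1..4} \<and> set v \<subseteq> {1..4} \<and> take 2 u \<noteq> take 2 v \<and>
      lift_ends a (2 + k) g (word_end 0 u x) (word_end 0 v x)" if "P g" for k g
    using that
  proof (induction k arbitrary: g)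
    case 0
    from base[OF 0] obtain u v where uv: "length u = 2 \<and> length v = 2 \<and> set u \<subseteq> {1..4} \<and> set v \<subseteq> {1..4} \<and> u \<noteq> v \<and>
      lift_ends a 2 g (word_end 0 u x) (word_end 0 v x)" by (elim exE)
    moreover have "take 2 u = u" "take 2 v = v" using uv by simp_all
    ultimately show ?case by (intro exI[of _ u] exI[of _ v]) simp
  next
    case (Suc k)
    obtain i j \<delta> where ij: "i \<in> {1..4}" "j \<in> {1..4}" and \<delta>: "lifts a 1 {0..1} g \<delta>" "\<delta> 0 = pathfinish (l i)"
      "\<delta> 1 = pathfinish (l j)" and P: "P (l i +++ (\<delta> +++ reversepath (l j)))" using step[OF Suc.prems] by blast
    obtain u v where uv: "length u = 2 + k" "length v = 2 + k" "set u \<subseteq> {1..4}" "set v \<subseteq> {1..4}" "take 2 u \<noteq> take 2 v"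
      and e: "lift_ends a (2 + k) (l i +++ (\<delta> +++ reversepath (l j))) (word_end 0 u x) (word_end 0 v x)" using Suc.IH[OF P] by blast
    have "lift_ends a (Suc (2 + k)) g (word_end 0 (u @ [i]) x) (word_end 0 (v @ [j]) x)"
      by (rule append_loop[OF ij loop[OF Suc.prems] \<delta> uv(3,4,1,2) e])
    then show ?case using uv ij by (intro exI[of _ "u @ [i]"] exI[of _ "v @ [j]"]) auto
  qed
  from this[OF P0] obtain u v where
    uv: "\<And>k. length (u k) = 2 + k" "\<And>k. length (v k) = 2 + k" "\<And>k. set (u k) \<subseteq> {1..4}" "\<And>k. set (v k) \<subseteq> {1..4}"
      "\<And>k. take 2 (u k) \<noteq> take 2 (v k)"
    and e: "\<And>k. lift_ends a (2 + k) g0 (word_end 0 (u k) x) (word_end 0 (v k) x)" by metis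
  \<comment> \<open>Padding with 1 turns words into sequences, so that the compactness lemma and the
    rate for \<open>code\<close> apply.\<close>
  define ext where "ext w n = (if n < length w then w ! n else 1)" for w :: "nat list" and n
  have ext: "ext w \<in> symbol_space 4" if "set w \<subseteq> {1..4}" for w
    using that nth_mem by (fastforce simp: ext_def symbol_space_def)
  have map_ext: "map (ext w) [0..<length w] = w" for w
    by (rule nth_equalityI) (auto simp: ext_def)
  obtain S where S: "\<And>m. infinite {k. \<forall>n<m. (ext (u k) n, ext (v k) n) = S n}"
  proof (rule constant_on_infinitely_many[of "{1..4} \<times> {1..4}" "\<lambda>k n. (ext (u k) n, ext (v k) n)"])
    show "(ext (u k) n, ext (v k) n) \<in> {1..4} \<times> {1..4}" for k n
      using ext[OF uv(3)] ext[OF uv(4)] by (auto simp: symbol_space_def)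
  qed auto
  define s s' where "s n = fst (S n)" and "s' n = snd (S n)" for n
  have ex: "\<exists>k\<ge>m. \<forall>n<m. ext (u k) n = s n \<and> ext (v k) n = s' n" for m
  proof -
    obtain k where "k \<ge> m" "\<forall>n<m. (ext (u k) n, ext (v k) n) = S n"
      using S[of m] unfolding infinite_nat_iff_unbounded_le by blast
    then show ?thesis by (intro exI[of _ k]) (metis fst_conv snd_conv s_def s'_def)
  qed
  have ss: "s \<in> symbol_space 4" "s' \<in> symbol_space 4"
  proof -
    have "s n \<in> {1..4} \<and> s' n \<in> {1..4}" for n
    proof -
      obtain k where "ext (u k) n = s n" "ext (v k) n = s' n" using ex[of "Suc n"] by auto
      then show ?thesis using ext[OF uv(3), of k] ext[OF uv(4), of k] unfolding symbol_space_def by (metis mem_Collect_eq)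
    qed
    then show "s \<in> symbol_space 4" "s' \<in> symbol_space 4" by (auto simp: symbol_space_def)
  qed
  have "s \<noteq> s'"
  proof
    assume "s = s'"
    obtain k where k: "\<And>n. n < 2 \<Longrightarrow> ext (u k) n = s n \<and> ext (v k) n = s' n" using ex[of 2] by blast
    have "take 2 (u k) = take 2 (v k)"
    proof (rule nth_equalityI)
      fix n assume "n < length (take 2 (u k))"
      then have "n < 2" by simp
      then show "take 2 (u k) ! n = take 2 (v k) ! n" using k[of n] \<open>s = s'\<close> uv(1,2)[of k] by (simp add: ext_def)
    qed (simp add: uv)
    then show False using uv(5) by blast
  qed
  \<comment> \<open>Index 0 carries the loop, so one rate and one constant serve loop and radial
    together.\<close>
  define \<gamma> where "\<gamma> i = (if i = 0 then g0 else l i)" for i :: nat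
  have op: "opath a (\<gamma> i)" if "i \<in> {0..4}" for i
    using l(1)[of i] loop[OF P0] that by (cases "i = 0") (auto simp: \<gamma>_def)
  obtain \<theta> C where \<theta>: "0 < \<theta>" "\<theta> < 1" "C \<ge> 0"
    and C: "\<And>i k z z'. i \<in> {0..4} \<Longrightarrow> lift_ends a k (\<gamma> i) z z' \<Longrightarrow> dist z z' \<le> C * \<theta> ^ k"
    using paths_shrink[of "{0..4}" \<gamma>] op by (metis finite_atLeastAtMost)
  have Cl: "dist z z' \<le> C * \<theta> ^ k" if "i \<in> {1..4}" "lift_ends a k (l i) z z'" for i k z z'
    using C[of i k z z'] that by (simp add: \<gamma>_def)
  have Cg: "dist z z' \<le> C * \<theta> ^ k" if "lift_ends a k g0 z z'" for k z z'
    using C[of 0 k z z'] that by (simp add: \<gamma>_def)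
  define B where "B = C / (1 - \<theta>)"
  have B: "B \<ge> 0" using \<theta> by (simp add: B_def)
  have cl: "dist (Z s k) (code s) \<le> B * \<theta> ^ k" if "s \<in> symbol_space 4" for s k
    unfolding B_def by (rule code_limit(2)) (use Cl \<theta> that in blast)+
  \<comment> \<open>Three errors of the same order: from \<open>s\<close> to its point at level
    \<open>m\<close>, from there to the code of \<open>ext w\<close>, and from that code to the
    point of the full word.\<close>
  have near: "dist (code s) (word_end 0 w x) \<le> 3 * (B * \<theta> ^ m)"
    if "s \<in> symbol_space 4" "set w \<subseteq> {1..4}" "length w \<ge> m" "\<And>n. n < m \<Longrightarrow> ext w n = s n" for s w m
  proof -
    have "word_end 0 w x = Z (ext w) (length w)" by (simp add: Z_def map_ext)
    moreover have "map (ext w) [0..<m] = map s [0..<m]" using that(4) by (intro map_cong) auto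
    then have "Z (ext w) m = Z s m" unfolding Z_def by (rule arg_cong)
    moreover have "B * \<theta> ^ length w \<le> B * \<theta> ^ m" using B \<theta> that(3) by (intro mult_left_mono power_decreasing) auto
    ultimately show ?thesis
      using cl[OF that(1), of m] cl[OF ext[OF that(2)], of m] cl[OF ext[OF that(2)], of "length w"]
        dist_triangle[of "code s" "word_end 0 w x" "Z s m"] dist_triangle[of "Z s m" "word_end 0 w x" "code (ext w)"]
      by (simp add: dist_commute)
  qed
  have "dist (code s) (code s') \<le> (6 * B + C) * \<theta> ^ m" for m
  proof -
    obtain k where k: "k \<ge> m" "\<And>n. n < m \<Longrightarrow> ext (u k) n = s n \<and> ext (v k) n = s' n" using ex[of m] by blast
    have "dist (code s) (word_end 0 (u k) x) \<le> 3 * (B * \<theta> ^ m)" "dist (code s') (word_end 0 (v k) x) \<le> 3 * (B * \<theta> ^ m)"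
      using near[OF ss(1) uv(3)] near[OF ss(2) uv(4)] k uv(1,2)[of k] by auto
    moreover have "dist (word_end 0 (u k) x) (word_end 0 (v k) x) \<le> C * \<theta> ^ (2 + k)" using Cg[OF e] .
    moreover have "C * \<theta> ^ (2 + k) \<le> C * \<theta> ^ m" using \<theta> k(1) by (intro mult_left_mono power_decreasing) auto
    ultimately show ?thesis
      using dist_triangle[of "code s" "code s'" "word_end 0 (u k) x"] dist_triangle2[of "word_end 0 (u k) x" "code s'" "word_end 0 (v k) x"]
      by (simp add: distrib_right)
  qed
  moreover have "(\<lambda>m. (6 * B + C) * \<theta> ^ m) \<longlonglongrightarrow> 0"
    using \<theta> by (intro tendsto_mult_right_zero LIMSEQ_realpow_zero) auto
  ultimately have "dist (code s) (code s') \<le> 0" by (intro LIMSEQ_le_const[where X = "\<lambda>m. (6 * B + C) * \<theta> ^ m"]) auto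
  then show ?thesis using \<open>s \<noteq> s'\<close> ss by auto
qed

end


subsection \<open>The coding map is not injective\<close>

lemma roots_along_cong:
  assumes "\<And>t. t \<in> {0..1} \<Longrightarrow> \<gamma> t = \<gamma>' t" "roots_along \<gamma> p q p' q'"
  shows "roots_along \<gamma>' p q p' q'"
proof -
  have "(\<forall>t\<in>{0..1}. (\<alpha> t)\<^sup>2 = \<gamma> t - 1 \<and> (\<beta> t)\<^sup>2 = \<gamma> t + 1) \<longleftrightarrow>
    (\<forall>t\<in>{0..1}. (\<alpha> t)\<^sup>2 = \<gamma>' t - 1 \<and> (\<beta> t)\<^sup>2 = \<gamma>' t + 1)" for \<alpha> \<beta>
    using assms(1) by (intro ball_cong) auto
  then show ?thesis using assms(2) unfolding roots_along_def by (simp only:)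
qed

text \<open>The roots \<open>p0\<close>, \<open>q0\<close> at the base point are continued along
  each path of the radial to \<open>pp i\<close>, \<open>qq i\<close>. The signs \<epsilon> and
  \<epsilon>' compare their images under \<open>root_up\<close> with \<open>p0\<close> and
  \<open>q0\<close>; \<open>C\<close> and \<open>Dd\<close> compare the roots at opposite
  endpoints.\<close>

locale signed_rad = rad +
  fixes A p0 q0 :: complex and bar :: "nat \<Rightarrow> nat" and pp qq :: "nat \<Rightarrow> complex" and \<epsilon> \<epsilon>' C Dd :: "nat \<Rightarrow> bool"
  assumes A: "A\<^sup>2 = a" and pq0: "p0\<^sup>2 = x - 1" "q0\<^sup>2 = x + 1"
    and inj: "inj_on (\<lambda>i. pathfinish (l i)) {1..4}"
    and fibre: "\<And>z. iter a 1 z = Fin x \<Longrightarrow> \<exists>i\<in>{1..4}. z = pathfinish (l i)"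
    and bar_mem: "\<And>i. i \<in> {1..4} \<Longrightarrow> bar i \<in> {1..4}"
    and ybar: "\<And>i. i \<in> {1..4} \<Longrightarrow> pathfinish (l (bar i)) = - pathfinish (l i)"
    and ppqq: "\<And>i. i \<in> {1..4} \<Longrightarrow> roots_along (l i) p0 q0 (pp i) (qq i)"
    and eps: "\<And>i. i \<in> {1..4} \<Longrightarrow> root_up A (- 1) (pp i) (qq i) = sg (\<epsilon> i) * p0"
    and eps': "\<And>i. i \<in> {1..4} \<Longrightarrow> root_up A 1 (pp i) (qq i) = sg (\<epsilon>' i) * q0"
    and C: "\<And>i. i \<in> {1..4} \<Longrightarrow> pp (bar i) = \<i> * sg (C i) * qq i"
    and Dd: "\<And>i. i \<in> {1..4} \<Longrightarrow> qq (bar i) = \<i> * sg (Dd i) * pp i"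
begin

abbreviation y :: "nat \<Rightarrow> complex" where "y i \<equiv> pathfinish (l i)"

lemma pq0_nz: "p0 \<noteq> 0" "q0 \<noteq> 0"
proof -
  have "x \<noteq> 1" "x \<noteq> - 1" using x_postcrit pm1_postcrit by metis+
  then show "p0 \<noteq> 0" "q0 \<noteq> 0" using pq0 by (auto simp: add_eq_0_iff2)
qed

lemma pp_sq: "i \<in> {1..4} \<Longrightarrow> (pp i)\<^sup>2 = y i - 1" "i \<in> {1..4} \<Longrightarrow> (qq i)\<^sup>2 = y i + 1"
  using roots_along_ends(3,4)[OF ppqq] by (auto simp: pathfinish_def)

lemma y_q: "i \<in> {1..4} \<Longrightarrow> quartic a (Fin (y i)) = Fin x"
  using l(3) by simp

lemma pp_nz: assumes "i \<in> {1..4}" shows "pp i \<noteq> 0" "qq i \<noteq> 0"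
proof -
  have "(y i)\<^sup>2 \<noteq> 1" using y_q[OF assms] by (simp add: quartic_Fin_eq_iff)
  then have "y i \<noteq> 1" "y i \<noteq> - 1" by auto
  then show "pp i \<noteq> 0" "qq i \<noteq> 0" using pp_sq[OF assms] by (auto simp: add_eq_0_iff2)
qed

lemma A_nz: "A \<noteq> 0" using A a0 by auto

lemma bar_bar: "i \<in> {1..4} \<Longrightarrow> bar (bar i) = i"
  using inj_onD[OF inj, of "bar (bar i)" i] ybar bar_mem by simp

lemma i_sg: "\<i> * sg b * (\<i> * sg c * z) = sg (b = c) * z"
  by (cases b; cases c) (simp_all add: sg_def)

lemma signs: "sign_data {1..4} bar \<epsilon> \<epsilon>' C Dd"
proof
  show "bar i \<in> {1..4}" if "i \<in> {1..4}" for i using bar_mem[OF that] .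
  show "{1..4} \<noteq> ({} :: nat set)" by simp
  show "C (bar i) = (\<not> Dd i)" if i: "i \<in> {1..4}" for i
  proof -
    have "pp i = sg (C (bar i) = Dd i) * pp i"
      using C[OF bar_mem[OF i]] Dd[OF i] bar_bar[OF i] i_sg by simp
    then show ?thesis using pp_nz(1)[OF i] by (auto simp: sg_def split: if_splits)
  qed
  show "Dd (bar i) = (\<not> C i)" if i: "i \<in> {1..4}" for i
  proof -
    have "qq i = sg (Dd (bar i) = C i) * qq i"
      using Dd[OF bar_mem[OF i]] C[OF i] bar_bar[OF i] i_sg by simp
    then show ?thesis using pp_nz(2)[OF i] by (auto simp: sg_def split: if_splits)
  qed
  show "\<epsilon> (bar i) = (\<epsilon> i \<noteq> (C i = Dd i))" if i: "i \<in> {1..4}" for i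
  proof -
    have "sg (\<epsilon> (bar i)) * p0 = sg (C i = Dd i) * (sg (\<epsilon> i) * p0)"
      using eps[OF bar_mem[OF i]] unfolding C[OF i] Dd[OF i] root_up_neg eps[OF i] by (rule sym)
    then have "sg (\<epsilon> (bar i)) * p0 = sg ((C i = Dd i) \<noteq> \<epsilon> i) * p0" by (simp only: sg_mult mult.assoc[symmetric])
    then show ?thesis unfolding sg_inj[OF pq0_nz(1)] by blast
  qed
  show "j = i \<or> j = bar i" if i: "i \<in> {1..4}" and j: "j \<in> {1..4}" and b: "(\<epsilon> i \<noteq> \<epsilon>' i) = (\<epsilon> j \<noteq> \<epsilon>' j)" for i j
  proof -
    define u where "u i = (A * pp i * qq i)\<^sup>2" for i
    have ue: "u i = a * ((y i)\<^sup>2 - 1)" if "i \<in> {1..4}" for i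
      unfolding u_def power_mult_distrib A pp_sq[OF that] by (simp add: algebra_simps power2_eq_square)
    \<comment> \<open>The quotient of the two images under \<open>root_up\<close> is
      \<open>(2 * u - 1) / (2 * u + 1)\<close>, an injective function of \<open>u\<close>. It equals
      \<open>p0 / q0\<close> up to the relative sign of \<epsilon> and \<epsilon>', so this sign
      determines \<open>u\<close>.\<close>
    have r: "(2 * u i - 1) * q0 = sg (\<epsilon> i \<noteq> \<epsilon>' i) * ((2 * u i + 1) * p0)" if i: "i \<in> {1..4}" for i
    proof -
      let ?X = "A * pp i * qq i"
      have X: "?X \<noteq> 0" using A_nz pp_nz[OF i] by simp
      have 1: "2 * u i - 1 = sg (\<epsilon> i) * p0 * (2 * ?X)" and 2: "2 * u i + 1 = sg (\<epsilon>' i) * q0 * (2 * ?X)"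
        using eps[OF i] eps'[OF i] X unfolding root_up_alt u_def by (simp_all add: divide_eq_eq)
      show ?thesis unfolding 1 2 by (cases "\<epsilon> i"; cases "\<epsilon>' i") (simp_all add: sg_def)
    qed
    define s where "s = sg (\<epsilon> i \<noteq> \<epsilon>' i)"
    have 1: "(2 * u i - 1) * q0 = s * ((2 * u i + 1) * p0)" using r[OF i] by (simp add: s_def)
    have 2: "(2 * u j - 1) * q0 = s * ((2 * u j + 1) * p0)" using r[OF j] by (simp only: s_def b)
    have "(2 * u i - 1) * (2 * u j + 1) * q0 = s * ((2 * u i + 1) * p0) * (2 * u j + 1)"
      unfolding 1[symmetric] by (simp only: mult_ac)
    also have "\<dots> = (2 * u j - 1) * q0 * (2 * u i + 1)" unfolding 2 by (simp only: mult_ac)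
    also have "\<dots> = (2 * u j - 1) * (2 * u i + 1) * q0" by (simp only: mult_ac)
    finally have "(2 * u i - 1) * (2 * u j + 1) = (2 * u j - 1) * (2 * u i + 1)" using pq0_nz by simp
    then have "4 * u i = 4 * u j" by (simp add: algebra_simps)
    then have "(y i)\<^sup>2 = (y j)\<^sup>2" using ue[OF i] ue[OF j] a0 by simp
    then have "y j = y i \<or> y j = y (bar i)" using ybar[OF i] by (auto simp: power2_eq_iff)
    then show ?thesis using inj_onD[OF inj] i j bar_mem[OF i] by auto
  qed
qed

sublocale sign_data "{1..4}" bar \<epsilon> \<epsilon>' C Dd by (rule signs)

lemma loop_action:
  assumes g: "opath a g" "pathstart g = x" "pathfinish g = x" and dd: "roots_along g p0 q0 (sg m * p0) (sg n * q0)"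
  obtains \<pi> Mp Mm \<delta> where "sign_action {1..4} bar \<epsilon> \<epsilon>' C Dd m n \<pi> Mp Mm"
    "\<And>i. i \<in> {1..4} \<Longrightarrow> lifts a 1 {0..1} g (\<delta> i) \<and> \<delta> i 0 = y i \<and> \<delta> i 1 = y (\<pi> i)"
    "\<And>i. i \<in> {1..4} \<Longrightarrow> opath a (l i +++ (\<delta> i +++ reversepath (l (\<pi> i)))) \<and>
       pathstart (l i +++ (\<delta> i +++ reversepath (l (\<pi> i)))) = x \<and> pathfinish (l i +++ (\<delta> i +++ reversepath (l (\<pi> i)))) = x \<and>
       roots_along (l i +++ (\<delta> i +++ reversepath (l (\<pi> i)))) p0 q0 (sg (Mp i) * p0) (sg (Mm i) * q0)"
proof -
  have "\<exists>\<delta> j mp mm. lifts a 1 {0..1} g \<delta> \<and> \<delta> 0 = y i \<and> \<delta> 1 = y j \<and> j \<in> {1..4} \<and>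
      roots_along \<delta> (pp i) (qq i) (sg mp * pp j) (sg mm * qq j)" if i: "i \<in> {1..4}" for i
  proof -
    obtain \<delta> where \<delta>: "lifts a 1 {0..1} g \<delta>" "\<delta> 0 = y i"
      using lift_path_ex[OF a0 g(1), of 1 "y i"] l(3)[OF i] g(2) by (auto simp: pathstart_def)
    have "iter a 1 (\<delta> 1) = Fin x" using liftsD[OF \<delta>(1), of 1] g(3) by (simp add: pathfinish_def)
    then obtain j where j: "j \<in> {1..4}" "\<delta> 1 = y j" using fibre by blast
    obtain P Q where PQ: "roots_along \<delta> (pp i) (qq i) P Q"
      using roots_along_total[OF opath_lift[OF g(1) \<delta>(1)], of "pp i" "qq i"] pp_sq[OF i] \<delta>(2) by auto
    have "P\<^sup>2 = (pp j)\<^sup>2" "Q\<^sup>2 = (qq j)\<^sup>2" using roots_along_ends(3,4)[OF PQ] pp_sq[OF j(1)] j(2) by auto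
    then obtain mp mm where "P = sg mp * pp j" "Q = sg mm * qq j" using sq_eq_sg by metis
    then show ?thesis using \<delta> j PQ by blast
  qed
  then obtain \<delta> \<pi> Mp Mm where \<delta>: "\<And>i. i \<in> {1..4} \<Longrightarrow> lifts a 1 {0..1} g (\<delta> i)" "\<And>i. i \<in> {1..4} \<Longrightarrow> \<delta> i 0 = y i"
     "\<And>i. i \<in> {1..4} \<Longrightarrow> \<delta> i 1 = y (\<pi> i)" and \<pi>: "\<And>i. i \<in> {1..4} \<Longrightarrow> \<pi> i \<in> {1..4}"
    and M: "\<And>i. i \<in> {1..4} \<Longrightarrow> roots_along (\<delta> i) (pp i) (qq i) (sg (Mp i) * pp (\<pi> i)) (sg (Mm i) * qq (\<pi> i))"
    by metis
  have push: "roots_along g (sg (\<epsilon> i) * p0) (sg (\<epsilon>' i) * q0)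
      (sg (Mp i \<noteq> Mm i) * (sg (\<epsilon> (\<pi> i)) * p0)) (sg (Mp i \<noteq> Mm i) * (sg (\<epsilon>' (\<pi> i)) * q0))" if i: "i \<in> {1..4}" for i
    using roots_along_push[OF A a0 \<delta>(1)[OF i] M[OF i]]
    unfolding root_up_sign eps[OF i] eps'[OF i] eps[OF \<pi>[OF i]] eps'[OF \<pi>[OF i]] .
  \<comment> \<open>Both continuations along \<open>g\<close> start from the same roots, once with
    the signs of the loop and once pushed down from the lift; their ends must agree.\<close>
  have mn: "sg (\<epsilon> i) * (sg m * p0) = sg (Mp i \<noteq> Mm i) * (sg (\<epsilon> (\<pi> i)) * p0)"
     "sg (\<epsilon>' i) * (sg n * q0) = sg (Mp i \<noteq> Mm i) * (sg (\<epsilon>' (\<pi> i)) * q0)" if i: "i \<in> {1..4}" for i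
    using roots_along_unique[OF g(1) roots_along_sign[OF dd, of "\<epsilon> i" "\<epsilon>' i"] push[OF i]] by auto
  \<comment> \<open>The map is even, so the negative of the lift at \<open>i\<close> is the lift at
    the opposite preimage.\<close>
  have barlift: "\<delta> (bar i) t = - \<delta> i t" if i: "i \<in> {1..4}" and t: "t \<in> {0..1}" for i t
  proof (rule lift_path_unique[OF a0 g(1) \<delta>(1)[OF bar_mem[OF i]] _ _ t])
    show "lifts a 1 {0..1} g (\<lambda>t. - \<delta> i t)"
      using \<delta>(1)[OF i] by (auto simp: lifts_def intro: continuous_on_minus)
    show "\<delta> (bar i) 0 = - \<delta> i 0" using \<delta>(2)[OF i] \<delta>(2)[OF bar_mem[OF i]] ybar[OF i] by simp
  qed
  have \<pi>bar: "\<pi> (bar i) = bar (\<pi> i)" if i: "i \<in> {1..4}" for i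
  proof (rule inj_onD[OF inj])
    show "y (\<pi> (bar i)) = y (bar (\<pi> i))"
      using barlift[OF i, of 1] \<delta>(3)[OF i] \<delta>(3)[OF bar_mem[OF i]] ybar[OF \<pi>[OF i]] by simp
  qed (use \<pi> bar_mem i in auto)
  have bd: "roots_along (\<delta> (bar i)) (pp (bar i)) (qq (bar i)) (\<i> * sg (C i) * (sg (Mm i) * qq (\<pi> i))) (\<i> * sg (Dd i) * (sg (Mp i) * pp (\<pi> i)))"
    if i: "i \<in> {1..4}" for i
    unfolding C[OF i] Dd[OF i] by (rule roots_along_cong[OF _ roots_along_neg[OF M[OF i]]]) (use barlift[OF i] in simp)
  have bars: "sg (Mp (bar i)) * pp (bar (\<pi> i)) = \<i> * sg (C i) * (sg (Mm i) * qq (\<pi> i))"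
    "sg (Mm (bar i)) * qq (bar (\<pi> i)) = \<i> * sg (Dd i) * (sg (Mp i) * pp (\<pi> i))" if i: "i \<in> {1..4}" for i
    using roots_along_unique[OF opath_lift[OF g(1) \<delta>(1)[OF bar_mem[OF i]]] M[OF bar_mem[OF i]] bd[OF i]]
    unfolding \<pi>bar[OF i] by blast+
  have "sign_action_axioms {1..4} bar \<epsilon> \<epsilon>' C Dd m n \<pi> Mp Mm"
  proof
    fix i :: nat assume i: "i \<in> {1..4}"
    show "\<pi> i \<in> {1..4}" by (rule \<pi>[OF i])
    have "sg (\<epsilon> i \<noteq> m) * p0 = sg ((Mp i \<noteq> Mm i) \<noteq> \<epsilon> (\<pi> i)) * p0"
      using mn(1)[OF i] by (simp only: mult.assoc[symmetric] sg_mult)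
    then show "m = (\<epsilon> i \<noteq> (\<epsilon> (\<pi> i) \<noteq> (Mp i \<noteq> Mm i)))" unfolding sg_inj[OF pq0_nz(1)] by blast
    have "sg (\<epsilon>' i \<noteq> n) * q0 = sg ((Mp i \<noteq> Mm i) \<noteq> \<epsilon>' (\<pi> i)) * q0"
      using mn(2)[OF i] by (simp only: mult.assoc[symmetric] sg_mult)
    then show "n = (\<epsilon>' i \<noteq> (\<epsilon>' (\<pi> i) \<noteq> (Mp i \<noteq> Mm i)))" unfolding sg_inj[OF pq0_nz(2)] by blast
    have "\<i> * (sg (Mp (bar i) \<noteq> C (\<pi> i)) * qq (\<pi> i)) = \<i> * (sg (C i \<noteq> Mm i) * qq (\<pi> i))"
      using bars(1)[OF i] unfolding C[OF \<pi>[OF i]] sg_mult[symmetric] by (simp only: mult_ac)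
    then have "sg (Mp (bar i) \<noteq> C (\<pi> i)) * qq (\<pi> i) = sg (C i \<noteq> Mm i) * qq (\<pi> i)" by simp
    then show "Mp (bar i) = (C i \<noteq> (C (\<pi> i) \<noteq> Mm i))" unfolding sg_inj[OF pp_nz(2)[OF \<pi>[OF i]]] by blast
    have "\<i> * (sg (Mm (bar i) \<noteq> Dd (\<pi> i)) * pp (\<pi> i)) = \<i> * (sg (Dd i \<noteq> Mp i) * pp (\<pi> i))"
      using bars(2)[OF i] unfolding Dd[OF \<pi>[OF i]] sg_mult[symmetric] by (simp only: mult_ac)
    then have "sg (Mm (bar i) \<noteq> Dd (\<pi> i)) * pp (\<pi> i) = sg (Dd i \<noteq> Mp i) * pp (\<pi> i)" by simp
    then show "Mm (bar i) = (Dd i \<noteq> (Dd (\<pi> i) \<noteq> Mp i))" unfolding sg_inj[OF pp_nz(1)[OF \<pi>[OF i]]] by blast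
  qed
  then have act: "sign_action {1..4} bar \<epsilon> \<epsilon>' C Dd m n \<pi> Mp Mm" using signs unfolding sign_action_def by blast
  show thesis
  proof (rule that[OF act])
    fix i :: nat assume i: "i \<in> {1..4}"
    show "lifts a 1 {0..1} g (\<delta> i) \<and> \<delta> i 0 = y i \<and> \<delta> i 1 = y (\<pi> i)" using \<delta> i by blast
    have ends: "pathstart (\<delta> i) = y i" "pathfinish (\<delta> i) = y (\<pi> i)"
      using \<delta>(2,3)[OF i] unfolding pathstart_def pathfinish_def by blast+
    have op: "opath a (l i +++ (\<delta> i +++ reversepath (l (\<pi> i))))"
      using opath_lift[OF g(1) \<delta>(1)[OF i]] l(1)[OF i] l(1)[OF \<pi>[OF i]] ends
      by (intro opath_join opath_reverse) auto
    have "roots_along (reversepath (l (\<pi> i))) (sg (Mp i) * pp (\<pi> i)) (sg (Mm i) * qq (\<pi> i)) (sg (Mp i) * p0) (sg (Mm i) * q0)"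
      by (rule roots_along_sign[OF roots_along_reverse[OF ppqq[OF \<pi>[OF i]]]])
    then have "roots_along (l i +++ (\<delta> i +++ reversepath (l (\<pi> i)))) p0 q0 (sg (Mp i) * p0) (sg (Mm i) * q0)"
      using roots_along_join[OF ppqq[OF i] roots_along_join[OF M[OF i]]] by blast
    then show "opath a (l i +++ (\<delta> i +++ reversepath (l (\<pi> i)))) \<and>
       pathstart (l i +++ (\<delta> i +++ reversepath (l (\<pi> i)))) = x \<and> pathfinish (l i +++ (\<delta> i +++ reversepath (l (\<pi> i)))) = x \<and>
       roots_along (l i +++ (\<delta> i +++ reversepath (l (\<pi> i)))) p0 q0 (sg (Mp i) * p0) (sg (Mm i) * q0)"
      using op l(2)[OF i] l(2)[OF \<pi>[OF i]] by simp
  qed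
qed

definition sloop :: "(real \<Rightarrow> complex) \<Rightarrow> bool \<Rightarrow> bool \<Rightarrow> bool" where
  "sloop g m n \<longleftrightarrow> opath a g \<and> pathstart g = x \<and> pathfinish g = x \<and> roots_along g p0 q0 (sg m * p0) (sg n * q0)"

lemma sloop_action:
  assumes "sloop g m n"
  obtains \<pi> Mp Mm \<delta> where "sign_action {1..4} bar \<epsilon> \<epsilon>' C Dd m n \<pi> Mp Mm"
    "\<And>i. i \<in> {1..4} \<Longrightarrow> lifts a 1 {0..1} g (\<delta> i) \<and> \<delta> i 0 = y i \<and> \<delta> i 1 = y (\<pi> i)"
    "\<And>i. i \<in> {1..4} \<Longrightarrow> sloop (l i +++ (\<delta> i +++ reversepath (l (\<pi> i)))) (Mp i) (Mm i)"
  using loop_action[of g m n] assms unfolding sloop_def by metis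

lemma sloop_moves:
  assumes g: "sloop g m n" "good m n"
  shows "\<exists>u v. length u = 2 \<and> length v = 2 \<and> set u \<subseteq> {1..4} \<and> set v \<subseteq> {1..4} \<and> u \<noteq> v \<and>
      lift_ends a 2 g (word_end 0 u x) (word_end 0 v x)"
proof -
  obtain \<pi> Mp Mm \<delta> where act: "sign_action {1..4} bar \<epsilon> \<epsilon>' C Dd m n \<pi> Mp Mm"
    and \<delta>: "\<And>i. i \<in> {1..4} \<Longrightarrow> lifts a 1 {0..1} g (\<delta> i) \<and> \<delta> i 0 = y i \<and> \<delta> i 1 = y (\<pi> i)"
    and h: "\<And>i. i \<in> {1..4} \<Longrightarrow> sloop (l i +++ (\<delta> i +++ reversepath (l (\<pi> i)))) (Mp i) (Mm i)"
    using sloop_action[OF g(1)] by metis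
  \<comment> \<open>The words are \<open>[1, i]\<close> and its image. The last letter is moved by
    \<open>g\<close> itself and the first by the new loop at \<open>i\<close>. If \<open>i\<close>
    stays fixed, the new loop has unequal signs, exchanges the values of \<open>u\<close>, and
    therefore moves the letter 1.\<close>
  have two: "\<exists>u v. length u = 2 \<and> length v = 2 \<and> set u \<subseteq> {1..4} \<and> set v \<subseteq> {1..4} \<and> u \<noteq> v \<and>
      lift_ends a 2 g (word_end 0 u x) (word_end 0 v x)"
    if i: "i \<in> {1..4}" and alt: "\<pi> i \<noteq> i \<or> Mp i \<noteq> Mm i" for i
  proof -
    obtain \<pi>' Mp' Mm' \<delta>' where act': "sign_action {1..4} bar \<epsilon> \<epsilon>' C Dd (Mp i) (Mm i) \<pi>' Mp' Mm'"
      and \<delta>': "\<And>k. k \<in> {1..4} \<Longrightarrow> lifts a 1 {0..1} (l i +++ (\<delta> i +++ reversepath (l (\<pi> i)))) (\<delta>' k) \<and> \<delta>' k 0 = y k \<and> \<delta>' k 1 = y (\<pi>' k)"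
      using sloop_action[OF h[OF i]] by metis
    have one: "(1::nat) \<in> {1..4}" by simp
    have \<pi>i: "\<pi> i \<in> {1..4}" "\<pi>' 1 \<in> {1..4}"
      using sign_action.\<pi>[OF act i] sign_action.\<pi>[OF act' one] by auto
    have "\<pi> i \<noteq> i \<or> \<pi>' 1 \<noteq> 1"
      using sign_action.swap[OF act' one] alt by auto
    then have ne: "[1, i] \<noteq> [\<pi>' 1, \<pi> i]" by auto
    have "lift_ends a 1 (l i +++ (\<delta> i +++ reversepath (l (\<pi> i)))) (word_end 0 [1] x) (word_end 0 [\<pi>' 1] x)"
      unfolding lift_ends_def using \<delta>'[OF one] lift_end_0[OF one] lift_end_0[OF \<pi>i(2)] by auto
    then have "lift_ends a (Suc 1) g (word_end 0 ([1] @ [i]) x) (word_end 0 ([\<pi>' 1] @ [\<pi> i]) x)"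
      using \<delta>[OF i] \<pi>i i g(1)
      by (intro append_loop[where \<delta> = "\<delta> i"]) (auto simp: sloop_def)
    then have "lift_ends a 2 g (word_end 0 [1, i] x) (word_end 0 [\<pi>' 1, \<pi> i] x)" by (simp add: numeral_2_eq_2)
    then show ?thesis using ne i \<pi>i by (intro exI[of _ "[1, i]"] exI[of _ "[\<pi>' 1, \<pi> i]"]) auto
  qed
  have "(\<exists>i\<in>{1..4}. \<pi> i \<noteq> i) \<or> (\<forall>i\<in>{1..4}. Mp i \<noteq> Mm i)" using sign_action.good_moves[OF act g(2)] .
  then obtain i where "i \<in> {1..4}" "\<pi> i \<noteq> i \<or> Mp i \<noteq> Mm i"
  proof
    assume "\<forall>i\<in>{1..4}. Mp i \<noteq> Mm i"
    then show thesis using that[of 1] by simp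
  qed blast
  then show ?thesis by (rule two)
qed

lemma not_inj: "\<exists>s\<in>symbol_space 4. \<exists>s'\<in>symbol_space 4. s \<noteq> s' \<and> code s = code s'"
proof -
  obtain g where "opath a g" "pathstart g = x" "pathfinish g = x" "roots_along g p0 q0 (- p0) (- q0)"
    using flipping_loop[OF x_postcrit pq0] by metis
  then have g: "sloop g True True" by (simp add: sloop_def sg_def)
  obtain \<pi> Mp Mm \<delta> where act: "sign_action {1..4} bar \<epsilon> \<epsilon>' C Dd True True \<pi> Mp Mm"
    and h: "\<And>i. i \<in> {1..4} \<Longrightarrow> sloop (l i +++ (\<delta> i +++ reversepath (l (\<pi> i)))) (Mp i) (Mm i)"
    using sloop_action[OF g] by metis
  have "good True True \<or> (\<exists>i\<in>{1..4}. good (Mp i) (Mm i))" using sign_action.good_start[OF act] by simp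
  then obtain g0 where g0: "\<exists>m n. sloop g0 m n \<and> good m n"
  proof
    assume "good True True"
    then show thesis using that[of g] g by blast
  next
    assume "\<exists>i\<in>{1..4}. good (Mp i) (Mm i)"
    then show thesis using that h by blast
  qed
  show ?thesis
  proof (rule loops_not_inj[of "\<lambda>g. \<exists>m n. sloop g m n \<and> good m n", OF g0])
    fix g assume "\<exists>m n. sloop g m n \<and> good m n"
    then obtain m n where g: "sloop g m n" "good m n" by blast
    show "opath a g" using g by (simp add: sloop_def)
    show "\<exists>u v. length u = 2 \<and> length v = 2 \<and> set u \<subseteq> {1..4} \<and> set v \<subseteq> {1..4} \<and> u \<noteq> v \<and>
      lift_ends a 2 g (word_end 0 u x) (word_end 0 v x)" using sloop_moves[OF g] .
    obtain \<pi> Mp Mm \<delta> where act: "sign_action {1..4} bar \<epsilon> \<epsilon>' C Dd m n \<pi> Mp Mm"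
      and \<delta>: "\<And>i. i \<in> {1..4} \<Longrightarrow> lifts a 1 {0..1} g (\<delta> i) \<and> \<delta> i 0 = y i \<and> \<delta> i 1 = y (\<pi> i)"
      and h: "\<And>i. i \<in> {1..4} \<Longrightarrow> sloop (l i +++ (\<delta> i +++ reversepath (l (\<pi> i)))) (Mp i) (Mm i)"
      using sloop_action[OF g(1)] by metis
    obtain i where "i \<in> {1..4}" "good (Mp i) (Mm i)" using sign_action.good_step[OF act g(2)] by blast
    then show "\<exists>i\<in>{1..4}. \<exists>j\<in>{1..4}. \<exists>\<delta>. lifts a 1 {0..1} g \<delta> \<and> \<delta> 0 = y i \<and> \<delta> 1 = y j \<and>
        (\<exists>m n. sloop (l i +++ (\<delta> +++ reversepath (l j))) m n \<and> good m n)"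
      using \<delta>[of i] h[of i] sign_action.\<pi>[OF act, of i] by blast
  qed
qed

end

context rad
begin

text \<open>Four distinct endpoints exhaust the fibre of \<open>x\<close>, so reflections and ends
  of lifted loops are endpoints of the radial again and the sign argument applies. Otherwise two
  symbols share an endpoint.\<close>

theorem code_not_inj: "\<exists>s\<in>symbol_space 4. \<exists>s'\<in>symbol_space 4. s \<noteq> s' \<and> code s = code s'"
proof (cases "inj_on (\<lambda>i. pathfinish (l i)) {1..4}")
  case False
  then show ?thesis using same_endpoint_not_inj unfolding inj_on_def by blast
next
  case inj: True
  let ?y = "\<lambda>i. pathfinish (l i)"
  have avoid: "x \<noteq> 1 \<and> x \<noteq> - 1 \<and> x \<noteq> qf a 0" using x_postcrit pm1_postcrit qf_0_postcrit by metis
  obtain Lf :: "nat \<Rightarrow> complex \<Rightarrow> complex" where "bij_betw (\<lambda>i. Lf i x) {1..4} {z. quartic a (Fin z) = Fin x}"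
    using four_lifts[OF a0, of "{x}" "\<lambda>x. x"] avoid by (metis continuous_on_id contractible_sing singletonD singletonI)
  then have card: "card {z. quartic a (Fin z) = Fin x} = 4" and fin: "finite {z. quartic a (Fin z) = Fin x}"
    using bij_betw_same_card bij_betw_finite by fastforce+
  have "?y ` {1..4} \<subseteq> {z. quartic a (Fin z) = Fin x}" using l(3) by auto
  moreover have "card (?y ` {1..4}) = 4" using card_image[OF inj] by simp
  ultimately have im: "?y ` {1..4} = {z. quartic a (Fin z) = Fin x}" using card_subset_eq[OF fin] card by metis
  have fibre: "\<exists>i\<in>{1..4}. z = ?y i" if "iter a 1 z = Fin x" for z
    using that im by auto
  have "\<exists>j\<in>{1..4}. ?y j = - ?y i" if "i \<in> {1..4}" for i
    using fibre[of "- ?y i"] l(3)[OF that] by auto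
  then obtain bar where bar: "\<And>i. i \<in> {1..4} \<Longrightarrow> bar i \<in> {1..4}" "\<And>i. i \<in> {1..4} \<Longrightarrow> ?y (bar i) = - ?y i" by metis
  define A p0 q0 where "A = csqrt a" and "p0 = csqrt (x - 1)" and "q0 = csqrt (x + 1)"
  have A: "A\<^sup>2 = a" and pq0: "p0\<^sup>2 = x - 1" "q0\<^sup>2 = x + 1" by (simp_all add: A_def p0_def q0_def)
  have "\<exists>p q. roots_along (l i) p0 q0 p q" if "i \<in> {1..4}" for i
    by (rule roots_along_total[OF l(1)[OF that]]) (use pq0 l(2)[OF that] in \<open>auto simp: pathstart_def\<close>)
  then obtain pp qq where ppqq: "\<And>i. i \<in> {1..4} \<Longrightarrow> roots_along (l i) p0 q0 (pp i) (qq i)" by metis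
  have sq: "(pp i)\<^sup>2 = ?y i - 1" "(qq i)\<^sup>2 = ?y i + 1" if "i \<in> {1..4}" for i
    using roots_along_ends(3,4)[OF ppqq[OF that]] by (auto simp: pathfinish_def)
  have up: "(root_up A e (pp i) (qq i))\<^sup>2 = x + e" if "i \<in> {1..4}" "e\<^sup>2 = 1" for i e
    by (rule root_up_sq[OF A a0 _ sq[OF that(1)] that(2)]) (use l(3)[OF that(1)] in simp)
  have "\<exists>b. root_up A (- 1) (pp i) (qq i) = sg b * p0" if "i \<in> {1..4}" for i
    by (rule sq_eq_sg) (simp add: up[OF that] pq0)
  then obtain \<epsilon> where eps: "\<And>i. i \<in> {1..4} \<Longrightarrow> root_up A (- 1) (pp i) (qq i) = sg (\<epsilon> i) * p0" by metis
  have "\<exists>b. root_up A 1 (pp i) (qq i) = sg b * q0" if "i \<in> {1..4}" for i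
    by (rule sq_eq_sg) (simp add: up[OF that] pq0)
  then obtain \<epsilon>' where eps': "\<And>i. i \<in> {1..4} \<Longrightarrow> root_up A 1 (pp i) (qq i) = sg (\<epsilon>' i) * q0" by metis
  have "\<exists>b. pp (bar i) = sg b * (\<i> * qq i)" if "i \<in> {1..4}" for i
    by (rule sq_eq_sg) (simp add: power_mult_distrib sq[OF that] sq[OF bar(1)[OF that]] bar(2)[OF that])
  then obtain C where C: "\<And>i. i \<in> {1..4} \<Longrightarrow> pp (bar i) = sg (C i) * (\<i> * qq i)" by metis
  have "\<exists>b. qq (bar i) = sg b * (\<i> * pp i)" if "i \<in> {1..4}" for i
    by (rule sq_eq_sg) (simp add: power_mult_distrib sq[OF that] sq[OF bar(1)[OF that]] bar(2)[OF that])
  then obtain Dd where Dd: "\<And>i. i \<in> {1..4} \<Longrightarrow> qq (bar i) = sg (Dd i) * (\<i> * pp i)" by metis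
  interpret signed_rad a D l x A p0 q0 bar pp qq \<epsilon> \<epsilon>' C Dd
    by unfold_locales (use A pq0 inj fibre bar ppqq eps eps' C Dd in \<open>auto simp: mult_ac\<close>)
  show ?thesis by (rule not_inj)
qed

end


subsection \<open>Critical points\<close>

lemma open_Fin_vimage: "open U \<Longrightarrow> open (Fin -` U)"
  using continuous_on_Fin[OF continuous_on_id, of UNIV] by (simp add: open_vimage)

text \<open>A nonzero derivative gives local injectivity, and an injective holomorphic function has
  no critical point. This makes the topological notion computable.\<close>

lemma critical_point_iff_deriv:
  assumes S: "open S" "c \<in> S" and h: "h holomorphic_on S" and g: "\<And>z. z \<in> S \<Longrightarrow> g (Fin z) = Fin (h z)"
  shows "critical_point g (Fin c) \<longleftrightarrow> deriv h c = 0"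
proof
  assume crit: "critical_point g (Fin c)"
  show "deriv h c = 0"
  proof (rule ccontr)
    assume "deriv h c \<noteq> 0"
    then obtain r where r: "r > 0" "ball c r \<subseteq> S" "inj_on h (ball c r)"
      using has_complex_derivative_locally_injective[OF h S(2,1)] by blast
    have "inj_on g (Fin ` ball c r)"
    proof (rule inj_onI)
      fix p q assume pq: "p \<in> Fin ` ball c r" "q \<in> Fin ` ball c r" "g p = g q"
      then obtain z w where zw: "p = Fin z" "q = Fin w" "z \<in> ball c r" "w \<in> ball c r" by blast
      then have "h z = h w" using pq(3) g r(2) by (metis rsphere.inject subsetD)
      then show "p = q" using r(3) zw by (simp add: inj_on_eq_iff)
    qed
    moreover have "Fin c \<in> Fin ` ball c r" using r(1) by simp
    ultimately show False using crit open_Fin_image[OF open_ball] unfolding critical_point_def by blast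
  qed
next
  assume d: "deriv h c = 0"
  show "critical_point g (Fin c)"
    unfolding critical_point_def
  proof
    assume "\<exists>U. open U \<and> Fin c \<in> U \<and> inj_on g U"
    then obtain U where U: "open U" "Fin c \<in> U" "inj_on g U" by blast
    define V where "V = S \<inter> Fin -` U"
    have V: "open V" "c \<in> V" using S U open_Fin_vimage by (auto simp: V_def)
    have "inj_on h V"
    proof (rule inj_onI)
      fix z w assume zw: "z \<in> V" "w \<in> V" "h z = h w"
      then have "g (Fin z) = g (Fin w)" using g by (simp add: V_def)
      then have "Fin z = Fin w" using inj_onD[OF U(3)] zw unfolding V_def by blast
      then show "z = w" by simp
    qed
    moreover have "h holomorphic_on V" using h holomorphic_on_subset by (auto simp: V_def)
    ultimately show False using holomorphic_injective_imp_regular[OF _ V(1)] V(2) d by blast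
  qed
qed

text \<open>Arbitrarily close to 0 and to infinity there are distinct points \<open>z\<close> and
  \<open>- z\<close> with the same image.\<close>

lemma critical_point_even:
  assumes "\<And>z. g (Fin (- z)) = g (Fin z)"
  shows "critical_point g (Fin 0)" "critical_point g Infty"
proof -
  show "critical_point g (Fin 0)"
    unfolding critical_point_def
  proof
    assume "\<exists>U. open U \<and> Fin 0 \<in> U \<and> inj_on g U"
    then obtain U where U: "open U" "Fin 0 \<in> U" "inj_on g U" by blast
    then obtain e where e: "e > 0" "ball 0 e \<subseteq> Fin -` U" using open_Fin_vimage open_contains_ball by (metis vimageI)
    define z :: complex where "z = of_real (e / 2)"
    have "z \<in> ball 0 e" "- z \<in> ball 0 e" using e(1) by (simp_all add: z_def dist_norm norm_divide)
    then have "Fin (- z) = Fin z" using inj_onD[OF U(3)] assms[of z] e(2) by blast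
    then show False using e(1) by (simp add: z_def)
  qed
  show "critical_point g Infty"
    unfolding critical_point_def
  proof
    assume "\<exists>U. open U \<and> Infty \<in> U \<and> inj_on g U"
    then obtain U where U: "open U" "Infty \<in> U" "inj_on g U" by blast
    then obtain e where e: "e > 0" "ball Infty e \<subseteq> U" using open_contains_ball by blast
    define z :: complex where "z = of_real (4 / e)"
    have z: "z \<noteq> 0" "cmod z = 4 / e" using e(1) by (simp_all add: z_def norm_divide)
    have "2 / cmod z < e" using e(1) z(2) by simp
    then have "dist (Fin z) Infty < e" "dist (Fin (- z)) Infty < e"
      using dist_Fin_Infty_le[of z] dist_Fin_Infty_le[of "- z"] z(1) by auto
    then have "Fin z \<in> U" "Fin (- z) \<in> U" using e(2) by (auto simp: dist_commute)
    then have "Fin (- z) = Fin z" using inj_onD[OF U(3)] assms[of z] by blast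
    then show False using z(1) by simp
  qed
qed

definition qf' :: "complex \<Rightarrow> complex \<Rightarrow> complex" where
  "qf' a z = 2 * a * z * (1 - 1 / (4 * (a * (z\<^sup>2 - 1))\<^sup>2))"

lemma qf_deriv:
  assumes "a \<noteq> 0" "z\<^sup>2 \<noteq> 1"
  shows "(qf a has_field_derivative qf' a z) (at z)"
proof -
  have nz: "a * (z\<^sup>2 - 1) \<noteq> 0" using assms by simp
  have "((\<lambda>u. u + 1 / (4 * u)) has_field_derivative 1 - 1 / (4 * u\<^sup>2)) (at u)" if "u \<noteq> 0" for u :: complex
    using that by (auto intro!: derivative_eq_intros simp: field_simps power2_eq_square)
  note 1 = this[OF nz]
  have 2: "((\<lambda>z. a * (z\<^sup>2 - 1)) has_field_derivative 2 * a * z) (at z)"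
    by (auto intro!: derivative_eq_intros)
  have "((\<lambda>z. a * (z\<^sup>2 - 1) + 1 / (4 * (a * (z\<^sup>2 - 1)))) has_field_derivative
      (1 - 1 / (4 * (a * (z\<^sup>2 - 1))\<^sup>2)) * (2 * a * z)) (at z)"
    using DERIV_chain2[OF 1 2] .
  then show ?thesis by (simp add: qf'_def qf_def[abs_def] mult_ac)
qed

lemma qf'_zero_iff:
  assumes "a \<noteq> 0" "z\<^sup>2 \<noteq> 1"
  shows "qf' a z = 0 \<longleftrightarrow> z = 0 \<or> 2 * (a * (z\<^sup>2 - 1)) = 1 \<or> 2 * (a * (z\<^sup>2 - 1)) = - 1"
proof -
  have nz: "a * (z\<^sup>2 - 1) \<noteq> 0" using assms by simp
  have "1 - 1 / (4 * u\<^sup>2) = 0 \<longleftrightarrow> (2 * u)\<^sup>2 = 1" if "u \<noteq> 0" for u :: complex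
    using that by (auto simp: power_mult_distrib)
  from this[OF nz] show ?thesis using assms(1) unfolding qf'_def power2_eq_1_iff by auto
qed

lemma open_not_pole: "open {z :: complex. z\<^sup>2 \<noteq> 1}"
  by (intro open_Collect_neq continuous_intros)

lemma qf_holomorphic: "a \<noteq> 0 \<Longrightarrow> qf a holomorphic_on {z. z\<^sup>2 \<noteq> 1}"
  using qf_deriv holomorphic_on_open[OF open_not_pole] by blast

lemma critical_quartic:
  assumes "a \<noteq> 0" "z\<^sup>2 \<noteq> 1"
  shows "critical_point (quartic a) (Fin z) \<longleftrightarrow> qf' a z = 0"
  using critical_point_iff_deriv[OF open_not_pole _ qf_holomorphic[OF assms(1)], of z "quartic a"] assms
    DERIV_imp_deriv[OF qf_deriv[OF assms]] by (simp add: quartic_Fin_eq_iff)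

lemma critical_quartic2:
  assumes a: "a \<noteq> 0" and z: "z\<^sup>2 \<noteq> 1" "(qf a z)\<^sup>2 \<noteq> 1"
  shows "critical_point (quartic a \<circ> quartic a) (Fin z) \<longleftrightarrow> qf' a z = 0 \<or> qf' a (qf a z) = 0"
proof -
  define S where "S = {z. z\<^sup>2 \<noteq> 1} \<inter> qf a -` {z. z\<^sup>2 \<noteq> 1}"
  have S: "open S" unfolding S_def
    by (rule continuous_open_preimage[OF holomorphic_on_imp_continuous_on[OF qf_holomorphic[OF a]] open_not_pole open_not_pole])
  have hol: "(qf a \<circ> qf a) holomorphic_on S"
    by (rule holomorphic_on_compose_gen[OF holomorphic_on_subset[OF qf_holomorphic[OF a]] qf_holomorphic[OF a]]) (auto simp: S_def)
  have "deriv (qf a \<circ> qf a) z = qf' a (qf a z) * qf' a z"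
    using DERIV_chain[OF qf_deriv[OF a z(2)] qf_deriv[OF a z(1)]] by (rule DERIV_imp_deriv)
  moreover have "critical_point (quartic a \<circ> quartic a) (Fin z) \<longleftrightarrow> deriv (qf a \<circ> qf a) z = 0"
  proof (rule critical_point_iff_deriv[OF S _ hol])
    fix w assume "w \<in> S"
    then have "quartic a (Fin w) = Fin (qf a w)" "quartic a (Fin (qf a w)) = Fin (qf a (qf a w))"
      by (auto simp: S_def quartic_Fin_eq_iff)
    then show "(quartic a \<circ> quartic a) (Fin w) = Fin ((qf a \<circ> qf a) w)" by simp
  qed (use z in \<open>auto simp: S_def\<close>)
  ultimately show ?thesis by auto
qed

lemma quartic_surj_Fin:
  assumes a: "a \<noteq> 0"
  obtains z where "quartic a (Fin z) = Fin w"
proof -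
  define u where "u = (w + csqrt (w\<^sup>2 - 1)) / 2"
  define z where "z = csqrt (1 + u / a)"
  have "4 * (u\<^sup>2 - w * u + 1/4) = (2 * u - w)\<^sup>2 - (w\<^sup>2 - 1)" by (simp add: algebra_simps power2_eq_square)
  also have "2 * u - w = csqrt (w\<^sup>2 - 1)" by (simp add: u_def add_divide_distrib)
  finally have "4 * (u\<^sup>2 - w * u + 1/4) = 0" by simp
  then have "u\<^sup>2 - w * u + 1/4 = 0" by (simp only: mult_eq_0_iff) simp
  moreover have "a * (z\<^sup>2 - 1) = u" using a by (simp add: z_def)
  ultimately have "quartic a (Fin z) = Fin w" unfolding qf_eq_iff[OF a] Let_def by simp
  then show thesis by (rule that)
qed

text \<open>For the values \<plusminus>1 the quadratic for \<open>u\<close> has the double root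
  \<open>e / 2\<close>, which accounts for the witness.\<close>

lemma critical_pm1:
  assumes a: "a \<noteq> 0" and e: "e = 1 \<or> e = - 1"
  obtains z where "quartic a (Fin z) = Fin e" "qf' a z = 0"
proof -
  define z where "z = csqrt (1 + e / 2 / a)"
  have az: "a * (z\<^sup>2 - 1) = e / 2" using a by (simp add: z_def)
  have "(e / 2)\<^sup>2 - e * (e / 2) + 1 / 4 = 0" using e by (auto simp: power2_eq_square)
  then have 1: "quartic a (Fin z) = Fin e" unfolding qf_eq_iff[OF a] Let_def az .
  then have "z\<^sup>2 \<noteq> 1" by (simp add: quartic_Fin_eq_iff)
  then have "qf' a z = 0" using e unfolding qf'_zero_iff[OF a \<open>z\<^sup>2 \<noteq> 1\<close>] az by auto
  with 1 show thesis by (rule that)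
qed

lemma qf'_0 [simp]: "qf' a 0 = 0"
  by (simp add: qf'_def)

lemma critical_values_quartic:
  assumes a: "a \<noteq> 0"
  shows "Infty \<in> critical_values (quartic a)" "Fin (qf a 0) \<in> critical_values (quartic a)"
    "Fin 1 \<in> critical_values (quartic a)" "Fin (- 1) \<in> critical_values (quartic a)"
proof -
  note ev = critical_point_even[of "quartic a", OF quartic_minus]
  show "Infty \<in> critical_values (quartic a)" using ev(2) unfolding critical_values_def by force
  have "quartic a (Fin 0) = Fin (qf a 0)" by (simp add: quartic_Fin_eq_iff)
  then show "Fin (qf a 0) \<in> critical_values (quartic a)" using ev(1) unfolding critical_values_def by (metis (mono_tags, lifting) mem_Collect_eq)
  have "Fin e \<in> critical_values (quartic a)" if e: "e = 1 \<or> e = - 1" for e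
  proof -
    obtain z where z: "quartic a (Fin z) = Fin e" "qf' a z = 0" using critical_pm1[OF a e] .
    then have "critical_point (quartic a) (Fin z)" using critical_quartic[OF a] by (simp add: quartic_Fin_eq_iff)
    then show ?thesis using z(1) unfolding critical_values_def by (metis (mono_tags, lifting) mem_Collect_eq)
  qed
  then show "Fin 1 \<in> critical_values (quartic a)" "Fin (- 1) \<in> critical_values (quartic a)" by auto
qed

lemma critical_values_quartic2:
  assumes a: "a \<noteq> 0"
  shows "Infty \<in> critical_values (quartic a \<circ> quartic a)" "iter a 2 0 \<in> critical_values (quartic a \<circ> quartic a)"
    "Fin (qf a 0) \<in> critical_values (quartic a \<circ> quartic a)"
    "Fin 1 \<in> critical_values (quartic a \<circ> quartic a)" "Fin (- 1) \<in> critical_values (quartic a \<circ> quartic a)"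
proof -
  let ?F = "quartic a \<circ> quartic a"
  have "?F (Fin (- z)) = ?F (Fin z)" for z by simp
  note ev = critical_point_even[of ?F, OF this]
  show "Infty \<in> critical_values ?F" using ev(2) unfolding critical_values_def by force
  have "iter a 2 0 = ?F (Fin 0)" by (simp add: numeral_2_eq_2)
  then show "iter a 2 0 \<in> critical_values ?F" using ev(1) unfolding critical_values_def by blast
  \<comment> \<open>A critical point \<open>z\<close> of one step has a preimage \<open>c\<close>,
    which is critical for two steps and has the same critical value as \<open>z\<close>.\<close>
  have *: "Fin w \<in> critical_values ?F" if w: "quartic a (Fin z) = Fin w" "qf' a z = 0" for z w
  proof -
    obtain c where c: "quartic a (Fin c) = Fin z" using quartic_surj_Fin[OF a] .
    have "c\<^sup>2 \<noteq> 1" "qf a c = z" "z\<^sup>2 \<noteq> 1" using c w by (auto simp: quartic_Fin_eq_iff)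
    then have "critical_point ?F (Fin c)" using critical_quartic2[OF a, of c] w(2) by simp
    moreover have "?F (Fin c) = Fin w" using c w by simp
    ultimately show ?thesis unfolding critical_values_def by (metis (mono_tags, lifting) mem_Collect_eq)
  qed
  show "Fin (qf a 0) \<in> critical_values ?F" by (rule *[of 0]) (simp_all add: quartic_Fin_eq_iff)
  show "Fin 1 \<in> critical_values ?F" using critical_pm1[OF a, of 1] * by metis
  show "Fin (- 1) \<in> critical_values ?F" using critical_pm1[OF a, of "- 1"] * by metis
qed

section \<open>From s-Cantor discs on the sphere to discs in the plane\<close>

lemma Fin_disc:
  assumes "D0 homeomorphic cball (0::complex) 1" "Infty \<notin> D0"
  obtains D where "D0 = Fin ` D" "D homeomorphic cball (0::complex) 1"
proof -
  define D where "D = Fin -` D0"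
  have e: "D0 = Fin ` D"
  proof
    show "D0 \<subseteq> Fin ` D"
    proof
      fix y assume y: "y \<in> D0"
      then obtain z where "y = Fin z" using assms(2) by (cases y) auto
      then show "y \<in> Fin ` D" using y by (auto simp: D_def)
    qed
  qed (auto simp: D_def)
  have "homeomorphism D (Fin ` D) Fin unFin"
    by (rule homeomorphism_of_subsets[OF homeomorphism_Fin]) auto
  then have "D homeomorphic D0" unfolding e homeomorphic_def by blast
  then show thesis using that[OF e] homeomorphic_trans[OF _ assms(1)] by blast
qed

lemma disc_of_s_Cantor2:
  assumes a: "a \<noteq> 0" and "s_Cantor (quartic a \<circ> quartic a)"
  obtains D where "disc a D"
proof -
  let ?F = "quartic a \<circ> quartic a"
  obtain D0 where D0: "D0 homeomorphic cball (0::complex) 1" "D0 \<inter> critical_values ?F = {}" "?F -` D0 \<subseteq> D0"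
    using assms(2) unfolding s_Cantor_def by blast
  have nc: "w \<notin> D0" if "w \<in> critical_values ?F" for w using D0(2) that by blast
  note cv = critical_values_quartic2[OF a, THEN nc]
  obtain D where D: "D0 = Fin ` D" "D homeomorphic cball (0::complex) 1" using Fin_disc[OF D0(1) cv(1)] .
  have "disc a D"
  proof
    show "z \<in> D" if "iter a 2 z \<in> Fin ` D" for z
    proof -
      have "?F (Fin z) \<in> D0" using that D(1) by (simp add: numeral_2_eq_2)
      then have "Fin z \<in> D0" using D0(3) by blast
      then show ?thesis using D(1) by auto
    qed
  qed (use a D cv in auto)
  then show thesis by (rule that)
qed

text \<open>A disc for one step also serves two steps, so everything proved for \<open>disc\<close>
  becomes available. The second image of 0 avoids it, as otherwise backward invariance would put the
  critical value \<open>qf a 0\<close> into it.\<close>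

lemma disc_of_s_Cantor:
  assumes a: "a \<noteq> 0" and "s_Cantor (quartic a)"
  obtains D where "disc a D" "\<And>z. quartic a (Fin z) \<in> Fin ` D \<Longrightarrow> z \<in> D"
proof -
  obtain D0 where D0: "D0 homeomorphic cball (0::complex) 1" "D0 \<inter> critical_values (quartic a) = {}" "quartic a -` D0 \<subseteq> D0"
    using assms(2) unfolding s_Cantor_def by blast
  have nc: "w \<notin> D0" if "w \<in> critical_values (quartic a)" for w using D0(2) that by blast
  note cv = critical_values_quartic[OF a, THEN nc]
  obtain D where D: "D0 = Fin ` D" "D homeomorphic cball (0::complex) 1" using Fin_disc[OF D0(1) cv(1)] .
  have bk: "y \<in> D0" if "quartic a y \<in> D0" for y using D0(3) that by blast
  have v: "quartic a (Fin 0) = Fin (qf a 0)" by (simp add: quartic_Fin_eq_iff)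
  have "disc a D"
  proof
    show "z \<in> D" if "iter a 2 z \<in> Fin ` D" for z
      using that bk[OF bk, of "Fin z"] D(1) by (auto simp: numeral_2_eq_2)
    show "iter a 2 0 \<notin> Fin ` D" using bk[of "Fin (qf a 0)"] cv(2) D(1) v by (auto simp: numeral_2_eq_2)
  qed (use a D cv in auto)
  moreover have "z \<in> D" if "quartic a (Fin z) \<in> Fin ` D" for z using bk[of "Fin z"] that D(1) by auto
  ultimately show thesis by (rule that)
qed

lemma postcritical_superset:
  assumes a: "a \<noteq> 0"
  shows "insert Infty (Fin ` postcrit a) \<subseteq> postcritical_set (quartic a)"
proof -
  have crit: "w \<in> postcritical_set (quartic a)" if "w \<in> critical_values (quartic a)" for w
    using that unfolding postcritical_set_def critical_values_def by (auto intro!: exI[of _ 1])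
  moreover have "Fin w \<in> postcritical_set (quartic a)" if "k > 0" "iter a k 0 = Fin w" for k w
    using that critical_point_even(1)[of "quartic a", OF quartic_minus] unfolding postcritical_set_def by (metis (mono_tags, lifting) mem_Collect_eq)
  ultimately show ?thesis using critical_values_quartic[OF a] unfolding postcrit_def by auto
qed

subsection \<open>Non-injectivity for every radial\<close>

context disc
begin

lemma radial_not_inj:
  assumes r: "radial 4 (quartic a) L"
  shows "coding_domain 4 (quartic a) L = symbol_space 4" "\<not> inj_on (coding_map (quartic a) L) (symbol_space 4)"
proof -
  obtain X where X: "\<And>i. i \<in> {1..4} \<Longrightarrow> pathstart (L i) = X" "\<And>i. i \<in> {1..4} \<Longrightarrow> quartic a (pathfinish (L i)) = X"
    and p: "\<And>i. i \<in> {1..4} \<Longrightarrow> path (L i)" "\<And>i. i \<in> {1..4} \<Longrightarrow> path_image (L i) \<subseteq> - postcritical_set (quartic a)"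
    using r unfolding radial_def by fastforce
  define l where "l i t = unFin (L i t)" for i t
  have nP: "L i t \<notin> insert Infty (Fin ` postcrit a)" if "i \<in> {1..4}" "t \<in> {0..1}" for i t
    using p(2)[OF that(1)] that(2) postcritical_superset[OF a0] unfolding path_image_def by blast
  have Ll: "L i t = Fin (l i t)" if "i \<in> {1..4}" "t \<in> {0..1}" for i t
    using nP[OF that] by (cases "L i t") (auto simp: l_def)
  have lPC: "l i t \<notin> postcrit a" if "i \<in> {1..4}" "t \<in> {0..1}" for i t
    using nP[OF that] Ll[OF that] by auto
  have op: "opath a (l i)" if i: "i \<in> {1..4}" for i
  proof -
    have "L i ` {0..1} \<subseteq> - {Infty}" using nP[OF i] unfolding image_subset_iff by auto
    then have "continuous_on {0..1} (\<lambda>t. unFin (L i t))"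
      by (rule continuous_on_compose2[OF continuous_on_unFin p(1)[OF i, unfolded path_def]])
    then show ?thesis using lPC[OF i] unfolding opath_def path_def path_image_def l_def by auto
  qed
  have "X = Fin (l 1 0)" using X(1)[of 1] Ll[of 1 0] by (simp add: pathstart_def)
  then obtain x where x: "X = Fin x" by blast
  interpret rad a D l x
  proof
    fix i :: nat assume i: "i \<in> {1..4}"
    show "opath a (l i)" by (rule op[OF i])
    show "pathstart (l i) = x" using X(1)[OF i] x Ll[OF i, of 0] by (simp add: pathstart_def)
    show "iter a 1 (pathfinish (l i)) = Fin x" using X(2)[OF i] x Ll[OF i, of 1] by (simp add: pathfinish_def)
  qed
  note cm = coding_map_eq[OF Ll]
  show "coding_domain 4 (quartic a) L = symbol_space 4"
    using cm(2) by (auto simp: coding_domain_def)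
  obtain s s' where "s \<in> symbol_space 4" "s' \<in> symbol_space 4" "s \<noteq> s'" "code s = code s'"
    using code_not_inj by blast
  then show "\<not> inj_on (coding_map (quartic a) L) (symbol_space 4)"
    using cm(1) unfolding inj_on_def by metis
qed

lemma not_t_Cantor: "\<not> t_Cantor 4 (quartic a)"
proof
  assume "t_Cantor 4 (quartic a)"
  then obtain L \<psi> where r: "radial 4 (quartic a) L"
    and h: "homeomorphism (symbol_space 4) (julia_set (quartic a)) (coding_map (quartic a) L) \<psi>"
    unfolding t_Cantor_def by blast
  have "inj_on (coding_map (quartic a) L) (symbol_space 4)"
    using h unfolding homeomorphism_def by (metis inj_on_inverseI)
  then show False using radial_not_inj(2)[OF r] by blast
qed

text \<open>All four branches now map \<open>D\<close> into itself, and a radial inside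
  \<open>D\<close> has all its lifts there. Its code satisfies
  \<open>code s = T (s 0) (code (\<sigma> s))\<close>: the map recovers the shifted sequence and the
  position in the fibre the first symbol. So the code is injective, against
  \<open>code_not_inj\<close>.\<close>

lemma not_backward_invariant_1:
  assumes bk: "\<And>z. quartic a (Fin z) \<in> Fin ` D \<Longrightarrow> z \<in> D"
  shows False
proof -
  have backn: "z \<in> D" if "iter a n z \<in> Fin ` D" for n z
    using that
  proof (induction n arbitrary: z)
    case (Suc n)
    obtain w where w: "quartic a (Fin z) = Fin w"
      using Suc.prems by (cases "quartic a (Fin z)") (auto simp: funpow_Suc_right simp del: funpow.simps)
    then have "iter a n w \<in> Fin ` D" using Suc.prems by (simp add: funpow_Suc_right del: funpow.simps)
    then have "w \<in> D" by (rule Suc.IH)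
    then show ?case using bk w by auto
  qed auto
  have nPC: "z \<notin> postcrit a" if "z \<in> D" for z using postcrit_D that by blast
  then have avoid: "z \<noteq> 1 \<and> z \<noteq> - 1 \<and> z \<noteq> qf a 0" if "z \<in> D" for z
    using that pm1_postcrit qf_0_postcrit by metis
  obtain T :: "nat \<Rightarrow> complex \<Rightarrow> complex" where T: "\<And>i. lifts a 1 D (\<lambda>z. z) (T i)"
    "\<And>z. z \<in> D \<Longrightarrow> bij_betw (\<lambda>i. T i z) {1..4} {w. quartic a (Fin w) = Fin z}"
    using four_lifts[OF a0 contractible_D, of "\<lambda>z. z"] avoid by (metis continuous_on_id)
  have TD: "T i z \<in> D" if "z \<in> D" for i z
    using liftsD[OF T(1) that, of i] that bk by auto
  obtain x where x: "x \<in> D" using D_dense_interior by blast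
  have "path_connected D"
    using homeomorphic_path_connectedness[OF Dh] by (simp add: convex_imp_path_connected)
  then have "\<exists>g. path g \<and> path_image g \<subseteq> D \<and> pathstart g = x \<and> pathfinish g = T i x" for i
    using x TD[OF x] unfolding path_connected_def by blast
  then obtain l where lg: "\<And>i. path (l i)" "\<And>i. path_image (l i) \<subseteq> D" "\<And>i. pathstart (l i) = x"
    "\<And>i. pathfinish (l i) = T i x" by metis
  interpret rad a D l x
  proof
    fix i :: nat
    show "opath a (l i)" using lg(1,2) nPC unfolding opath_def by blast
    show "iter a 1 (pathfinish (l i)) = Fin x" using liftsD[OF T(1) x] lg(4) by simp
  qed (rule lg)
  \<comment> \<open>The lift never leaves \<open>D\<close>, so applying the branch
    \<open>T k\<close> to it yields a lift under one step more.\<close>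
  have lift_end_D: "lift_end n (l i) z \<in> D \<and> lift_end (Suc n) (l i) (T k z) = T k (lift_end n (l i) z)"
    if i: "i \<in> {1..4}" and z: "iter a n z = Fin x" for n i k z
  proof -
    obtain \<delta> where \<delta>: "lifts a n {0..1} (l i) \<delta>" "\<delta> 0 = z" "\<delta> 1 = lift_end n (l i) z"
      using lift_end_l[OF i z] unfolding lift_ends_def by blast
    have \<delta>D: "\<delta> t \<in> D" if "t \<in> {0..1}" for t
      using backn[of n "\<delta> t"] liftsD[OF \<delta>(1) that] lg(2)[of i] that unfolding path_image_def by (metis imageI subsetD)
    then have sub: "\<delta> ` {0..1} \<subseteq> D" by blast
    have "lifts a 1 {0..1} \<delta> (\<lambda>t. T k (\<delta> t))"
      using lifts_precomp[OF T(1) lifts_cont[OF \<delta>(1)] sub] by simp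
    then have "lifts a (n + 1) {0..1} (l i) (\<lambda>t. T k (\<delta> t))" using lifts_compose[OF \<delta>(1)] by blast
    then have "lift_ends a (Suc n) (l i) (T k z) (T k (lift_end n (l i) z))"
      unfolding lift_ends_def using \<delta>(2,3) by (intro exI[of _ "\<lambda>t. T k (\<delta> t)"]) simp
    moreover have "opath a (l i)" using lg(1,2) nPC unfolding opath_def by blast
    ultimately show ?thesis using lift_end_eq \<delta>D[of 1] \<delta>(3) by simp
  qed
  have word_end_T: "word_end n w z \<in> D \<and> word_end (Suc n) w (T k z) = T k (word_end n w z)"
    if "set w \<subseteq> {1..4}" "iter a n z = Fin x" "z \<in> D" for n w z k
    using that
  proof (induction w arbitrary: n z)
    case (Cons i w)
    have i: "i \<in> {1..4}" using Cons.prems by simp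
    show ?case using Cons.IH[OF _ lift_end_fibre(2)[OF i Cons.prems(2)]] lift_end_D[OF i Cons.prems(2)] Cons.prems by simp
  qed simp
  define \<sigma> where "\<sigma> s n = s (Suc n)" for s :: "nat \<Rightarrow> nat" and n
  have \<sigma>: "\<sigma> s \<in> symbol_space 4" if "s \<in> symbol_space 4" for s using that by (simp add: \<sigma>_def symbol_space_def)
  have ZD: "Z s k \<in> D" "Z s (Suc k) = T (s 0) (Z (\<sigma> s) k)" if s: "s \<in> symbol_space 4" for s k
  proof -
    show "Z s k \<in> D" using word_end_T[OF symbol_words[OF s], of 0 x] x by (simp add: Z_def)
    have "s 0 \<in> {1..4}" using s by (simp add: symbol_space_def)
    then have "lift_end 0 (l (s 0)) x = T (s 0) x" using lift_end_0 lg(4) by simp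
    moreover have "map s [0..<Suc k] = s 0 # map (\<sigma> s) [0..<k]" unfolding map_upt_Suc \<sigma>_def ..
    ultimately have "Z s (Suc k) = word_end (Suc 0) (map (\<sigma> s) [0..<k]) (T (s 0) x)" by (simp add: Z_def del: upt_Suc)
    then show "Z s (Suc k) = T (s 0) (Z (\<sigma> s) k)"
      using word_end_T[OF symbol_words[OF \<sigma>[OF s]], of 0 x] x by (simp add: Z_def)
  qed
  have codeD: "code s \<in> D" if "s \<in> symbol_space 4" for s
    using Z_tendsto[OF that] ZD(1)[OF that] compact_imp_closed[OF compact_D] unfolding closed_sequential_limits by blast
  have code_T: "code s = T (s 0) (code (\<sigma> s))" if s: "s \<in> symbol_space 4" for s
  proof -
    have "(\<lambda>k. T (s 0) (Z (\<sigma> s) k)) \<longlonglongrightarrow> T (s 0) (code (\<sigma> s))"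
      using continuous_on_tendsto_compose[OF lifts_cont[OF T(1)] Z_tendsto[OF \<sigma>[OF s]] codeD[OF \<sigma>[OF s]]] ZD(1)[OF \<sigma>[OF s]] by simp
    moreover have "(\<lambda>k. Z s (Suc k)) \<longlonglongrightarrow> code s" using Z_tendsto[OF s] by (rule LIMSEQ_Suc)
    ultimately show ?thesis unfolding ZD(2)[OF s] by (rule LIMSEQ_unique[symmetric, THEN sym, rotated])
  qed
    have *: "code (\<sigma> s) = code (\<sigma> s') \<and> s 0 = s' 0" if s: "s \<in> symbol_space 4" "s' \<in> symbol_space 4" "code s = code s'" for s s'
    proof -
      have e: "quartic a (Fin (code s)) = Fin (code (\<sigma> s))" if "s \<in> symbol_space 4" for s
        using liftsD[OF T(1) codeD[OF \<sigma>[OF that]]] code_T[OF that] by simp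
      have c: "code (\<sigma> s) = code (\<sigma> s')" using e[OF s(1)] e[OF s(2)] s(3) by simp
      have "T (s 0) (code (\<sigma> s)) = T (s' 0) (code (\<sigma> s))" using code_T[OF s(1)] code_T[OF s(2)] s(3) c by simp
      then have "s 0 = s' 0"
        using inj_onD[OF bij_betw_imp_inj_on[OF T(2)[OF codeD[OF \<sigma>[OF s(1)]]]]] s(1,2) by (simp add: symbol_space_def)
      then show ?thesis using c by simp
    qed
  have "s n = s' n" if "s \<in> symbol_space 4" "s' \<in> symbol_space 4" "code s = code s'" for n s s'
    using that
  proof (induction n arbitrary: s s')
    case 0
    then show ?case using * by blast
  next
    case (Suc n)
    have "\<sigma> s n = \<sigma> s' n" using Suc.IH[OF \<sigma> \<sigma>] * Suc.prems by blast
    then show ?case by (simp add: \<sigma>_def)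
  qed
  then show False using code_not_inj by (metis ext)
qed

end

lemma not_s_Cantor_quartic: "a \<noteq> 0 \<Longrightarrow> \<not> s_Cantor (quartic a)"
  using disc_of_s_Cantor disc.not_backward_invariant_1 by metis


subsection \<open>An invariant disc for large parameters\<close>

lemma critical_values_quartic2_Fin:
  assumes a: "a \<noteq> 0" and w: "Fin w \<in> critical_values (quartic a \<circ> quartic a)"
  shows "w = 1 \<or> w = - 1 \<or> w = qf a 0 \<or> w = qf a (qf a 0)"
proof -
  let ?F = "quartic a \<circ> quartic a"
  obtain y where y: "critical_point ?F y" "Fin w = ?F y" using w unfolding critical_values_def by blast
  have "quartic a (quartic a y) = Fin w" using y(2) by simp
  then obtain z1 where z1: "quartic a y = Fin z1" "z1\<^sup>2 \<noteq> 1" "w = qf a z1" unfolding quartic_eq_Fin_iff by blast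
  then obtain z where z: "y = Fin z" "z\<^sup>2 \<noteq> 1" "z1 = qf a z" unfolding quartic_eq_Fin_iff by blast
  have half: "qf a t = 1 \<or> qf a t = - 1" if "2 * (a * (t\<^sup>2 - 1)) = 1 \<or> 2 * (a * (t\<^sup>2 - 1)) = - 1" for t
  proof -
    define u where "u = a * (t\<^sup>2 - 1)"
    have "qf a t = u + 1 / (4 * u)" by (simp add: qf_def u_def mult.assoc)
    moreover have "u = 1 / 2 \<Longrightarrow> u + 1 / (4 * u) = 1" "u = - (1 / 2) \<Longrightarrow> u + 1 / (4 * u) = - 1"
      by (simp_all only:) simp_all
    moreover have "u = 1 / 2 \<or> u = - (1 / 2)" using that unfolding u_def[symmetric] by (auto simp: field_simps)
    ultimately show ?thesis by metis
  qed
  have "qf' a z = 0 \<or> qf' a z1 = 0"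
    using critical_quartic2[OF a z(2)] z1(2) y(1) unfolding z(1,3) by blast
  then show ?thesis
  proof
    assume "qf' a z = 0"
    then have "z = 0 \<or> z1 = 1 \<or> z1 = - 1" using half[of z] qf'_zero_iff[OF a z(2)] z(3) by auto
    then show ?thesis using z1 z(3) by auto
  next
    assume "qf' a z1 = 0"
    then show ?thesis using half[of z1] qf'_zero_iff[OF a z1(2)] z1(3) by auto
  qed
qed

text \<open>The wedge for \<open>q\<close> has its tip at \<open>p + (1 - \<kappa>) * q\<close> and
  opens away from \<open>p\<close>, so its removal leaves a set that is star-shaped about
  \<open>p\<close>. Scaling by 2 makes the unit ball fit inside, since the tips have modulus at
  least 1/2.\<close>

lemma wedge_disc:
  fixes Q :: "complex set"
  assumes Q: "finite Q" "\<And>q. q \<in> Q \<Longrightarrow> cmod q \<ge> 1" and \<kappa>: "0 < \<kappa>" "\<kappa> \<le> 1 / 2"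
  shows "{z. cmod (z - p) \<le> 3 \<and> (\<forall>q\<in>Q. \<bar>Im ((z - p) / q)\<bar> \<ge> (Re ((z - p) / q) - (1 - \<kappa>)) / 24)}
    homeomorphic cball (0::complex) 1"
proof -
  define S where "S = {y. cmod y \<le> 6 \<and> (\<forall>q\<in>Q. \<bar>Im (y / (2 * q))\<bar> \<ge> (Re (y / (2 * q)) - (1 - \<kappa>)) / 24)}"
  define O' where "O' = {y. cmod y < 6 \<and> (\<forall>q\<in>Q. \<bar>Im (y / (2 * q))\<bar> > (Re (y / (2 * q)) - (1 - \<kappa>)) / 24)}"
  have q0: "q \<noteq> 0" if "q \<in> Q" for q using Q(2)[OF that] by auto
  have "S = cball 0 6 \<inter> (\<Inter>q\<in>Q. {y. \<bar>Im (y / (2 * q))\<bar> \<ge> (Re (y / (2 * q)) - (1 - \<kappa>)) / 24})"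
    by (auto simp: S_def)
  moreover have "closed (\<Inter>q\<in>Q. {y. \<bar>Im (y / (2 * q))\<bar> \<ge> (Re (y / (2 * q)) - (1 - \<kappa>)) / 24})"
    by (intro closed_INT ballI closed_Collect_le continuous_intros) (use q0 in auto)
  ultimately have S: "compact S" by (simp add: compact_Int_closed)
  have "O' = ball 0 6 \<inter> (\<Inter>q\<in>Q. {y. \<bar>Im (y / (2 * q))\<bar> > (Re (y / (2 * q)) - (1 - \<kappa>)) / 24})"
    by (auto simp: O'_def)
  moreover have "open (\<Inter>q\<in>Q. {y. \<bar>Im (y / (2 * q))\<bar> > (Re (y / (2 * q)) - (1 - \<kappa>)) / 24})"
    by (intro open_INT Q(1) ballI open_Collect_less continuous_intros) (use q0 in auto)
  ultimately have O': "open O'" by (simp add: open_Int)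
  have "O' \<subseteq> S" unfolding O'_def S_def by fastforce
  then have OI: "O' \<subseteq> interior S" using O' by (simp add: interior_maximal)
  have "S homeomorphic cball (0::complex) 1"
  proof (rule starlike_compact_projective_special[OF S])
    show "cball 0 1 \<subseteq> S"
    proof
      fix y :: complex assume y: "y \<in> cball 0 1"
      have "(Re (y / (2 * q)) - (1 - \<kappa>)) / 24 \<le> \<bar>Im (y / (2 * q))\<bar>" if "q \<in> Q" for q
      proof -
        have "cmod (y / (2 * q)) \<le> 1 / 2"
          using y Q(2)[OF that] by (simp add: norm_divide norm_mult divide_le_eq)
        then have "Re (y / (2 * q)) \<le> 1 / 2" using complex_Re_le_cmod order_trans by blast
        then have "(Re (y / (2 * q)) - (1 - \<kappa>)) / 24 \<le> 0" using \<kappa> by simp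
        then show ?thesis by (rule order_trans) (rule abs_ge_zero)
      qed
      then show "y \<in> S" using y by (auto simp: S_def)
    qed
    fix y :: complex and t :: real assume y: "y \<in> S" and t: "0 \<le> t" "t < 1"
    have "cmod (t *\<^sub>R y) < 6"
    proof -
      have "t * cmod y \<le> t * 6" using y t by (intro mult_left_mono) (auto simp: S_def)
      then show ?thesis using t by simp
    qed
    \<comment> \<open>Shrinking towards 0 makes the inequality strict because
      \<open>1 - \<kappa>\<close> is positive and is not shrunk along with \<open>y\<close>.\<close>
    moreover have "\<bar>Im (t *\<^sub>R y / (2 * q))\<bar> > (Re (t *\<^sub>R y / (2 * q)) - (1 - \<kappa>)) / 24" if "q \<in> Q" for q
    proof -
      define X where "X = y / (2 * q)"
      have X: "t *\<^sub>R y / (2 * q) = of_real t * X" by (simp add: X_def scaleR_conv_of_real)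
      have "(Re X - (1 - \<kappa>)) / 24 \<le> \<bar>Im X\<bar>" using y that by (auto simp: S_def X_def)
      then have "t * ((Re X - (1 - \<kappa>)) / 24) \<le> t * \<bar>Im X\<bar>" using t by (intro mult_left_mono)
      moreover have "t * (1 - \<kappa>) < 1 - \<kappa>" using t \<kappa> by simp
      ultimately show ?thesis unfolding X using t by (simp add: abs_mult right_diff_distrib)
    qed
    ultimately have "t *\<^sub>R y \<in> O'" by (simp add: O'_def)
    then have "t *\<^sub>R y \<in> interior S" using OI by blast
    then show "t *\<^sub>R y \<in> S - frontier S" using interior_subset by (auto simp: frontier_def)
  qed
  moreover have "{z. cmod (z - p) \<le> 3 \<and> (\<forall>q\<in>Q. \<bar>Im ((z - p) / q)\<bar> \<ge> (Re ((z - p) / q) - (1 - \<kappa>)) / 24)}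
      = (\<lambda>y. p + (1 / 2) *\<^sub>R y) ` S" (is "?L = _")
  proof
    show "?L \<subseteq> (\<lambda>y. p + (1 / 2) *\<^sub>R y) ` S"
    proof
      fix z assume z: "z \<in> ?L"
      have "2 * (z - p) / (2 * q) = (z - p) / q" for q by (simp del: right_diff_distrib_numeral)
      then have "2 * (z - p) \<in> S" using z by (simp add: S_def norm_mult del: right_diff_distrib_numeral)
      moreover have "z = p + (1 / 2) *\<^sub>R (2 * (z - p))" by (simp add: scaleR_conv_of_real del: right_diff_distrib_numeral)
      ultimately show "z \<in> (\<lambda>y. p + (1 / 2) *\<^sub>R y) ` S" by blast
    qed
    show "(\<lambda>y. p + (1 / 2) *\<^sub>R y) ` S \<subseteq> ?L"
    proof
      fix z assume "z \<in> (\<lambda>y. p + (1 / 2) *\<^sub>R y) ` S"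
      then obtain y where y: "y \<in> S" "z = p + (1 / 2) *\<^sub>R y" by blast
      have "(z - p) / q = y / (2 * q)" for q by (simp add: y(2) scaleR_conv_of_real)
      moreover have "cmod (z - p) = cmod y / 2" by (simp add: y(2))
      ultimately show "z \<in> ?L" using y(1) by (simp add: S_def)
    qed
  qed
  moreover have "S homeomorphic (\<lambda>y. p + (1 / 2) *\<^sub>R y) ` S" by (rule homeomorphic_affinity) simp
  then have "(\<lambda>y. p + (1 / 2) *\<^sub>R y) ` S homeomorphic S" by (rule homeomorphic_sym[THEN iffD1])
  ultimately show ?thesis using homeomorphic_trans[of "(\<lambda>y. p + (1 / 2) *\<^sub>R y) ` S" S "cball (0::complex) 1"] by simp
qed

lemma root_bound:
  assumes "u\<^sup>2 - w * u + 1/4 = 0" "cmod w \<le> W" "W \<ge> 0"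
  shows "cmod u \<le> W + 1"
proof (cases "cmod u \<le> 1")
  case False
  then have u: "u \<noteq> 0" and inv: "cmod (1 / (4 * u)) \<le> 1" by (auto simp: norm_divide norm_mult divide_le_eq)
  have "u * (u - (w - 1 / (4 * u))) = u\<^sup>2 - w * u + 1/4" using u by (simp add: algebra_simps power2_eq_square)
  then have "u = w - 1 / (4 * u)" using assms(1) u by simp
  then have "cmod u \<le> cmod w + cmod (1 / (4 * u))" by (metis norm_triangle_ineq4)
  then show ?thesis using inv assms(2) by linarith
qed (use assms in linarith)

lemma sum_ge_one: "\<exists>e\<in>{1, - 1}. cmod (z + e) \<ge> 1"
proof (rule ccontr)
  assume "\<not> ?thesis"
  then have "cmod (z + 1) < 1" "cmod (z + - 1) < 1" by auto
  then have "cmod ((z + 1) - (z + - 1)) < 2" using norm_triangle_ineq4[of "z + 1" "z + - 1"] by linarith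
  then show False by simp
qed

text \<open>For bounded \<open>w\<close> the first preimage \<open>z1\<close> is close to some
  \<open>s = \<plusminus>1\<close>. Then \<open>u\<close> is close to the double root
  \<open>s / 2\<close>, and \<open>a * (z - e) * (z + e) = u\<close> with \<open>z + e\<close> near
  \<open>2 * e\<close> puts \<open>z\<close> near \<open>e + s * e / (4 * a)\<close>.\<close>

lemma second_preimages:
  assumes a: "cmod a \<ge> 100000" and f: "quartic a (Fin z) = Fin z1" "quartic a (Fin z1) = Fin w" and w: "cmod w \<le> 4"
  obtains e \<sigma> where "e \<in> {1, - 1}" "\<sigma> \<in> {1, - 1 :: complex}" "cmod (4 * a * (z - e) - \<sigma>) \<le> 1 / 8" "cmod (z - e) \<le> 1 / 4"
proof -
  have a0: "a \<noteq> 0" using a by auto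
  have inv_a: "1 / cmod a \<le> 1 / 100000" using a frac_le[of 1 1 100000 "cmod a"] by simp
  define u1 where "u1 = a * (z1\<^sup>2 - 1)"
  have "u1\<^sup>2 - w * u1 + 1/4 = 0" using f(2) unfolding qf_eq_iff[OF a0] Let_def u1_def .
  from root_bound[OF this w] have u1: "cmod u1 \<le> 5" by simp
  obtain s where s: "s \<in> {1, - 1}" "cmod (z1 + s) \<ge> 1" using sum_ge_one by blast
  have s2: "s * s = 1" using s(1) by auto
  have near: "cmod (z1 - s) \<le> 5 / cmod a"
  proof -
    have "a * ((z1 - s) * (z1 + s)) = u1" using s2 by (simp add: u1_def algebra_simps power2_eq_square)
    then have "cmod a * (cmod (z1 - s) * cmod (z1 + s)) = cmod u1" by (metis norm_mult)
    moreover have "cmod (z1 - s) * 1 \<le> cmod (z1 - s) * cmod (z1 + s)" using s(2) by (intro mult_left_mono) auto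
    then have "cmod a * cmod (z1 - s) \<le> cmod a * (cmod (z1 - s) * cmod (z1 + s))" by (intro mult_left_mono) auto
    ultimately have "cmod a * cmod (z1 - s) \<le> 5" using u1 by simp
    then show ?thesis using a0 by (simp add: field_simps)
  qed
  have near': "cmod (z1 - s) \<le> 5 / 100000" using near inv_a by simp
  have "cmod s = 1" using s(1) by auto
  then have z1: "cmod z1 \<le> 2" using near' norm_triangle_sub[of z1 s] by simp
  define u where "u = a * (z\<^sup>2 - 1)"
  have ur: "u\<^sup>2 - z1 * u + 1/4 = 0" using f(1) unfolding qf_eq_iff[OF a0] Let_def u_def .
  from root_bound[OF this z1] have u: "cmod u \<le> 3" by simp
  \<comment> \<open>A double root is controlled only through a square. Here the size of
    \<open>a\<close> matters most: \<open>60 / 100000\<close> has to stay below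
    \<open>(1 / 32)\<^sup>2\<close>.\<close>
  have "(2 * u - s)\<^sup>2 = 4 * (u\<^sup>2 - z1 * u + 1/4) + 4 * u * (z1 - s) + (s * s - 1)" by (simp add: algebra_simps power2_eq_square)
  then have "(2 * u - s)\<^sup>2 = 4 * u * (z1 - s)" using ur s2 by simp
  then have "(cmod (2 * u - s))\<^sup>2 = 4 * cmod u * cmod (z1 - s)" by (metis norm_mult norm_numeral norm_power)
  also have "\<dots> \<le> 4 * 3 * (5 / 100000)" using u near' by (intro mult_mono) auto
  also have "\<dots> \<le> (1 / 32)\<^sup>2" by (simp add: power2_eq_square)
  finally have us: "cmod (2 * u - s) \<le> 1 / 32" by (rule power2_le_imp_le) simp
  obtain e where e: "e \<in> {1, - 1}" "cmod (z + e) \<ge> 1" using sum_ge_one by blast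
  have e2: "e * e = 1" using e(1) by auto
  have ze: "a * ((z - e) * (z + e)) = u" using e2 by (simp add: u_def algebra_simps power2_eq_square)
  have \<nu>: "cmod (z - e) \<le> 3 / 100000"
  proof -
    have "cmod a * (cmod (z - e) * cmod (z + e)) = cmod u" using ze by (metis norm_mult)
    moreover have "cmod (z - e) * 1 \<le> cmod (z - e) * cmod (z + e)" using e(2) by (intro mult_left_mono) auto
    then have "100000 * cmod (z - e) \<le> cmod a * (cmod (z - e) * cmod (z + e))" using a by (intro mult_mono) auto
    ultimately show ?thesis using u by simp
  qed
  have "(4 * a * (z - e) - s * e) * (z + e) = 4 * (a * ((z - e) * (z + e))) - s * e * ((z - e) + 2 * e)"
    by (simp add: algebra_simps)
  also have "\<dots> = 2 * (2 * u - s) - s * e * (z - e)" using e2 unfolding ze by (simp add: algebra_simps)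
  finally have id: "(4 * a * (z - e) - s * e) * (z + e) = 2 * (2 * u - s) - s * e * (z - e)" .
  have "cmod (4 * a * (z - e) - s * e) * 1 \<le> cmod (4 * a * (z - e) - s * e) * cmod (z + e)"
    using e(2) by (intro mult_left_mono) auto
  also have "\<dots> = cmod (2 * (2 * u - s) - s * e * (z - e))" unfolding id[symmetric] norm_mult ..
  also have "\<dots> \<le> cmod (2 * (2 * u - s)) + cmod (s * e * (z - e))" by (rule norm_triangle_ineq4)
  also have "cmod (2 * (2 * u - s)) = 2 * cmod (2 * u - s)" by (simp only: norm_mult norm_numeral)
  also have "cmod (s * e * (z - e)) = cmod (z - e)" using s(1) e(1) unfolding norm_mult by auto
  also have "2 * cmod (2 * u - s) + cmod (z - e) \<le> 1 / 8" using us \<nu> by simp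
  finally have "cmod (4 * a * (z - e) - s * e) \<le> 1 / 8" by simp
  moreover have "s * e \<in> {1, - 1}" using s(1) e(1) by auto
  ultimately show thesis using that[of e "s * e"] e(1) \<nu> by simp
qed

text \<open>The wedges are cut out so that their axes point away from \<open>p\<close>; \<open>p\<close> is chosen such that the
  directions \<open>\<plusminus>1 / a\<close> are not close to these axes.\<close>

lemma wedge_direction:
  assumes a: "a \<noteq> (0::complex)"
  obtains p :: complex where "p = 0 \<or> p = \<i>" "\<And>e. e \<in> {1, - 1} \<Longrightarrow> \<bar>Im (1 / (4 * a * (e - p)))\<bar> \<ge> cmod (1 / (4 * a * (e - p))) / 4"
proof -
  define b where "b = 1 / (4 * a)"
  have eq: "1 / (4 * a * (e - p)) = b / (e - p)" for e p by (simp add: b_def)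
  show thesis
  proof (cases "\<bar>Im b\<bar> \<ge> cmod b / 4")
    case True
    then have "\<bar>Im (b / (e - 0))\<bar> \<ge> cmod (b / (e - 0)) / 4" if "e \<in> {1, - 1}" for e using that by auto
    then show thesis using that[of 0] unfolding eq by blast
  next
    case False
    have bb: "(cmod b)\<^sup>2 = (Re b)\<^sup>2 + (Im b)\<^sup>2" by (simp add: cmod_power2)
    have "\<bar>Re b\<bar> \<ge> 3 / 4 * cmod b" using cmod_le[of b] False by linarith
    then have im: "\<bar>Re b\<bar> - \<bar>Im b\<bar> \<ge> cmod b / 2" using False by linarith
    \<comment> \<open>In this case \<open>b\<close> is nearly real, and division by
      \<open>e - \<i>\<close> rotates it by an odd multiple of 45 degrees.\<close>
    have "\<bar>Im (b / (e - \<i>))\<bar> \<ge> cmod (b / (e - \<i>)) / 4" if e: "e \<in> {1, - 1}" for e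
    proof -
      have n: "(cmod (e - \<i>))\<^sup>2 = 2" using e by (auto simp: cmod_power2)
      then have n1: "cmod (e - \<i>) \<ge> 1" by (metis norm_ge_zero not_le one_le_numeral power_le_one order.trans less_imp_le one_less_numeral_iff semiring_norm(76) not_less)
      have "Im (b / (e - \<i>)) = (Re e * Im b + Re b) / 2"
        using e by (auto simp: Im_divide power2_eq_square)
      then have "\<bar>Im (b / (e - \<i>))\<bar> \<ge> (\<bar>Re b\<bar> - \<bar>Im b\<bar>) / 2" using e by auto
      then have "\<bar>Im (b / (e - \<i>))\<bar> \<ge> cmod b / 4" using im by simp
      moreover have "cmod (b / (e - \<i>)) \<le> cmod b" using n1 by (simp add: norm_divide divide_le_eq mult_le_cancel_left1)
      ultimately show ?thesis by linarith
    qed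
    then show thesis using that[of \<i>] unfolding eq by blast
  qed
qed

text \<open>In the coordinate \<open>(z - p) / (e - p)\<close> the critical value \<open>e\<close>
  is 1 and lies in a wedge with tip \<open>1 - \<kappa>\<close>, whereas the second preimages near
  \<open>e\<close> cluster at \<open>1 \<plusminus> \<beta>\<close> with
  \<open>\<beta> = 1 / (4 * a * (e - p))\<close>. The choice of \<open>p\<close> keeps \<beta> away
  from the real axis, so narrow wedges miss the clusters.\<close>

lemma s_Cantor_quartic2:
  assumes a: "cmod a \<ge> 100000"
  shows "s_Cantor (quartic a \<circ> quartic a)"
proof -
  let ?F = "quartic a \<circ> quartic a"
  have a0: "a \<noteq> 0" using a by auto
  obtain p :: complex where p: "p = 0 \<or> p = \<i>" and dir: "\<And>e. e \<in> {1, - 1} \<Longrightarrow> \<bar>Im (1 / (4 * a * (e - p)))\<bar> \<ge> cmod (1 / (4 * a * (e - p))) / 4"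
    using wedge_direction[OF a0] by blast
  define Q where "Q = (\<lambda>e. e - p) ` {1, - 1}"
  \<comment> \<open>Chosen below the modulus of \<beta>, which is at least
    \<open>1 / (8 * cmod a)\<close> as \<open>cmod (e - p) \<le> 2\<close>.\<close>
  define \<kappa> where "\<kappa> = 1 / (16 * cmod a)"
  have \<kappa>: "0 < \<kappa>" "\<kappa> \<le> 1 / 2"
    using a a0 by (auto simp: \<kappa>_def divide_le_eq)
  define D where "D = {z. cmod (z - p) \<le> 3 \<and> (\<forall>q\<in>Q. \<bar>Im ((z - p) / q)\<bar> \<ge> (Re ((z - p) / q) - (1 - \<kappa>)) / 24)}"
  have cq: "1 \<le> cmod (e - p)" "cmod (e - p) \<le> 2" if "e \<in> {1, - 1}" for e
  proof -
    have "(cmod (e - p))\<^sup>2 = 1 \<or> (cmod (e - p))\<^sup>2 = 2" using that p by (auto simp: cmod_power2)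
    then show "1 \<le> cmod (e - p)" "cmod (e - p) \<le> 2"
      using power2_le_imp_le[of 1 "cmod (e - p)"] power2_le_imp_le[of "cmod (e - p)" 2] by auto
  qed
  have Dh: "D homeomorphic cball (0::complex) 1"
    unfolding D_def by (rule wedge_disc) (use cq \<kappa> in \<open>auto simp: Q_def\<close>)
  have cp: "cmod p \<le> 1" using p by auto
  have D4: "cmod z \<le> 4" if "z \<in> D" for z
    using that cp norm_triangle_sub[of z p] by (auto simp: D_def)
  have De: "e \<notin> D" if "e \<in> {1, - 1}" for e
  proof
    assume "e \<in> D"
    moreover have "e - p \<in> Q" using that by (auto simp: Q_def)
    ultimately have "(Re ((e - p) / (e - p)) - (1 - \<kappa>)) / 24 \<le> \<bar>Im ((e - p) / (e - p))\<bar>" unfolding D_def by blast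
    moreover have "e - p \<noteq> 0" using cq[OF that] by auto
    ultimately show False using \<kappa> by simp
  qed
  have esc: "escR a \<le> 3" using a a0 by (simp add: escR_def divide_le_eq)
  have v: "cmod (qf a 0) \<ge> 5"
  proof -
    have "cmod (1 / (4 * a)) \<le> 1" using a by (simp add: norm_divide norm_mult divide_le_eq)
    moreover have "qf a 0 = - a - 1 / (4 * a)" by (simp add: qf_def)
    moreover have "cmod (- a - 1 / (4 * a)) \<ge> cmod (- a) - cmod (1 / (4 * a))" by (rule norm_triangle_ineq2)
    ultimately show ?thesis using a by simp
  qed
  then have fv: "cmod (qf a (qf a 0)) \<ge> 5" using qf_growth[OF a0, of "qf a 0"] esc by simp
  have "z \<in> D" if F: "?F (Fin z) \<in> Fin ` D" for z
  proof -
    obtain w where w: "?F (Fin z) = Fin w" "w \<in> D" using F by blast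
    then obtain z1 where f: "quartic a (Fin z) = Fin z1" "quartic a (Fin z1) = Fin w"
      by (cases "quartic a (Fin z)") auto
    obtain e \<sigma> where e: "e \<in> {1, - 1}" and \<sigma>: "\<sigma> \<in> {1, - 1 :: complex}"
      and 1: "cmod (4 * a * (z - e) - \<sigma>) \<le> 1 / 8" and 2: "cmod (z - e) \<le> 1 / 4"
      using second_preimages[OF a f D4[OF w(2)]] .
    have ce: "cmod e = 1" using e by auto
    have "cmod (z - p) \<le> 3"
      using 2 ce cp norm_triangle_ineq4[of "z - e" "p - e"] norm_triangle_ineq4[of p e] by simp
    moreover have "(Re ((z - p) / (e' - p)) - (1 - \<kappa>)) / 24 \<le> \<bar>Im ((z - p) / (e' - p))\<bar>" if e': "e' \<in> {1, - 1}" for e'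
    proof (cases "e' = e")
      case True
      define \<beta> where "\<beta> = 1 / (4 * a * (e - p))"
      define X where "X = (4 * a * (z - e)) * \<beta>"
      have ep: "e - p \<noteq> 0" using cq(1)[OF e] by auto
      have zX: "(z - p) / (e' - p) = 1 + X" using ep a0 True by (simp add: X_def \<beta>_def field_simps)
      define \<theta> where "\<theta> = 4 * a * (z - e) - \<sigma>"
      have X: "X = \<sigma> * \<beta> + \<theta> * \<beta>" by (simp add: X_def \<theta>_def algebra_simps)
      have t: "cmod (\<theta> * \<beta>) \<le> cmod \<beta> / 8" using 1 mult_right_mono[of "cmod \<theta>" "1 / 8" "cmod \<beta>"] by (simp add: \<theta>_def norm_mult)
      have "\<bar>Im (\<sigma> * \<beta>)\<bar> = \<bar>Im \<beta>\<bar>" using \<sigma> by auto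
      then have im: "\<bar>Im X\<bar> \<ge> cmod \<beta> / 4 - cmod \<beta> / 8"
      proof -
        have "Im X = Im (\<sigma> * \<beta>) + Im (\<theta> * \<beta>)" unfolding X by (simp only: plus_complex.sel)
        then show ?thesis
          using dir[OF e] t abs_Im_le_cmod[of "\<theta> * \<beta>"] \<open>\<bar>Im (\<sigma> * \<beta>)\<bar> = \<bar>Im \<beta>\<bar>\<close> unfolding \<beta>_def[symmetric] by linarith
      qed
      have "cmod (\<sigma> * \<beta>) = cmod \<beta>" using \<sigma> by auto
      then have re: "Re X \<le> cmod \<beta> + cmod \<beta> / 8"
        using t complex_Re_le_cmod[of "\<sigma> * \<beta>"] complex_Re_le_cmod[of "\<theta> * \<beta>"] unfolding X by simp
      have "\<kappa> \<le> cmod \<beta>"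
      proof -
        have "4 * cmod a * cmod (e - p) \<le> 16 * cmod a" using cq(2)[OF e] mult_left_mono[of "cmod (e - p)" 4 "4 * cmod a"] by simp
        moreover have "cmod \<beta> = 1 / (4 * cmod a * cmod (e - p))" by (simp add: \<beta>_def norm_divide norm_mult)
        moreover have "4 * cmod a * cmod (e - p) > 0" using a0 ep by simp
        ultimately show ?thesis unfolding \<kappa>_def by (simp only:) (rule frac_le; simp)
      qed
      \<comment> \<open>\<open>Im X\<close> has absolute value at least
        \<open>cmod \<beta> / 8\<close>, and \<open>Re X + \<kappa>\<close> is at most
        \<open>3 * cmod \<beta>\<close>; this accounts for the slope 1/24.\<close>
      then show ?thesis unfolding zX using im re by simp
    next
      case False
      then have e'e: "e' = - e" using e e' by auto
      have ep': "e' - p \<noteq> 0" using cq(1)[OF e'] by auto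
      \<comment> \<open>Seen from \<open>p\<close>, the two wedges point in directions at least a
        right angle apart, so points near one tip are far from the other wedge.\<close>
      have "Re ((e - p) / (e' - p)) \<le> 0" using p e unfolding e'e by (auto simp: Re_divide)
      moreover have "cmod ((z - e) / (e' - p)) \<le> 1 / 4"
        using 2 cq(1)[OF e'] by (simp add: norm_divide divide_le_eq)
      then have "Re ((z - e) / (e' - p)) \<le> 1 / 4" using complex_Re_le_cmod order_trans by blast
      moreover have "(z - p) / (e' - p) = (z - e) / (e' - p) + (e - p) / (e' - p)" by (simp flip: add_divide_distrib)
      ultimately have "Re ((z - p) / (e' - p)) \<le> 1 / 4" by simp
      then have "(Re ((z - p) / (e' - p)) - (1 - \<kappa>)) / 24 \<le> 0" using \<kappa> by simp
      then show ?thesis by (rule order_trans) (rule abs_ge_zero)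
    qed
    ultimately show "z \<in> D" unfolding D_def Q_def by blast
  qed
  then have "?F -` (Fin ` D) \<subseteq> Fin ` D"
    by (intro subsetI) (metis comp_apply image_iff not_Infty_iff quartic.simps(2) rsphere.distinct(1) vimageE)
  moreover have "Fin ` D \<inter> critical_values ?F = {}"
    using critical_values_quartic2_Fin[OF a0] De v fv D4 by fastforce
  moreover have "Fin ` D homeomorphic cball (0::complex) 1"
  proof -
    have "homeomorphism D (Fin ` D) Fin unFin"
      by (rule homeomorphism_of_subsets[OF homeomorphism_Fin]) auto
    then have "D homeomorphic Fin ` D" unfolding homeomorphic_def by blast
    then show ?thesis using Dh homeomorphic_sym homeomorphic_trans by blast
  qed
  ultimately show ?thesis unfolding s_Cantor_def by blast
qed


subsection \<open>The Julia set\<close>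

lemma continuous_on_finite_fibres:
  fixes f :: "'a::t2_space \<Rightarrow> 'b::topological_space"
  assumes "closed S" "finite (f ` S)" "\<And>c. closed {z \<in> S. f z = c}"
  shows "continuous_on S f"
  unfolding continuous_on_closed_vimage[OF assms(1)]
proof (intro allI impI)
  fix B :: "'b set"
  have "f -` B \<inter> S = (\<Union>c\<in>B \<inter> f ` S. {z \<in> S. f z = c})" by auto
  then show "closed (f -` B \<inter> S)" using assms(2,3) by (simp add: closed_UN)
qed

text \<open>A continuous bijection from a compact set is closed. Closedness of images is checked
  after embedding the sequences into real ones.\<close>

lemma homeomorphic_compact_sequences:
  fixes f :: "'a::t2_space \<Rightarrow> nat \<Rightarrow> nat"
  assumes K: "compact K" and f: "continuous_on K f" and im: "f ` K = T" and inj: "inj_on f K"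
  shows "K homeomorphic T"
proof -
  define j where "j s n = real (s n)" for s :: "nat \<Rightarrow> nat" and n
  have jc: "continuous_on S j" for S
    unfolding j_def
  proof (rule continuous_on_coordinatewise_then_product)
    fix n
    have "continuous_on S (\<lambda>s. s n)"
      by (rule continuous_on_product_then_coordinatewise[OF continuous_on_id])
    then show "continuous_on S (\<lambda>s. real (s n))" by (rule continuous_on_of_nat)
  qed
  have j_inj: "j s = j t \<Longrightarrow> s = t" for s t
    unfolding j_def fun_eq_iff by simp
  obtain g where "homeomorphism K T f g"
  proof (rule homeomorphism_injective_closed_map[OF f im inj])
    fix U assume "closedin (top_of_set K) U"
    then have U: "compact U" "U \<subseteq> K" using K closedin_compact closedin_imp_subset by blast+
    have "continuous_on U (\<lambda>x. j (f x))"
      by (rule continuous_on_compose2[OF jc continuous_on_subset[OF f U(2)]]) auto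
    from compact_continuous_image[OF this U(1)] have "closed ((\<lambda>x. j (f x)) ` U)" by (rule compact_imp_closed)
    then have "closedin (top_of_set T) (T \<inter> j -` ((\<lambda>x. j (f x)) ` U))"
      by (rule continuous_closedin_preimage[OF jc])
    moreover have "T \<inter> j -` ((\<lambda>x. j (f x)) ` U) = f ` U" using U(2) im j_inj by blast
    ultimately show "closedin (top_of_set T) (f ` U)" by simp
  qed
  then show ?thesis unfolding homeomorphic_def by blast
qed

text \<open>Normality quantifies over arbitrary sequences of exponents. After thinning, either the
  same iterate recurs or the exponents tend to infinity.\<close>

lemma subsequence_cases:
  fixes s :: "nat \<Rightarrow> nat"
  obtains r c where "strict_mono (r :: nat \<Rightarrow> nat)" "\<And>n. s (r n) = c"
  | r where "strict_mono (r :: nat \<Rightarrow> nat)" "\<And>n. s (r n) \<ge> n"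
proof (cases "\<forall>n. infinite {k. s k \<ge> n}")
  case True
  have "\<exists>r. \<forall>n. s (r n) \<ge> n \<and> r n < r (Suc n)"
  proof (rule dependent_nat_choice)
    show "\<exists>k. s k \<ge> 0" by simp
    fix k n :: nat
    obtain k' where "k' > k" "s k' \<ge> Suc n"
      using True unfolding infinite_nat_iff_unbounded by blast
    then show "\<exists>k'. s k' \<ge> Suc n \<and> k < k'" by blast
  qed
  then obtain r where "\<And>n. s (r n) \<ge> n" "strict_mono r" unfolding strict_mono_Suc_iff by blast
  then show thesis using that(2) by blast
next
  case False
  then obtain n where "finite {k. s k \<ge> n}" by blast
  then have "infinite (- {k. s k \<ge> n})" by (simp add: finite_compl)
  moreover have "- {k. s k \<ge> n} = {k. s k < n}" by auto
  ultimately have inf: "infinite {k. s k < n}" by simp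
  have "finite (s ` {k. s k < n})" by (rule finite_subset[of _ "{..<n}"]) auto
  from pigeonhole_infinite[OF inf this] obtain k0 where "infinite {k \<in> {k. s k < n}. s k = s k0}" by blast
  from infinite_enumerate[OF this] obtain r :: "nat \<Rightarrow> nat" where "strict_mono r" "\<And>n. s (r n) = s k0" by auto
  then show thesis using that(1) by blast
qed

lemma big_dist_Infty:
  assumes a: "a \<noteq> 0" and "big a x"
  shows "dist ((quartic a ^^ n) x) Infty \<le> 2 / 2 ^ n"
proof (cases "(quartic a ^^ n) x")
  case (Fin w)
  have w: "cmod w \<ge> 2 ^ n" using big_iter_growth[OF assms Fin] .
  then have "w \<noteq> 0" by (metis norm_zero not_le zero_less_numeral zero_less_power)
  then have "dist (Fin w) Infty \<le> 2 / cmod w" by (rule dist_Fin_Infty_le)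
  also have "\<dots> \<le> 2 / 2 ^ n" using w by (intro divide_left_mono mult_pos_pos) (auto simp: \<open>w \<noteq> 0\<close>)
  finally show ?thesis unfolding Fin .
qed simp

lemma big_dist_Infty_later:
  assumes "a \<noteq> 0" "big a ((quartic a ^^ n) x)" "n \<le> m"
  shows "dist ((quartic a ^^ m) x) Infty \<le> 2 / 2 ^ (m - n)"
proof -
  have "(quartic a ^^ m) x = (quartic a ^^ (m - n)) ((quartic a ^^ n) x)"
    using assms(3) by (metis comp_apply funpow_add le_add_diff_inverse2)
  then show ?thesis using big_dist_Infty[OF assms(1,2)] by simp
qed

lemma open_big: "open {x. big a x}"
proof -
  have "{x. big a x} = - Fin ` cball 0 (escR a)"
  proof (intro set_eqI)
    fix x show "x \<in> {x. big a x} \<longleftrightarrow> x \<in> - Fin ` cball 0 (escR a)" by (cases x) auto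
  qed
  then show ?thesis using compact_imp_closed[OF compact_Fin_image[OF compact_cball]] by (simp add: open_Compl)
qed

lemma open_big_iterate:
  assumes a: "a \<noteq> 0"
  shows "open {x. big a ((quartic a ^^ n) x)}"
proof -
  have "{x. big a ((quartic a ^^ n) x)} = Fin ` {z. big a (iter a n z)} \<union> {x. big a x}"
  proof (intro set_eqI)
    fix x
    show "x \<in> {x. big a ((quartic a ^^ n) x)} \<longleftrightarrow> x \<in> Fin ` {z. big a (iter a n z)} \<union> {x. big a x}"
      using big_iter_mono[OF a, of 0 x n] by (cases x) auto
  qed
  then show ?thesis using open_Fin_image[OF open_big_iter[OF a]] open_big by auto
qed

lemma uniform_escape:
  assumes a: "a \<noteq> 0" and C: "compact C" "C \<subseteq> - Fin ` filled a"
  obtains n where "\<And>x m. x \<in> C \<Longrightarrow> m \<ge> n \<Longrightarrow> dist ((quartic a ^^ m) x) Infty \<le> 2 / 2 ^ (m - n)"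
proof -
  let ?V = "\<lambda>n. {x. big a ((quartic a ^^ n) x)}"
  have "C \<subseteq> (\<Union>n\<in>UNIV. ?V n)"
  proof
    fix x assume "x \<in> C"
    then have "x \<notin> Fin ` filled a" using C by blast
    then show "x \<in> (\<Union>n\<in>UNIV. ?V n)"
      by (cases x) (auto simp: filled_def intro: exI[of _ 0])
  qed
  then obtain N where N: "finite N" "C \<subseteq> (\<Union>n\<in>N. ?V n)"
    using compactE_image[OF C(1), of UNIV ?V] open_big_iterate[OF a] by auto
  obtain n where n: "\<And>k. k \<in> N \<Longrightarrow> k \<le> n" using N(1) finite_nat_set_iff_bounded_le by auto
  show thesis
  proof (rule that[of n])
    fix x m assume x: "x \<in> C" and m: "n \<le> m"
    then obtain k where k: "k \<in> N" "big a ((quartic a ^^ k) x)" using N(2) by blast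
    have "big a ((quartic a ^^ n) x)" by (rule big_iter_mono[OF a k(2) n[OF k(1)]])
    then show "dist ((quartic a ^^ m) x) Infty \<le> 2 / 2 ^ (m - n)" using big_dist_Infty_later[OF a _ m] by blast
  qed
qed

lemma outside_filled_fatou:
  assumes a: "a \<noteq> 0"
  shows "- Fin ` filled a \<subseteq> fatou_set (quartic a)"
proof -
  have "iterates_normal_on (quartic a) (- Fin ` filled a)"
    unfolding iterates_normal_on_def
  proof
    fix s :: "nat \<Rightarrow> nat"
    show "\<exists>r g. strict_mono r \<and> (\<forall>K. compact K \<and> K \<subseteq> - Fin ` filled a \<longrightarrow>
      uniform_limit K (\<lambda>n. quartic a ^^ s (r n)) g sequentially)"
    proof (cases rule: subsequence_cases[of s])
      case (1 r c)
      then show ?thesis by (intro exI[of _ r] exI[of _ "quartic a ^^ c"]) (auto intro: uniform_limit_const)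
    next
      case (2 r)
      have "uniform_limit K (\<lambda>n. quartic a ^^ s (r n)) (\<lambda>_. Infty) sequentially"
        if K: "compact K" "K \<subseteq> - Fin ` filled a" for K
      proof -
        obtain n0 where n0: "\<And>x m. x \<in> K \<Longrightarrow> m \<ge> n0 \<Longrightarrow> dist ((quartic a ^^ m) x) Infty \<le> 2 / 2 ^ (m - n0)"
          using uniform_escape[OF a K] by blast
        show ?thesis
          unfolding uniform_limit_iff
        proof (intro allI impI)
          fix e :: real assume e: "e > 0"
          obtain j where j: "2 / e < 2 ^ j" using real_arch_pow[of 2 "2 / e"] by auto
          have "\<forall>x\<in>K. dist ((quartic a ^^ s (r n)) x) Infty < e" if n: "n \<ge> n0 + j" for n
          proof
            fix x assume x: "x \<in> K"
            have m: "n0 \<le> s (r n)" "j \<le> s (r n) - n0" using 2(2)[of n] n by auto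
            have "(2::real) ^ j \<le> 2 ^ (s (r n) - n0)" using m(2) by (intro power_increasing) auto
            then have "2 / e < 2 ^ (s (r n) - n0)" using j by linarith
            then have "2 / 2 ^ (s (r n) - n0) < e" using e by (simp add: field_simps)
            then show "dist ((quartic a ^^ s (r n)) x) Infty < e" using n0[OF x m(1)] by linarith
          qed
          then show "\<forall>\<^sub>F n in sequentially. \<forall>x\<in>K. dist ((quartic a ^^ s (r n)) x) Infty < e"
            unfolding eventually_sequentially by blast
        qed
      qed
      then show ?thesis using 2(1) by blast
    qed
  qed
  moreover have "open (- Fin ` filled a)"
    using compact_imp_closed[OF compact_Fin_image[OF compact_filled[OF a]]] by (simp add: open_Compl)
  ultimately show ?thesis unfolding fatou_set_def by blast
qed

text \<open>Escaping points lie arbitrarily close to \<open>z\<close>, and there a limit of iterates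
  is infinity. By uniform convergence and continuity of one iterate, the orbit of \<open>z\<close>
  would come closer to infinity than the filled set permits.\<close>

lemma filled_subset_julia:
  assumes a: "a \<noteq> 0" and int: "interior (filled a) = {}"
  shows "Fin ` filled a \<subseteq> julia_set (quartic a)"
proof
  fix x assume "x \<in> Fin ` filled a"
  then obtain z where z: "x = Fin z" "z \<in> filled a" by blast
  show "x \<in> julia_set (quartic a)"
  proof (rule ccontr)
    assume "x \<notin> julia_set (quartic a)"
    then obtain U where U: "open U" "iterates_normal_on (quartic a) U" "Fin z \<in> U"
      unfolding julia_set_def fatou_set_def z(1) by blast
    obtain r g where r: "strict_mono (r :: nat \<Rightarrow> nat)"
      and lim: "\<And>K. compact K \<Longrightarrow> K \<subseteq> U \<Longrightarrow> uniform_limit K (\<lambda>n. quartic a ^^ r n) g sequentially"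
      using spec[OF U(2)[unfolded iterates_normal_on_def], of "\<lambda>n. n"] by auto
    obtain e where e: "e > 0" "cball z e \<subseteq> Fin -` U"
      using open_Fin_vimage[OF U(1)] U(3) open_contains_cball by (metis vimageI)
    define C where "C = Fin ` cball z e"
    have uC: "uniform_limit C (\<lambda>n. quartic a ^^ r n) g sequentially"
      using lim[of C] compact_Fin_image[OF compact_cball] e(2) by (auto simp: C_def)
    \<comment> \<open>The chordal distance to infinity at modulus \<open>escR a\<close>, hence a
      lower bound for it along orbits in the filled set.\<close>
    define \<epsilon> where "\<epsilon> = 2 / sqrt ((escR a)\<^sup>2 + 1)"
    have sp: "sqrt ((escR a)\<^sup>2 + 1) > 0" by (simp add: add_nonneg_pos)
    have \<epsilon>: "\<epsilon> > 0" using sp by (simp add: \<epsilon>_def)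
    have far: "dist (Fin w) Infty \<ge> \<epsilon>" if "cmod w \<le> escR a" for w
      unfolding dist_Fin_Infty \<epsilon>_def using that power_mono[OF that norm_ge_zero, of 2]
      by (intro divide_left_mono mult_pos_pos) (auto simp: norm_sq_plus_1_pos add_nonneg_pos)
    obtain N where N: "\<And>y. y \<in> C \<Longrightarrow> dist ((quartic a ^^ r N) y) (g y) < \<epsilon> / 4"
      using uniform_limitD[OF uC, of "\<epsilon> / 4"] \<epsilon> unfolding eventually_sequentially by auto
    let ?Q = "\<lambda>w. snd (hit a (r N) w)"
    define W where "W = {w. ?Q w \<noteq> 0}"
    have "open W" unfolding W_def
      by (intro open_Collect_neq continuous_on_const holomorphic_on_imp_continuous_on hit_holomorphic)
    have Wi: "iter a (r N) w = Fin (phi a (r N) w)" if "w \<in> W" for w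
      using that by (simp add: W_def iter_eq_Fin_iff[OF a] phi_def)
    obtain w0 where w0: "iter a (r N) z = Fin w0" using filled_notin_Infty[OF z(2)] not_Infty_iff by blast
    then have zW: "z \<in> W" by (simp add: W_def iter_eq_Fin_iff[OF a])
    have "phi a (r N) holomorphic_on W" by (rule phi_holomorphic[OF a]) (use Wi in auto)
    then have "continuous_on W (\<lambda>w. Fin (phi a (r N) w))"
      by (intro continuous_on_Fin holomorphic_on_imp_continuous_on)
    then have "isCont (\<lambda>w. Fin (phi a (r N) w)) z" using \<open>open W\<close> zW continuous_on_eq_continuous_at by blast
    then obtain d1 where d1: "d1 > 0" "\<And>w. dist w z < d1 \<Longrightarrow> dist (Fin (phi a (r N) w)) (Fin (phi a (r N) z)) < \<epsilon> / 4"
      using \<epsilon> unfolding continuous_at_eps_delta by (metis divide_pos_pos zero_less_numeral)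
    obtain d2 where d2: "d2 > 0" "ball z d2 \<subseteq> W" using \<open>open W\<close> zW open_contains_ball by blast
    define d where "d = Min {e, d1, d2}"
    have d: "d > 0" "d \<le> e" "d \<le> d1" "d \<le> d2" using e d1 d2 by (auto simp: d_def)
    have "\<not> ball z d \<subseteq> filled a"
      using int d(1) interior_maximal[of "ball z d" "filled a"] by auto
    then obtain z' where z': "z' \<in> ball z d" "z' \<notin> filled a" by blast
    have zC: "Fin z' \<in> C" using z'(1) d(2) by (auto simp: C_def)
    have "g (Fin z') = Infty"
    proof (rule LIMSEQ_unique)
      show "(\<lambda>n. iter a (r n) z') \<longlonglongrightarrow> g (Fin z')" using tendsto_uniform_limitI[OF uC zC] .
      obtain n0 where n0: "big a (iter a n0 z')" using z'(2) by (auto simp: filled_def)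
      show "(\<lambda>n. iter a (r n) z') \<longlonglongrightarrow> Infty"
      proof (rule metric_LIMSEQ_I)
        fix e :: real assume e: "e > 0"
        obtain j where j: "2 / e < 2 ^ j" using real_arch_pow[of 2 "2 / e"] by auto
        have "dist (iter a (r n) z') Infty < e" if n: "n \<ge> n0 + j" for n
        proof -
          have m: "n0 \<le> r n" "j \<le> r n - n0" using seq_suble[OF r, of n] n by auto
          have "(2::real) ^ j \<le> 2 ^ (r n - n0)" using m(2) by (intro power_increasing) auto
          then have "2 / e < 2 ^ (r n - n0)" using j by linarith
          then have "2 / 2 ^ (r n - n0) < e" using e by (simp add: field_simps)
          then show ?thesis using big_dist_Infty_later[OF a n0 m(1)] by linarith
        qed
        then show "\<exists>no. \<forall>n\<ge>no. dist (iter a (r n) z') Infty < e" by blast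
      qed
    qed
    then have 1: "dist (iter a (r N) z') Infty < \<epsilon> / 4" using N[OF zC] by simp
    have "z' \<in> W" "dist z' z < d1" using z'(1) d d2(2) by (auto simp: dist_commute)
    then have 2: "dist (iter a (r N) z') (iter a (r N) z) < \<epsilon> / 4" using d1(2) Wi[OF \<open>z' \<in> W\<close>] Wi[OF zW] by simp
    have "dist (iter a (r N) z) Infty < \<epsilon>"
      using 1 2 \<epsilon> dist_triangle3[of "iter a (r N) z" Infty "iter a (r N) z'"] by linarith
    moreover have "\<not> big a (iter a (r N) z)" using z(2) by (auto simp: filled_def)
    then have "cmod w0 \<le> escR a" using w0 by simp
    then have "dist (iter a (r N) z) Infty \<ge> \<epsilon>" unfolding w0 by (rule far)
    ultimately show False by simp
  qed
qed

subsection \<open>Itineraries\<close>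

context disc
begin

text \<open>Segments of the unit disc, carried over to \<open>D\<close> by one homeomorphism, join
  any two points with a common modulus of continuity. So the constant of \<open>lift_shrink\<close>
  is the same for all pairs.\<close>

lemma inverse_branch_diameter:
  obtains \<theta> C where "0 < \<theta>" "\<theta> < 1" "C \<ge> 0"
    "\<And>n S w w'. lifts a n D (\<lambda>x. x) S \<Longrightarrow> w \<in> D \<Longrightarrow> w' \<in> D \<Longrightarrow> dist (S w) (S w') \<le> C * \<theta> ^ n"
proof -
  have "D \<inter> postcrit a = {}" using postcrit_D by blast
  from lift_shrink[OF compact_D this] obtain \<theta> \<rho> where \<theta>: "0 < \<theta>" "\<theta> < 1" and \<rho>: "\<rho> > 0" and
    sh: "\<And>M. M > 0 \<Longrightarrow> \<exists>C\<ge>0. \<forall>\<gamma> k \<delta>. path \<gamma> \<longrightarrow> path_image \<gamma> \<subseteq> D \<longrightarrow>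
      (\<forall>t\<in>{0..1}. \<forall>t'\<in>{0..1}. \<bar>t - t'\<bar> \<le> 1 / real M \<longrightarrow> dist (\<gamma> t) (\<gamma> t') < \<rho>) \<longrightarrow>
      lifts a k {0..1} \<gamma> \<delta> \<longrightarrow> dist (\<delta> 0) (\<delta> 1) \<le> C * \<theta> ^ k"
    by metis
  obtain h k where hk: "homeomorphism (cball (0::complex) 1) D h k"
    using Dh homeomorphic_sym unfolding homeomorphic_def by metis
  then have hc: "continuous_on (cball 0 1) h" and im: "h ` cball 0 1 = D" by (auto simp: homeomorphism_def)
  have "uniformly_continuous_on (cball 0 1) h" by (rule compact_uniformly_continuous[OF hc compact_cball])
  then obtain d where d: "d > 0" "\<And>y y'. y \<in> cball 0 1 \<Longrightarrow> y' \<in> cball 0 1 \<Longrightarrow> dist y' y < d \<Longrightarrow> dist (h y') (h y) < \<rho>"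
    using \<rho> unfolding uniformly_continuous_on_def by metis
  obtain j where j: "1 / real (Suc j) < d / 2" using nat_approx_posE[of "d / 2"] d(1) by auto
  obtain C where C: "C \<ge> 0" "\<And>\<gamma> k \<delta>. path \<gamma> \<Longrightarrow> path_image \<gamma> \<subseteq> D \<Longrightarrow>
      (\<forall>t\<in>{0..1}. \<forall>t'\<in>{0..1}. \<bar>t - t'\<bar> \<le> 1 / real (Suc j) \<longrightarrow> dist (\<gamma> t) (\<gamma> t') < \<rho>) \<Longrightarrow>
      lifts a k {0..1} \<gamma> \<delta> \<Longrightarrow> dist (\<delta> 0) (\<delta> 1) \<le> C * \<theta> ^ k"
    using sh[OF zero_less_Suc[of j]] by (elim exE conjE) blast
  show thesis
  proof (rule that[OF \<theta> C(1)])
    fix n S w w' assume S: "lifts a n D (\<lambda>x. x) S" and w: "w \<in> D" "w' \<in> D"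
    obtain b b' where b: "b \<in> cball 0 1" "b' \<in> cball 0 1" "w = h b" "w' = h b'" using w im by blast
    define \<gamma> where "\<gamma> t = h (linepath b b' t)" for t
    have seg: "linepath b b' t \<in> cball 0 1" if "t \<in> {0..1}" for t
      using b(1,2) convex_contains_segment[of "cball (0::complex) 1"] linepath_in_path[OF that, of b b'] by (meson convex_cball subsetD)
    have \<gamma>D: "\<gamma> ` {0..1} \<subseteq> D" using seg im by (auto simp: \<gamma>_def)
    have \<gamma>c: "continuous_on {0..1} \<gamma>" unfolding \<gamma>_def
      by (rule continuous_on_compose2[OF hc continuous_on_linepath]) (use seg in auto)
    have "dist (\<gamma> t) (\<gamma> t') < \<rho>" if t: "t \<in> {0..1}" "t' \<in> {0..1}" "\<bar>t - t'\<bar> \<le> 1 / real (Suc j)" for t t'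
    proof -
      have "linepath b b' t - linepath b b' t' = (t - t') *\<^sub>R (b' - b)" by (simp add: linepath_def algebra_simps)
      then have "dist (linepath b b' t) (linepath b b' t') = \<bar>t - t'\<bar> * cmod (b' - b)" by (simp add: dist_norm)
      also have "\<dots> \<le> 1 / real (Suc j) * 2"
        using t(3) b(1,2) norm_triangle_ineq4[of b' b] by (intro mult_mono) auto
      also have "\<dots> < d" using j by simp
      finally show ?thesis unfolding \<gamma>_def using d(2)[OF seg[OF t(2)] seg[OF t(1)]] by simp
    qed
    then have "dist (S (\<gamma> 0)) (S (\<gamma> 1)) \<le> C * \<theta> ^ n"
      using C(2)[of \<gamma> n "\<lambda>t. S (\<gamma> t)"] lifts_precomp[OF S \<gamma>c \<gamma>D] \<gamma>c \<gamma>D by (simp add: path_def path_image_def)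
    then show "dist (S w) (S w') \<le> C * \<theta> ^ n" using b(3,4) by (simp add: \<gamma>_def linepath_def)
  qed
qed

text \<open>Inverse branches preserve \<open>D\<close> only in steps of two. Naming the sixteen
  branches by two letters each keeps the alphabet at four symbols.\<close>

lemma second_branches:
  "\<exists>M :: nat \<Rightarrow> nat \<Rightarrow> complex \<Rightarrow> complex. (\<forall>i j. lifts a 2 D (\<lambda>x. x) (M i j)) \<and>
    (\<forall>z. \<forall>w\<in>D. iter a 2 z = Fin w \<longrightarrow> (\<exists>i\<in>{1..4}. \<exists>j\<in>{1..4}. z = M i j w)) \<and>
    (\<forall>i\<in>{1..4}. \<forall>j\<in>{1..4}. \<forall>i'\<in>{1..4}. \<forall>j'\<in>{1..4}. \<forall>w\<in>D. M i j w = M i' j' w \<longrightarrow> i = i' \<and> j = j')"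
proof -
  have nPC: "z \<notin> postcrit a" if "z \<in> D" for z using postcrit_D that by blast
  have avoid: "z \<noteq> 1 \<and> z \<noteq> - 1 \<and> z \<noteq> qf a 0" if "z \<notin> postcrit a" for z using that pm1_postcrit qf_0_postcrit by metis
  obtain L :: "nat \<Rightarrow> complex \<Rightarrow> complex" where L: "\<And>i. lifts a 1 D (\<lambda>z. z) (L i)"
    "\<And>z. z \<in> D \<Longrightarrow> bij_betw (\<lambda>i. L i z) {1..4} {w. quartic a (Fin w) = Fin z}"
    using four_lifts[OF a0 contractible_D, of "\<lambda>z. z"] avoid nPC by (metis continuous_on_id)
  have LPC: "L i z \<notin> postcrit a" if "z \<in> D" for i z using lifts_notin_postcrit[OF L(1) that nPC[OF that]] .
  have "\<exists>M :: nat \<Rightarrow> complex \<Rightarrow> complex. (\<forall>j. lifts a 1 D (L i) (M j)) \<and>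
      (\<forall>z\<in>D. bij_betw (\<lambda>j. M j z) {1..4} {w. quartic a (Fin w) = Fin (L i z)})" for i
    using four_lifts[OF a0 contractible_D lifts_cont[OF L(1)[of i]]] avoid LPC by metis
  then obtain M :: "nat \<Rightarrow> nat \<Rightarrow> complex \<Rightarrow> complex" where M: "\<And>i j. lifts a 1 D (L i) (M i j)"
    "\<And>i z. z \<in> D \<Longrightarrow> bij_betw (\<lambda>j. M i j z) {1..4} {w. quartic a (Fin w) = Fin (L i z)}" by metis
  have uniq: "i = i' \<and> j = j'" if ij: "i \<in> {1..4}" "j \<in> {1..4}" "i' \<in> {1..4}" "j' \<in> {1..4}" and w: "w \<in> D" and e: "M i j w = M i' j' w" for i j i' j' w
  proof -
    have "L i w = L i' w" using liftsD[OF M(1) w, of i j] liftsD[OF M(1) w, of i' j'] e by simp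
    then have "i = i'" using inj_onD[OF bij_betw_imp_inj_on[OF L(2)[OF w]]] ij by simp
    then show ?thesis using inj_onD[OF bij_betw_imp_inj_on[OF M(2)[OF w]], of i j j'] ij e by simp
  qed
  show ?thesis
  proof (intro exI[of _ M] conjI allI ballI impI)
    show "lifts a 2 D (\<lambda>x. x) (M i j)" for i j using lifts_compose[OF L(1) M(1), of i j] by (simp add: numeral_2_eq_2)
    show "\<exists>i\<in>{1..4}. \<exists>j\<in>{1..4}. z = M i j w" if w: "w \<in> D" "iter a 2 z = Fin w" for z w
    proof -
      have "quartic a (quartic a (Fin z)) = Fin w" using w(2) by (simp add: numeral_2_eq_2)
      then obtain z1 where z1: "quartic a (Fin z) = Fin z1" "quartic a (Fin z1) = Fin w"
        by (cases "quartic a (Fin z)") auto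
      have "z1 \<in> (\<lambda>i. L i w) ` {1..4}" using bij_betw_imp_surj_on[OF L(2)[OF w(1)]] z1(2) by simp
      then obtain i where i: "i \<in> {1..4}" "z1 = L i w" by blast
      have "z \<in> (\<lambda>j. M i j w) ` {1..4}" using bij_betw_imp_surj_on[OF M(2)[OF w(1)]] z1(1) i(2) by simp
      then show ?thesis using i(1) by blast
    qed
    show "i = i'" "j = j'" if "i \<in> {1..4}" "j \<in> {1..4}" "i' \<in> {1..4}" "j' \<in> {1..4}" "w \<in> D" "M i j w = M i' j' w" for i j i' j' w
      using uniq[OF that] by auto
  qed
qed

lemma filled_iff_D: "z \<in> filled a \<longleftrightarrow> (\<forall>n. iter a (2 * n) z \<in> Fin ` D)"
proof
  assume z: "z \<in> filled a"
  show "\<forall>n. iter a (2 * n) z \<in> Fin ` D"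
  proof
    fix n
    obtain w where w: "iter a (2 * n) z = Fin w" using filled_notin_Infty[OF z] not_Infty_iff by blast
    then have "w \<in> filled a" using filled_iter_iff[OF a0 w] z by simp
    then show "iter a (2 * n) z \<in> Fin ` D" using w escape_outside_D by auto
  qed
next
  assume D: "\<forall>n. iter a (2 * n) z \<in> Fin ` D"
  show "z \<in> filled a"
  proof (rule ccontr)
    assume "z \<notin> filled a"
    then obtain n where n: "big a (iter a n z)" by (auto simp: filled_def)
    obtain B where B: "\<And>z. z \<in> D \<Longrightarrow> cmod z \<le> B" using compact_imp_bounded[OF compact_D] unfolding bounded_iff by blast
    obtain j where j: "B < 2 ^ j" using real_arch_pow[of 2 B] by auto
    obtain w where w: "iter a (2 * (n + j)) z = Fin w" "w \<in> D" using D by blast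
    have "2 * (n + j) = (n + 2 * j) + n" by simp
    then have "(quartic a ^^ (n + 2 * j)) (iter a n z) = Fin w" using w(1) by (metis comp_apply funpow_add)
    then have "cmod w \<ge> 2 ^ (n + 2 * j)" using big_iter_growth[OF a0 n] by blast
    moreover have "(2::real) ^ j \<le> 2 ^ (n + 2 * j)" by (intro power_increasing) auto
    ultimately show False using B[OF w(2)] j by linarith
  qed
qed

lemma filled_itineraries:
  obtains I :: "complex \<Rightarrow> nat \<Rightarrow> nat" where "continuous_on (filled a) I" "inj_on I (filled a)" "I ` filled a = symbol_space 4"
proof -
  obtain M :: "nat \<Rightarrow> nat \<Rightarrow> complex \<Rightarrow> complex" where
    M: "\<And>i j. i \<in> {1..4} \<Longrightarrow> j \<in> {1..4} \<Longrightarrow> lifts a 2 D (\<lambda>x. x) (M i j)"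
    and Mex: "\<And>z w. w \<in> D \<Longrightarrow> iter a 2 z = Fin w \<Longrightarrow> \<exists>i\<in>{1..4}. \<exists>j\<in>{1..4}. z = M i j w"
    and Muniq: "\<And>i j i' j' w. i \<in> {1..4} \<Longrightarrow> j \<in> {1..4} \<Longrightarrow> i' \<in> {1..4} \<Longrightarrow> j' \<in> {1..4} \<Longrightarrow> w \<in> D \<Longrightarrow>
      M i j w = M i' j' w \<Longrightarrow> i = i' \<and> j = j'"
  proof (rule exE[OF second_branches], elim conjE)
    fix M :: "nat \<Rightarrow> nat \<Rightarrow> complex \<Rightarrow> complex"
    assume 1: "\<forall>i j. lifts a 2 D (\<lambda>x. x) (M i j)"
      and 2: "\<forall>z. \<forall>w\<in>D. iter a 2 z = Fin w \<longrightarrow> (\<exists>i\<in>{1..4}. \<exists>j\<in>{1..4}. z = M i j w)"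
      and 3: "\<forall>i\<in>{1..4}. \<forall>j\<in>{1..4}. \<forall>i'\<in>{1..4}. \<forall>j'\<in>{1..4}. \<forall>w\<in>D. M i j w = M i' j' w \<longrightarrow> i = i' \<and> j = j'"
    show thesis
      by (rule that[of M]) (rule 1[rule_format] 2[rule_format] 3[rule_format]; assumption)+
  qed
  let ?K = "filled a"
  have closedK: "closed ?K" using compact_filled[OF a0] compact_imp_closed by blast
  define T where "T n z = phi a (2 * n) z" for n z
  have TK: "iter a (2 * n) z = Fin (T n z)" "T n z \<in> ?K" "T n z \<in> D" if z: "z \<in> ?K" for n z
  proof -
    show e: "iter a (2 * n) z = Fin (T n z)" unfolding T_def using iter_phi[OF a0 filled_notin_Infty[OF z]] .
    then show "T n z \<in> ?K" using filled_iter_iff[OF a0 e] z by simp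
    then show "T n z \<in> D" using escape_outside_D by blast
  qed
  have TS: "iter a 2 (T n z) = Fin (T (Suc n) z)" if z: "z \<in> ?K" for n z
    using iter_add[OF TK(1)[OF z, of n], of 2] TK(1)[OF z, of "Suc n"] by simp
  have Tc: "continuous_on ?K (T n)" for n
    unfolding T_def by (intro holomorphic_on_imp_continuous_on phi_holomorphic[OF a0]) (rule filled_notin_Infty)
  have "\<exists>i j. i \<in> {1..4} \<and> j \<in> {1..4} \<and> z = M i j (T 1 z)" if z: "z \<in> ?K" for z
  proof -
    have "iter a 2 z = Fin (T 1 z)" using TK(1)[OF z, of 1] by simp
    from Mex[OF TK(3)[OF z] this] show ?thesis by blast
  qed
  then obtain p q where pq: "\<And>z. z \<in> ?K \<Longrightarrow> p z \<in> {1..4}" "\<And>z. z \<in> ?K \<Longrightarrow> q z \<in> {1..4}"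
    "\<And>z. z \<in> ?K \<Longrightarrow> z = M (p z) (q z) (T 1 z)" by metis
  have lab: "z \<in> M i j ` D \<longleftrightarrow> p z = i \<and> q z = j" if z: "z \<in> ?K" and ij: "i \<in> {1..4}" "j \<in> {1..4}" for z i j
  proof
    assume "z \<in> M i j ` D"
    then obtain w where w: "w \<in> D" "z = M i j w" by blast
    then have "iter a 2 z = Fin w" using liftsD[OF M[OF ij]] by simp
    then have "w = T 1 z" using TK(1)[OF z, of 1] by simp
    then show "p z = i \<and> q z = j" using Muniq[OF pq(1,2)[OF z] ij w(1)] pq(3)[OF z] w(2) by simp
  next
    assume "p z = i \<and> q z = j"
    then show "z \<in> M i j ` D" using pq(3)[OF z] TK(3)[OF z] by blast
  qed
  have clM: "closed (M i j ` D)" if "i \<in> {1..4}" "j \<in> {1..4}" for i j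
    using compact_continuous_image[OF lifts_cont[OF M[OF that]] compact_D] compact_imp_closed by blast
  have closed_pair: "closed {z \<in> ?K. p z = i \<and> q z = j}" for i j
  proof (cases "i \<in> {1..4} \<and> j \<in> {1..4}")
    case True
    then have "{z \<in> ?K. p z = i \<and> q z = j} = ?K \<inter> M i j ` D" using lab by blast
    then show ?thesis using clM True closedK by (simp add: closed_Int)
  next
    case False
    then have "{z \<in> ?K. p z = i \<and> q z = j} = {}" using pq by blast
    then show ?thesis by (simp only: closed_empty)
  qed
  have pc: "continuous_on ?K p"
  proof (rule continuous_on_finite_fibres[OF closedK])
    show "finite (p ` ?K)" by (rule finite_subset[of _ "{1..4}"]) (use pq(1) in auto)
    have "{z \<in> ?K. p z = c} = (\<Union>j\<in>{1..4}. {z \<in> ?K. p z = c \<and> q z = j})" for c using pq(2) by blast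
    then show "closed {z \<in> ?K. p z = c}" for c using closed_pair by (simp add: closed_UN)
  qed
  have qc: "continuous_on ?K q"
  proof (rule continuous_on_finite_fibres[OF closedK])
    show "finite (q ` ?K)" by (rule finite_subset[of _ "{1..4}"]) (use pq(2) in auto)
    have "{z \<in> ?K. q z = c} = (\<Union>i\<in>{1..4}. {z \<in> ?K. p z = i \<and> q z = c})" for c using pq(1) by blast
    then show "closed {z \<in> ?K. q z = c}" for c using closed_pair by (simp add: closed_UN)
  qed
  define I where "I z n = (if even n then p (T (n div 2) z) else q (T (n div 2) z))" for z n
  \<comment> \<open>The composition of the branches named by \<open>s\<close>, with the last pair of
    letters applied first; thus the images of \<open>D\<close> are nested.\<close>
  define SS where "SS s = rec_nat (\<lambda>w. w) (\<lambda>n F w. F (M (s (2 * n)) (s (2 * n + 1)) w))" for s :: "nat \<Rightarrow> nat"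
  have SS0: "SS s 0 = (\<lambda>w. w)" and SSS: "SS s (Suc n) = (\<lambda>w. SS s n (M (s (2 * n)) (s (2 * n + 1)) w))" for s n
    by (simp_all add: SS_def)
  have MD: "M i j w \<in> D" if "i \<in> {1..4}" "j \<in> {1..4}" "w \<in> D" for i j w
    using Dback liftsD[OF M[OF that(1,2)] that(3)] that(3) by auto
  have SSl: "lifts a (2 * n) D (\<lambda>x. x) (SS s n)" if s: "s \<in> symbol_space 4" for s n
  proof (induction n)
    case 0
    then show ?case by (simp add: lifts_def SS0)
  next
    case (Suc n)
    have s2: "s (2 * n) \<in> {1..4}" "s (2 * n + 1) \<in> {1..4}" using s by (simp_all add: symbol_space_def)
    have "lifts a (2 * n) D (\<lambda>x. M (s (2 * n)) (s (2 * n + 1)) x) (\<lambda>x. SS s n (M (s (2 * n)) (s (2 * n + 1)) x))"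
      by (rule lifts_precomp[OF Suc lifts_cont[OF M[OF s2]]]) (use MD[OF s2] in blast)
    from lifts_compose[OF M[OF s2] this] show ?case by (simp add: SSS)
  qed
  have IS: "I z \<in> symbol_space 4" if z: "z \<in> ?K" for z
    using pq TK(2)[OF z] by (auto simp: I_def symbol_space_def)
  have zS: "z = SS (I z) n (T n z)" if z: "z \<in> ?K" for z n
  proof (induction n)
    case 0
    then show ?case using TK(1)[OF z, of 0] by (simp add: SS0)
  next
    case (Suc n)
    have "T 1 (T n z) = T (Suc n) z" using TK(1)[OF TK(2)[OF z], of 1 n] TS[OF z, of n] by simp
    then have "T n z = M (I z (2 * n)) (I z (2 * n + 1)) (T (Suc n) z)"
      using pq(3)[OF TK(2)[OF z], of n] by (simp add: I_def)
    then show ?case using Suc by (simp add: SSS)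
  qed
  obtain \<theta> C where \<theta>: "0 < \<theta>" "\<theta> < 1" "C \<ge> 0"
    and diam: "\<And>n S w w'. lifts a n D (\<lambda>x. x) S \<Longrightarrow> w \<in> D \<Longrightarrow> w' \<in> D \<Longrightarrow> dist (S w) (S w') \<le> C * \<theta> ^ n"
    using inverse_branch_diameter by metis
  have "inj_on I ?K"
  proof (rule inj_onI)
    fix z z' assume z: "z \<in> ?K" "z' \<in> ?K" "I z = I z'"
    have "dist z z' \<le> C * (\<theta>\<^sup>2) ^ n" for n
      using diam[OF SSl[OF IS[OF z(1)]] TK(3)[OF z(1)] TK(3)[OF z(2)], of n n n] zS[OF z(1), of n] zS[OF z(2), of n] z(3)
      by (simp add: power_mult)
    moreover have "(\<lambda>n. C * (\<theta>\<^sup>2) ^ n) \<longlonglongrightarrow> 0"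
      using \<theta> by (intro tendsto_mult_right_zero LIMSEQ_realpow_zero) (auto simp: power_less_one_iff)
    ultimately have "dist z z' \<le> 0" by (intro LIMSEQ_le_const[where X = "\<lambda>n. C * (\<theta>\<^sup>2) ^ n"]) auto
    then show "z = z'" by simp
  qed
  moreover have "I ` ?K = symbol_space 4"
  proof
    show "I ` ?K \<subseteq> symbol_space 4" using IS by blast
    show "symbol_space 4 \<subseteq> I ` ?K"
    proof
      fix s assume s: "s \<in> symbol_space 4"
      have s2: "s n \<in> {1..4}" for n using s by (simp add: symbol_space_def)
      define F where "F n = SS s n ` D" for n
      have "\<Inter> (range F) \<noteq> {}"
      proof (rule compact_nest)
        show "compact (F n)" for n unfolding F_def
          by (rule compact_continuous_image[OF lifts_cont[OF SSl[OF s]] compact_D])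
        show "F n \<noteq> {}" for n using D_dense_interior unfolding F_def by blast
        have "F (Suc n) \<subseteq> F n" for n unfolding F_def SSS using MD[OF s2 s2] by blast
        then show "F n \<subseteq> F m" if "m \<le> n" for m n using that lift_Suc_antimono_le[of F] by blast
      qed
      then obtain z where z: "\<And>n. z \<in> F n" by blast
      then have "\<exists>w\<in>D. z = SS s n w" for n unfolding F_def by blast
      then obtain w where w: "\<And>n. w n \<in> D" "\<And>n. z = SS s n (w n)" by metis
      have iz: "iter a (2 * n) z = Fin (w n)" for n using liftsD[OF SSl[OF s] w(1)] w(2) by metis
      have zK: "z \<in> ?K" unfolding filled_iff_D using iz w(1) by auto
      have Tw: "T n z = w n" for n using TK(1)[OF zK, of n] iz by simp
      have Mw: "w n = M (s (2 * n)) (s (2 * n + 1)) (w (Suc n))" for n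
      proof -
        have "z = SS s n (M (s (2 * n)) (s (2 * n + 1)) (w (Suc n)))" using w(2)[of "Suc n"] by (simp add: SSS)
        then have "iter a (2 * n) z = Fin (M (s (2 * n)) (s (2 * n + 1)) (w (Suc n)))"
          using liftsD[OF SSl[OF s] MD[OF s2 s2 w(1)]] by metis
        then show ?thesis using iz[of n] by simp
      qed
      have TM: "T n z = M (s (2 * n)) (s (2 * n + 1)) (w (Suc n))" for n by (rule trans[OF Tw Mw])
      have "T n z \<in> M (s (2 * n)) (s (2 * n + 1)) ` D" for n using w(1)[of "Suc n"] unfolding TM by (rule imageI)
      then have ps: "p (T n z) = s (2 * n) \<and> q (T n z) = s (2 * n + 1)" for n using lab[OF TK(2)[OF zK] s2 s2] by blast
      have "I z = s"
      proof
        fix n show "I z n = s n"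
          using ps[of "n div 2"] by (cases "even n") (auto simp: I_def elim!: evenE oddE)
      qed
      then show "s \<in> I ` ?K" using zK by blast
    qed
  qed
  moreover have "continuous_on ?K I"
  proof (rule continuous_on_coordinatewise_then_product)
    fix n
    have c: "continuous_on ?K (\<lambda>z. f (T (n div 2) z))" if "continuous_on ?K f" for f :: "complex \<Rightarrow> nat"
      by (rule continuous_on_compose2[OF that Tc]) (use TK(2) in blast)
    show "continuous_on ?K (\<lambda>z. I z n)" unfolding I_def using c[OF pc] c[OF qc] by (cases "even n") simp_all
  qed
  ultimately show thesis using that by blast
qed

text \<open>On a ball every letter of the itinerary is constant by connectedness, although distinct
  points have distinct itineraries.\<close>

lemma interior_filled: "interior (filled a) = {}"
proof (rule ccontr)
  assume "interior (filled a) \<noteq> {}"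
  then obtain z e where e: "e > 0" "ball z e \<subseteq> filled a" unfolding mem_interior by (metis ex_in_conv mem_interior)
  obtain I :: "complex \<Rightarrow> nat \<Rightarrow> nat" where I: "continuous_on (filled a) I" "inj_on I (filled a)" "I ` filled a = symbol_space 4"
    using filled_itineraries .
  have "closed (filled a)" using compact_filled[OF a0] compact_imp_closed by blast
  have rng: "I w n \<in> {1..4}" if "w \<in> filled a" for w n using I(3) that unfolding symbol_space_def by blast
  have const: "I w n = I z n" if w: "w \<in> ball z e" for w n
  proof -
    have In: "continuous_on (filled a) (\<lambda>w. I w n)"
      by (rule continuous_on_product_then_coordinatewise[OF I(1)])
    have "continuous_on (filled a) (\<lambda>w. real (I w n))"
    proof (rule continuous_on_finite_fibres[OF \<open>closed (filled a)\<close>])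
      show "finite ((\<lambda>w. real (I w n)) ` filled a)"
        by (rule finite_subset[of _ "real ` {1..4}"]) (use rng in blast)+
      show "closed {w \<in> filled a. real (I w n) = c}" for c
      proof (cases "c \<in> \<nat>")
        case True
        then obtain k where "c = real k" by (auto elim: Nats_cases)
        then have "{w \<in> filled a. real (I w n) = c} = (\<lambda>w. I w n) -` {k} \<inter> filled a" by auto
        then show ?thesis using In unfolding continuous_on_closed_vimage[OF \<open>closed (filled a)\<close>] by simp
      next
        case False
        then have "{w \<in> filled a. real (I w n) = c} = {}" by auto
        then show ?thesis by (simp only: closed_empty)
      qed
    qed
    then have c: "continuous_on (ball z e) (\<lambda>w. real (I w n))" using e(2) continuous_on_subset by blast
    have "finite ((\<lambda>w. real (I w n)) ` ball z e)"
      by (rule finite_subset[of _ "real ` {1..4}"]) (use rng e(2) in blast)+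
    from continuous_finite_range_constant[OF connected_ball c this]
    have "real (I w n) = real (I z n)" using w e(1) unfolding constant_on_def by (metis centre_in_ball)
    then show ?thesis by simp
  qed
  define w where "w = z + of_real (e / 2)"
  have w: "w \<in> ball z e" "w \<noteq> z" using e(1) by (auto simp: w_def dist_norm)
  have "I w = I z" using const[OF w(1)] by blast
  moreover have "w \<in> filled a" "z \<in> filled a" using w(1) e by auto
  ultimately show False using w(2) I(2) by (metis inj_on_eq_iff)
qed

section \<open>The Julia set, its topology and hyperbolicity\<close>

lemma julia_eq: "julia_set (quartic a) = Fin ` filled a"
  using outside_filled_fatou[OF a0] filled_subset_julia[OF a0 interior_filled] unfolding julia_set_def by blast

lemma Cantor: "Cantor_map 4 (quartic a)"
proof -
  obtain I :: "complex \<Rightarrow> nat \<Rightarrow> nat" where I: "continuous_on (filled a) I" "inj_on I (filled a)" "I ` filled a = symbol_space 4"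
    using filled_itineraries .
  have "filled a homeomorphic symbol_space 4"
    by (rule homeomorphic_compact_sequences[OF compact_filled[OF a0] I(1,3,2)])
  moreover have "homeomorphism (filled a) (Fin ` filled a) Fin unFin"
    by (rule homeomorphism_of_subsets[OF homeomorphism_Fin]) auto
  then have "Fin ` filled a homeomorphic filled a" using homeomorphic_sym unfolding homeomorphic_def by blast
  ultimately show ?thesis unfolding Cantor_map_def julia_eq using homeomorphic_trans by blast
qed

text \<open>Poles go to infinity at once and the critical points with
  \<open>u = \<plusminus>1/2\<close> after two steps, so the orbit of 0 is the only other
  source.\<close>

lemma postcritical_subset: "postcritical_set (quartic a) \<subseteq> insert Infty (Fin ` postcrit a)"
proof
  fix x assume "x \<in> postcritical_set (quartic a)"
  then obtain k c where k: "k > 0" "x = (quartic a ^^ k) c" "critical_point (quartic a) c"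
    unfolding postcritical_set_def by blast
  obtain j where j: "k = Suc j" using k(1) by (cases k) auto
  have xj: "x = (quartic a ^^ j) (quartic a c)" using k(2) by (simp add: j funpow_Suc_right del: funpow.simps)
  show "x \<in> insert Infty (Fin ` postcrit a)"
  proof (cases c)
    case Infty
    then show ?thesis using xj by simp
  next
    case (Fin z)
    show ?thesis
    proof (cases "z\<^sup>2 = 1")
      case True
      then show ?thesis using xj Fin by (simp add: quartic.simps(1))
    next
      case False
      then have "z = 0 \<or> 2 * (a * (z\<^sup>2 - 1)) = 1 \<or> 2 * (a * (z\<^sup>2 - 1)) = - 1"
        using k(3) Fin critical_quartic[OF a0 False] qf'_zero_iff[OF a0 False] by simp
      then consider "z = 0" | e where "e = 1 \<or> e = - 1" "2 * (a * (z\<^sup>2 - 1)) = e" by blast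
      then show ?thesis
      proof cases
        case 1
        then have "x = iter a k 0" using k(2) Fin by simp
        then have "w \<in> postcrit a" if "x = Fin w" for w using k(1) that unfolding postcrit_def by auto
        then show ?thesis by (cases x) auto
      next
        case (2 e)
        define u where "u = a * (z\<^sup>2 - 1)"
        have "2 * u = e" using 2(2) by (simp add: u_def)
        have "e * e = 1" using 2(1) by auto
        have "4 * (u\<^sup>2 - e * u + 1/4) = (2 * u) * (2 * u) - 2 * e * (2 * u) + 1" by (simp add: algebra_simps power2_eq_square)
        then have "4 * (u\<^sup>2 - e * u + 1/4) = 0" unfolding \<open>2 * u = e\<close> using \<open>e * e = 1\<close> by (simp add: mult.assoc)
        then have "u\<^sup>2 - e * u + 1/4 = 0" by (simp only: mult_eq_0_iff) simp
        then have qe: "quartic a (Fin z) = Fin e" unfolding qf_eq_iff[OF a0] Let_def u_def .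
        show ?thesis
        proof (cases j)
          case 0
          then show ?thesis using xj Fin qe 2(1) by (auto simp: postcrit_def)
        next
          case (Suc i)
          have "e\<^sup>2 = 1" using \<open>e * e = 1\<close> by (simp add: power2_eq_square)
          then have "x = Infty" using xj Fin qe iter_Suc_pole[of e i a] Suc by simp
          then show ?thesis by simp
        qed
      qed
    qed
  qed
qed

lemma hyperbolic: "hyperbolic (quartic a)"
proof -
  define R where "R = escR a + 1"
  \<comment> \<open>Only finitely many postcritical points lie in the disc of radius
    \<open>R\<close>, and everything outside it is added. This gives a closed set that contains the
    postcritical set and misses the filled set.\<close>
  define T where "T = Fin ` (postcrit a \<inter> cball 0 R) \<union> - Fin ` ball 0 R"
  have "closed (Fin ` (postcrit a \<inter> cball 0 R))" using finite_postcrit_cball by (intro finite_imp_closed) auto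
  moreover have "closed (- Fin ` ball 0 R)" using open_Fin_image[OF open_ball] by (simp add: closed_Compl)
  ultimately have "closed T" by (simp add: T_def closed_Un)
  moreover have "postcritical_set (quartic a) \<subseteq> T"
    using postcritical_subset unfolding T_def by fastforce
  ultimately have "closure (postcritical_set (quartic a)) \<subseteq> T" by (simp add: closure_minimal)
  moreover have "T \<inter> Fin ` filled a = {}"
    using postcrit_filled filled_subset[of a] unfolding T_def R_def by fastforce
  ultimately show ?thesis unfolding hyperbolic_def julia_eq by blast
qed

end

text \<open>The map is \<open>r + 1 / q\<close>; a common divisor of \<open>q * r + 1\<close> and
  \<open>q\<close> divides 1.\<close>

lemma rational_map_quartic:
  assumes a: "a \<noteq> 0"
  shows "rational_map 4 (quartic a)"
proof -
  define q where "q = [:- 4 * a, 0, 4 * a:]"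
  define r where "r = [:- a, 0, a:]"
  have dq: "degree q = 2" and dr: "degree r = 2" using a by (simp_all add: q_def r_def)
  have q0: "q \<noteq> 0" and r0: "r \<noteq> 0" using a by (simp_all add: q_def r_def)
  have dqr: "degree (q * r) = 4" using degree_mult_eq[OF q0 r0] dq dr by simp
  then have dp: "degree (q * r + 1) = 4" by (simp add: degree_add_eq_left)
  have "coprime (q * r + 1) q"
  proof (rule coprimeI)
    fix c assume "c dvd q * r + 1" "c dvd q"
    then show "is_unit c" using dvd_add_right_iff[of c "q * r" 1] dvd_mult2 by blast
  qed
  moreover have "quartic a = rat_fun (q * r + 1) q"
  proof
    fix x show "quartic a x = rat_fun (q * r + 1) q x"
    proof (cases x)
      case Infty
      then show ?thesis using dp dq by simp
    next
      case (Fin z)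
      have pq: "poly q z = 4 * a * (z\<^sup>2 - 1)" and pr: "poly r z = a * (z\<^sup>2 - 1)"
        by (simp_all add: q_def r_def algebra_simps power2_eq_square)
      show ?thesis
      proof (cases "z\<^sup>2 - 1 = 0")
        case True
        then show ?thesis using Fin pq by (simp add: quartic.simps(1))
      next
        case False
        then have nz: "poly q z \<noteq> 0" using a pq by simp
        have "poly (q * r + 1) z / poly q z = poly r z + 1 / poly q z" using nz by (simp add: add_divide_distrib)
        then show ?thesis using Fin False nz by (simp add: quartic.simps(1) pq pr)
      qed
    qed
  qed
  ultimately show ?thesis unfolding rational_map_def using q0 dp dq by (intro exI[of _ "q * r + 1"] exI[of _ q]) simp
qed

text \<open>Non-injectivity is asserted on \<open>coding_domain\<close>, where the limits exist, so
  that it cannot be caused by arbitrary values of \<open>lim\<close>. The bound \<open>R\<close>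
  shows that the hypothesis on the second iterate does hold for all large parameters.\<close>

theorem theorem8:
  "(\<forall>a. a \<noteq> 0 \<longrightarrow> rational_map 4 (quartic a)) \<and>
   (\<exists>R. \<forall>a. a \<noteq> 0 \<and> R \<le> cmod a \<longrightarrow> s_Cantor (quartic a \<circ> quartic a)) \<and>
   (\<forall>a. a \<noteq> 0 \<and> s_Cantor (quartic a \<circ> quartic a) \<longrightarrow>
      \<not> t_Cantor 4 (quartic a) \<and>
      (\<forall>l. radial 4 (quartic a) l \<longrightarrow>
         \<not> inj_on (coding_map (quartic a) l) (coding_domain 4 (quartic a) l))) \<and>
   (\<exists>g. rational_map 4 g \<and> hyperbolic g \<and> Cantor_map 4 g \<and> \<not> s_Cantor g)"
proof (intro conjI)
  show "\<forall>a. a \<noteq> 0 \<longrightarrow> rational_map 4 (quartic a)" using rational_map_quartic by blast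
  show "\<exists>R. \<forall>a. a \<noteq> 0 \<and> R \<le> cmod a \<longrightarrow> s_Cantor (quartic a \<circ> quartic a)" using s_Cantor_quartic2 by blast
  show "\<forall>a. a \<noteq> 0 \<and> s_Cantor (quartic a \<circ> quartic a) \<longrightarrow> \<not> t_Cantor 4 (quartic a) \<and>
      (\<forall>l. radial 4 (quartic a) l \<longrightarrow> \<not> inj_on (coding_map (quartic a) l) (coding_domain 4 (quartic a) l))"
  proof (intro allI impI, elim conjE)
    fix a assume "a \<noteq> 0" "s_Cantor (quartic a \<circ> quartic a)"
    then obtain D where "disc a D" using disc_of_s_Cantor2 by blast
    then interpret disc a D .
    show "\<not> t_Cantor 4 (quartic a) \<and>
      (\<forall>l. radial 4 (quartic a) l \<longrightarrow> \<not> inj_on (coding_map (quartic a) l) (coding_domain 4 (quartic a) l))"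
      using not_t_Cantor radial_not_inj by simp
  qed
  define a :: complex where "a = 100000"
  have "a \<noteq> 0" "cmod a \<ge> 100000" by (simp_all add: a_def)
  then obtain D where "disc a D" using disc_of_s_Cantor2 s_Cantor_quartic2 by blast
  then interpret disc a D .
  show "\<exists>g. rational_map 4 g \<and> hyperbolic g \<and> Cantor_map 4 g \<and> \<not> s_Cantor g"
    using rational_map_quartic[OF a0] hyperbolic Cantor not_s_Cantor_quartic[OF a0] by blast
qed

end
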